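(* Let $M$ be a 6-dimensional abstract hyperbolic CR-manifold of CR-codimension two, with canonical regular normal Cartan geometry $(p:\mathcal G\to M,\omega)$ and curvature $\kappa$. The canonical almost complex structure $J$ on $T^{CR}M$ is integrable if and only if the part $\kappa^{(1)}_{aa}\in C^\infty(\mathcal G,\mathfrak g_{-1}^*\wedge\mathfrak g_{-1}^*\otimes\mathfrak g_{-1})$ of $\kappa^{(1)}$ which is antilinear in both arguments vanishes. In particular, this part of the torsion vanishes on the embedded 6-dimensional hyperbolic CR-manifolds (of CR-codimension two) in $\mathbb C^4$.
   Context: Algebra. $\mathfrak{su}(2,1)$ is the algebra of trace-free complex $3\times3$ matrices $X$ with $X^*S+SX=0$, $S$ the antidiagonal matrix with entries $1$, graded by $\mathfrak{su}(2,1)_k=\{X: X_{ij}=0\text{ unless }j-i=k\}$, $-2\le k\le2$. $\mathfrak g=\mathfrak g^L\oplus\mathfrak g^R$ is the sum of two copies, $\mathfrak g_k=\mathfrak g^L_k\oplus\mathfrak g^R_k$, $\mathfrak g_-=\mathfrak g_{-2}\oplus\mathfrak g_{-1}$, $\mathfrak p=\mathfrak g_0\oplus\mathfrak g_1\oplus\mathfrak g_2$, $\mathfrak p_+=\mathfrak g_1\oplus\mathfrak g_2$. In each copy, the degree $-1$ part is a complex line via the entry $X_{21}$ (then $X_{32}=-\overline{X_{21}}$); $i$ denotes the resulting complex structure on $\mathfrak g_{-1}\cong\mathbb C^2$. $G=((\mathrm{SU}(2,1)/\mathbb Z_3)\times(\mathrm{SU}(2,1)/\mathbb Z_3))\rtimes\mathbb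 Z_2$, $\mathbb Z_2$ interchanging the factors; $P\subset G$ consists of the elements whose adjoint action preserves the filtration $V^k=\bigoplus_{j\ge k}\mathfrak g_j$, and $G_0\subset P$ of those preserving each $\mathfrak g_k$. $P$ acts complex linearly on $\mathfrak g_{-1}\subset\mathfrak g/\mathfrak p$. Abstract hyperbolic CR-manifolds. A regular $(\mathfrak g,P)$-structure on a smooth manifold $M$ is a filtration $TM=T^{-2}M\supset T^{-1}M$ with a reduction of $\operatorname{Gr}TM=TM/T^{-1}M\oplus T^{-1}M$ to the structure group $G_0$ (fibre model $\mathfrak g_{-2}\oplus\mathfrak g_{-1}$), such that the tensorial bracket $T^{-1}M\times T^{-1}M\to TM/T^{-1}M$ induced by the Lie bracket of vector fields coincides with the one induced from the Lie bracket of $\mathfrak g_-$. An abstract hyperbolic 6-dimensional CR-manifold of CR-codimension two is a smooth 6-manifold with such a structure; $T^{CR}M=T^{-1}M$. Cartan connection. A Cartan connection of type $G/P$ on a principal $P$-bundle $p:\mathcal G\to M$ is a $P$-equivariant form $\omega\in\Omega^1(\mathcal G,\mathfrak g)$, reproducing generators in $\mathfrak p$ of fundamental fields and restricting to isomorphisms $T_u\mathcal G\to\mathfrak g$; $\omega^{-1}(X)$ is the field with $\omega(\omega^{-1}(X))=X$. Its curvature is $\kappa(u)(X,Y)=[X,Y]-\omega([\omega^{-1}(X),\omega^{-1}(Y)](u))$, $X,Y\in\mathfrak g_-$, with components $\kappa^{(k)}:\mathfrak g_i\times\mathfrak g_j\to\mathfrak g_{i+j+k}$; the torsion is its $\mathfrak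 g_-$-valued part. It is regular if $\kappa^{(k)}=0$ for $k\le0$, and normal if $\partial^*\circ\kappa=0$, where $\mathfrak g_-^*\cong\mathfrak p_+$ via the Killing form and $\partial^*(Z_1\wedge Z_2\otimes A)=-Z_2\otimes[Z_1,A]+Z_1\otimes[Z_2,A]-[Z_1,Z_2]\otimes A$. By the general theory there is a regular normal Cartan geometry $(\mathcal G,\omega)$, unique up to isomorphism, inducing the given structure ($T^{-1}M=Tp(\omega^{-1}(\mathfrak g_{-1}\oplus\mathfrak p))$, $G_0$-frames induced by $X\mapsto Tp\,\omega^{-1}(X)(u)$). $J$ is defined by $J(Tp\,\omega^{-1}(X)(u))=Tp\,\omega^{-1}(iX)(u)$, $X\in\mathfrak g_{-1}$. It is integrable if the $(0,1)$-subbundle (equivalently the $(1,0)$-subbundle) of $T^{CR}M\otimes\mathbb C$ is involutive. For $X,Y\in\mathfrak g_{-1}$, $\kappa^{(1)}_{aa}(X,Y)=\frac14\bigl(\kappa^{(1)}(X,Y)-\kappa^{(1)}(iX,iY)+i\kappa^{(1)}(iX,Y)+i\kappa^{(1)}(X,iY)\bigr)$. Embedded manifolds. For a real 6-dimensional submanifold $M\subset\mathbb C^4$ with $T^{CR}M=TM\cap iTM$ of real rank 4 (CR-codimension two), a point is hyperbolic if in suitable holomorphic coordinates $(z,w)\in\mathbb C^2\times\mathbb C^2$, $w=u+iv$, centred there $M$ is $v_1=|z_1|^2+O(3)$, $v_2=|z_2|^2+O(3)$. $M$ is hyperbolic if all its points are. It carries the regular $(\mathfrak g,P)$-structure with $T^{-1}M=T^{CR}M$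 whose $G_0$-frames at $x$ are the graded isomorphisms $\mathfrak g_-\to\operatorname{Gr}T_xM$ which are complex linear on $\mathfrak g_{-1}$ and intertwine the bracket of $\mathfrak g_-$ with the bracket $T^{CR}M\times T^{CR}M\to TM/T^{CR}M$ induced by the Lie bracket of vector fields; then $J$ is the complex structure inherited from $\mathbb C^4$. *)

theory Defs
  imports "HOL-Analysis.Analysis" "HOL-Library.Landau_Symbols" "HOL-Algebra.Coset"
begin

section \<open>Smooth manifolds\<close>

primrec Ck_on :: "nat \<Rightarrow> 'a::real_normed_vector set \<Rightarrow> ('a \<Rightarrow> 'b::real_normed_vector) \<Rightarrow> bool" where
  "Ck_on 0 U = (\<lambda>f. continuous_on U f)"
| "Ck_on (Suc k) U = (\<lambda>f. (\<forall>x\<in>U. f differentiable (at x)) \<and>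
     (\<forall>v. Ck_on k U (\<lambda>x. frechet_derivative f (at x) v)))"

text \<open>Only meaningful for open \<open>U\<close>.\<close>

definition smooth_on :: "'a::real_normed_vector set \<Rightarrow> ('a \<Rightarrow> 'b::real_normed_vector) \<Rightarrow> bool" where
  "smooth_on U f \<longleftrightarrow> (\<forall>k. Ck_on k U f)"

text \<open>
  A manifold is given by an atlas on a set; the atlas determines the topology as the one for
  which all chart domains are open and all charts are homeomorphisms onto open sets. Chart
  maps are total functions that matter only on the chart domain.
\<close>

type_synonym ('a, 'e) chart = "'a set \<times> ('a \<Rightarrow> 'e)"

definition cinv :: "('a, 'e) chart \<Rightarrow> 'e \<Rightarrow> 'a" where
  "cinv c = inv_into (fst c) (snd c)"

definition smooth_atlas :: "('a, 'e::euclidean_space) chart set \<Rightarrow> bool" where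
  "smooth_atlas A \<longleftrightarrow>
     (\<forall>c\<in>A. inj_on (snd c) (fst c) \<and> open (snd c ` fst c)) \<and>
     (\<forall>c\<in>A. \<forall>d\<in>A. open (snd c ` (fst c \<inter> fst d)) \<and>
        smooth_on (snd c ` (fst c \<inter> fst d)) (snd d \<circ> cinv c))"

definition mcarrier :: "('a, 'e) chart set \<Rightarrow> 'a set" where
  "mcarrier A = (\<Union>c\<in>A. fst c)"

definition mtopology :: "('a, 'e::euclidean_space) chart set \<Rightarrow> 'a topology" where
  "mtopology A = topology (\<lambda>U. U \<subseteq> mcarrier A \<and> (\<forall>c\<in>A. open (snd c ` (U \<inter> fst c))))"

definition smooth_manifold :: "('a, 'e::euclidean_space) chart set \<Rightarrow> bool" where
  "smooth_manifold A \<longleftrightarrow> smooth_atlas A \<and> Hausdorff_space (mtopology A) \<and>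
     second_countable (mtopology A)"

definition restrict_atlas :: "('a, 'e) chart set \<Rightarrow> 'a set \<Rightarrow> ('a, 'e) chart set" where
  "restrict_atlas A U = (\<lambda>c. (fst c \<inter> U, snd c)) ` A"

definition prod_atlas ::
  "('a, 'e) chart set \<Rightarrow> ('b, 'f) chart set \<Rightarrow> ('a \<times> 'b, 'e \<times> 'f) chart set" where
  "prod_atlas A B = (\<lambda>(c, d). (fst c \<times> fst d, map_prod (snd c) (snd d))) ` (A \<times> B)"

definition smooth_map ::
  "('a, 'e::euclidean_space) chart set \<Rightarrow> ('b, 'f::euclidean_space) chart set \<Rightarrow> ('a \<Rightarrow> 'b) \<Rightarrow> bool" where
  "smooth_map A B f \<longleftrightarrow> continuous_map (mtopology A) (mtopology B) f \<and>
     (\<forall>c\<in>A. \<forall>d\<in>B. smooth_on (snd c ` (fst c \<inter> f -` fst d)) (snd d \<circ> f \<circ> cinv c))"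

definition diffeomorphism ::
  "('a, 'e::euclidean_space) chart set \<Rightarrow> ('b, 'f::euclidean_space) chart set \<Rightarrow> ('a \<Rightarrow> 'b) \<Rightarrow> bool" where
  "diffeomorphism A B f \<longleftrightarrow> bij_betw f (mcarrier A) (mcarrier B) \<and> smooth_map A B f \<and>
     smooth_map B A (inv_into (mcarrier A) f)"

text \<open>
  Tangent vectors at \<open>x\<close> are represented by their coordinates in one fixed chart around \<open>x\<close>, so
  each tangent space is the model space \<open>'e\<close> itself. The choice \<open>chart_at\<close> need not vary
  continuously with \<open>x\<close>; smoothness and brackets of vector fields are therefore always expressed
  by first converting to the coordinates of a single chart \<open>c\<close> (\<open>tcoord\<close>, \<open>vf_rep\<close>).
\<close>

definition chart_at :: "('a, 'e) chart set \<Rightarrow> 'a \<Rightarrow> ('a, 'e) chart" where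
  "chart_at A x = (SOME c. c \<in> A \<and> x \<in> fst c)"

definition tcoord :: "('a, 'e::euclidean_space) chart set \<Rightarrow> ('a, 'e) chart \<Rightarrow> 'a \<Rightarrow> 'e \<Rightarrow> 'e" where
  "tcoord A c x v =
     frechet_derivative (snd c \<circ> cinv (chart_at A x)) (at (snd (chart_at A x) x)) v"

definition tmap ::
  "('a, 'e::euclidean_space) chart set \<Rightarrow> ('b, 'f::euclidean_space) chart set \<Rightarrow> ('a \<Rightarrow> 'b) \<Rightarrow> 'a \<Rightarrow> 'e \<Rightarrow> 'f" where
  "tmap A B f x v =
     frechet_derivative (snd (chart_at B (f x)) \<circ> f \<circ> cinv (chart_at A x))
       (at (snd (chart_at A x) x)) v"

definition curve_velocity :: "('a, 'e::euclidean_space) chart set \<Rightarrow> (real \<Rightarrow> 'a) \<Rightarrow> 'e" where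
  "curve_velocity A \<gamma> = vector_derivative (\<lambda>t. snd (chart_at A (\<gamma> 0)) (\<gamma> t)) (at 0)"

definition vf_rep :: "('a, 'e::euclidean_space) chart set \<Rightarrow> ('a, 'e) chart \<Rightarrow> ('a \<Rightarrow> 'e) \<Rightarrow> 'e \<Rightarrow> 'e" where
  "vf_rep A c \<xi> y = tcoord A c (cinv c y) (\<xi> (cinv c y))"

definition smooth_vf :: "('a, 'e::euclidean_space) chart set \<Rightarrow> 'a set \<Rightarrow> ('a \<Rightarrow> 'e) \<Rightarrow> bool" where
  "smooth_vf A U \<xi> \<longleftrightarrow> (\<forall>c\<in>A. smooth_on (snd c ` (fst c \<inter> U)) (vf_rep A c \<xi>))"

definition smooth_fun ::
  "('a, 'e::euclidean_space) chart set \<Rightarrow> 'a set \<Rightarrow> ('a \<Rightarrow> 'b::real_normed_vector) \<Rightarrow> bool" where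
  "smooth_fun A U f \<longleftrightarrow> (\<forall>c\<in>A. smooth_on (snd c ` (fst c \<inter> U)) (f \<circ> cinv c))"

definition smooth_one_form ::
  "('a, 'e::euclidean_space) chart set \<Rightarrow> ('a \<Rightarrow> 'e \<Rightarrow> 'b::real_normed_vector) \<Rightarrow> bool" where
  "smooth_one_form A \<omega> \<longleftrightarrow> (\<forall>x\<in>mcarrier A. linear (\<omega> x)) \<and>
     (\<forall>U \<xi>. openin (mtopology A) U \<and> smooth_vf A U \<xi> \<longrightarrow> smooth_fun A U (\<lambda>x. \<omega> x (\<xi> x)))"

definition lie_bracket ::
  "('a, 'e::euclidean_space) chart set \<Rightarrow> ('a \<Rightarrow> 'e) \<Rightarrow> ('a \<Rightarrow> 'e) \<Rightarrow> 'a \<Rightarrow> 'e" where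
  "lie_bracket A \<xi> \<eta> x = (let c = chart_at A x in
     frechet_derivative (vf_rep A c \<eta>) (at (snd c x)) (\<xi> x) -
     frechet_derivative (vf_rep A c \<xi>) (at (snd c x)) (\<eta> x))"

text \<open>
  All charts of a subset \<open>S\<close> of a Euclidean space that are restrictions of smooth maps on open
  sets and have smooth inverses. \<open>S\<close> is an embedded submanifold iff their domains cover \<open>S\<close>.
\<close>

definition submanifold_charts :: "'v::euclidean_space set \<Rightarrow> ('v, 'e::euclidean_space) chart set" where
  "submanifold_charts S = {(U, \<phi>). \<exists>W \<Phi>. open W \<and> U = S \<inter> W \<and> smooth_on W \<Phi> \<and>
     (\<forall>x\<in>U. \<phi> x = \<Phi> x) \<and> inj_on \<phi> U \<and> open (\<phi> ` U) \<and> smooth_on (\<phi> ` U) (inv_into U \<phi>)}"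


section \<open>The graded Lie algebra and its groups\<close>

type_synonym cmat3 = "complex^3^3"

text \<open>Positions \<open>1, 2, 3\<close> as integers; the index type \<open>3\<close> itself has \<open>3 = 0\<close>.\<close>

definition pos3 :: "3 \<Rightarrow> int" where
  "pos3 i = (if i = 1 then 1 else if i = 2 then 2 else 3)"

definition ctranspose :: "cmat3 \<Rightarrow> cmat3" where
  "ctranspose X = (\<chi> i j. cnj (X$j$i))"

definition Smat :: cmat3 where
  "Smat = (\<chi> i j. if pos3 i + pos3 j = 4 then 1 else 0)"

definition su21 :: "cmat3 set" where
  "su21 = {X. trace X = 0 \<and> ctranspose X ** Smat + Smat ** X = 0}"

definition su21_grade :: "int \<Rightarrow> cmat3 set" where
  "su21_grade k = {X\<in>su21. \<forall>i j. pos3 j - pos3 i \<noteq> k \<longrightarrow> X$i$j = 0}"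

type_synonym gvec = "cmat3 \<times> cmat3"

definition galg :: "gvec set" where
  "galg = su21 \<times> su21"

definition gbr :: "gvec \<Rightarrow> gvec \<Rightarrow> gvec" where
  "gbr X Y = (fst X ** fst Y - fst Y ** fst X, snd X ** snd Y - snd Y ** snd X)"

definition ggr :: "int \<Rightarrow> gvec set" where
  "ggr k = su21_grade k \<times> su21_grade k"

definition gfilt :: "int \<Rightarrow> gvec set" where
  "gfilt k = span (\<Union>j\<in>{k..}. ggr j)"

definition gminus :: "gvec set" where
  "gminus = span (ggr (-2) \<union> ggr (-1))"

abbreviation palg :: "gvec set" where
  "palg \<equiv> gfilt 0"

abbreviation pplus :: "gvec set" where
  "pplus \<equiv> gfilt 1"

text \<open>The projection of \<open>galg\<close> onto \<open>ggr k\<close> along the other grading components.\<close>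

definition gproj :: "int \<Rightarrow> gvec \<Rightarrow> gvec" where
  "gproj k X = (let pr = (\<lambda>Y::cmat3. \<chi> i j. if pos3 j - pos3 i = k then Y$i$j else 0)
     in (pr (fst X), pr (snd X)))"

text \<open>
  The complex structure on \<open>ggr (-1)\<close>: the entry \<open>X$2$1\<close> is multiplied by \<open>\<i>\<close>, hence
  \<open>X$3$2 = - cnj (X$2$1)\<close> by \<open>- \<i>\<close>.
\<close>

definition cxm :: "gvec \<Rightarrow> gvec" where
  "cxm X = (let I = (\<lambda>Y::cmat3. \<chi> i j. if i = 2 \<and> j = 1 then \<i> * Y$2$1
                                 else if i = 3 \<and> j = 2 then - \<i> * Y$3$2 else 0)
     in (I (fst X), I (snd X)))"

text \<open>The trace of a linear endomorphism \<open>f\<close> of a subspace \<open>V\<close>.\<close>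

definition trace_on :: "'a::real_vector set \<Rightarrow> ('a \<Rightarrow> 'a) \<Rightarrow> real" where
  "trace_on V f = (let B = (SOME B. independent B \<and> span B = V)
     in \<Sum>b\<in>B. representation B (f b) b)"

definition killing :: "gvec \<Rightarrow> gvec \<Rightarrow> real" where
  "killing X Y = trace_on galg (\<lambda>Z. gbr X (gbr Y Z))"

definition SU21 :: "cmat3 monoid" where
  "SU21 = \<lparr>carrier = {A. ctranspose A ** Smat ** A = Smat \<and> det A = 1},
           mult = (\<lambda>A B. A ** B), one = mat 1\<rparr>"

definition Zthree :: "cmat3 set" where
  "Zthree = {mat \<zeta> |\<zeta>. \<zeta>^3 = 1}"

abbreviation PSU21 :: "cmat3 set monoid" where
  "PSU21 \<equiv> SU21 Mod Zthree"

text \<open>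
  The semidirect product with the group of two elements; \<open>True\<close> is the generator, which
  interchanges the factors.
\<close>

type_synonym gelt = "(cmat3 set \<times> cmat3 set) \<times> bool"

definition Ggrp :: "gelt monoid" where
  "Ggrp = \<lparr>carrier = carrier (PSU21 \<times>\<times> PSU21) \<times> UNIV,
           mult = (\<lambda>(a, s) (b, t). (a \<otimes>\<^bsub>PSU21 \<times>\<times> PSU21\<^esub> (if s then prod.swap b else b), s \<noteq> t)),
           one = (\<one>\<^bsub>PSU21 \<times>\<times> PSU21\<^esub>, False)\<rparr>"

definition Ad :: "gelt \<Rightarrow> gvec \<Rightarrow> gvec" where
  "Ad a X = (let A = (SOME A. A \<in> fst (fst a)); B = (SOME B. B \<in> snd (fst a));
                 Y = (if snd a then prod.swap X else X)
     in (A ** fst Y ** matrix_inv A, B ** snd Y ** matrix_inv B))"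

definition Pset :: "gelt set" where
  "Pset = {a\<in>carrier Ggrp. \<forall>k. Ad a ` gfilt k \<subseteq> gfilt k}"

definition G0set :: "gelt set" where
  "G0set = {a\<in>Pset. \<forall>k. Ad a ` ggr k \<subseteq> ggr k}"

definition gquot :: "bool \<Rightarrow> cmat3 \<times> cmat3 \<Rightarrow> gelt" where
  "gquot s AB = ((Zthree #>\<^bsub>SU21\<^esub> fst AB, Zthree #>\<^bsub>SU21\<^esub> snd AB), s)"

text \<open>
  The smooth structure of \<open>Pset\<close>: its preimage in pairs of matrices is an embedded submanifold of
  dimension 10 (for either value of \<open>s\<close>), and \<open>gquot s\<close> is a covering with fibres of nine
  elements. The charts are those induced by submanifold charts on whose domain \<open>gquot s\<close> is
  injective.
\<close>

definition P_atlas :: "(gelt, real^10) chart set" where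
  "P_atlas = {(gquot s ` U, \<phi>) | s U \<phi>.
     (U, \<phi> \<circ> gquot s) \<in>
       submanifold_charts {AB \<in> carrier SU21 \<times> carrier SU21. gquot s AB \<in> Pset} \<and>
     inj_on (gquot s) U}"

primrec mpow :: "cmat3 \<Rightarrow> nat \<Rightarrow> cmat3" where
  "mpow X 0 = mat 1"
| "mpow X (Suc n) = X ** mpow X n"

definition mexp :: "cmat3 \<Rightarrow> cmat3" where
  "mexp X = (\<Sum>n. (1 / fact n) *\<^sub>R mpow X n)"

definition gexp :: "gvec \<Rightarrow> gelt" where
  "gexp X = gquot False (mexp (fst X), mexp (snd X))"


section \<open>Cartan geometries of type $G/P$\<close>

text \<open>In the following \<open>A\<close> is the base, \<open>B\<close> the total space, \<open>p\<close> the projection, \<open>r\<close> the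
  right action of the structure group.\<close>

definition principal_P_bundle ::
  "('m, 'e::euclidean_space) chart set \<Rightarrow> ('g, 'f::euclidean_space) chart set \<Rightarrow>
   ('g \<Rightarrow> 'm) \<Rightarrow> ('g \<Rightarrow> gelt \<Rightarrow> 'g) \<Rightarrow> bool" where
  "principal_P_bundle A B p r \<longleftrightarrow>
     smooth_manifold A \<and> smooth_manifold B \<and> smooth_map B A p \<and>
     smooth_map (prod_atlas B P_atlas) B (\<lambda>(u, a). r u a) \<and>
     (\<forall>u\<in>mcarrier B. r u \<one>\<^bsub>Ggrp\<^esub> = u) \<and>
     (\<forall>u\<in>mcarrier B. \<forall>a\<in>Pset. \<forall>b\<in>Pset. r (r u a) b = r u (a \<otimes>\<^bsub>Ggrp\<^esub> b)) \<and>
     (\<forall>u\<in>mcarrier B. \<forall>a\<in>Pset. p (r u a) = p u) \<and>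
     (\<forall>x\<in>mcarrier A. \<exists>U \<psi>. openin (mtopology A) U \<and> x \<in> U \<and>
        diffeomorphism (restrict_atlas B (p -` U)) (prod_atlas (restrict_atlas A U) P_atlas)
          (\<lambda>u. (p u, \<psi> u)) \<and>
        (\<forall>u\<in>mcarrier B \<inter> p -` U. \<forall>a\<in>Pset. \<psi> (r u a) = \<psi> u \<otimes>\<^bsub>Ggrp\<^esub> a))"

definition cartan_connection ::
  "('g, 'f::euclidean_space) chart set \<Rightarrow> ('g \<Rightarrow> gelt \<Rightarrow> 'g) \<Rightarrow> ('g \<Rightarrow> 'f \<Rightarrow> gvec) \<Rightarrow> bool" where
  "cartan_connection B r \<omega> \<longleftrightarrow>
     smooth_one_form B \<omega> \<and>
     (\<forall>u\<in>mcarrier B. bij_betw (\<omega> u) UNIV galg) \<and>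
     (\<forall>u\<in>mcarrier B. \<forall>a\<in>Pset. \<forall>v.
        \<omega> (r u a) (tmap B B (\<lambda>u. r u a) u v) = Ad (inv\<^bsub>Ggrp\<^esub> a) (\<omega> u v)) \<and>
     (\<forall>u\<in>mcarrier B. \<forall>X\<in>palg. \<omega> u (curve_velocity B (\<lambda>t. r u (gexp (t *\<^sub>R X)))) = X)"

definition omega_inv :: "('g \<Rightarrow> 'f \<Rightarrow> gvec) \<Rightarrow> gvec \<Rightarrow> 'g \<Rightarrow> 'f" where
  "omega_inv \<omega> X u = inv_into UNIV (\<omega> u) X"

definition curvature ::
  "('g, 'f::euclidean_space) chart set \<Rightarrow> ('g \<Rightarrow> 'f \<Rightarrow> gvec) \<Rightarrow> 'g \<Rightarrow> gvec \<Rightarrow> gvec \<Rightarrow> gvec" where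
  "curvature B \<omega> u X Y = gbr X Y - \<omega> u (lie_bracket B (omega_inv \<omega> X) (omega_inv \<omega> Y) u)"

definition curvature_comp ::
  "int \<Rightarrow> ('g, 'f::euclidean_space) chart set \<Rightarrow> ('g \<Rightarrow> 'f \<Rightarrow> gvec) \<Rightarrow> 'g \<Rightarrow> gvec \<Rightarrow> gvec \<Rightarrow> gvec" where
  "curvature_comp k B \<omega> u X Y =
     (\<Sum>i\<in>{-2,-1}. \<Sum>j\<in>{-2,-1}. gproj (i + j + k) (curvature B \<omega> u (gproj i X) (gproj j Y)))"

definition curvature_aa ::
  "('g, 'f::euclidean_space) chart set \<Rightarrow> ('g \<Rightarrow> 'f \<Rightarrow> gvec) \<Rightarrow> 'g \<Rightarrow> gvec \<Rightarrow> gvec \<Rightarrow> gvec" where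
  "curvature_aa B \<omega> u X Y = (let K = curvature_comp 1 B \<omega> u in
     (1/4) *\<^sub>R (K X Y - K (cxm X) (cxm Y) + cxm (K (cxm X) Y) + cxm (K X (cxm Y))))"

text \<open>
  A triple \<open>(Z1, Z2, A)\<close> stands for the decomposable element \<open>Z1 \<and> Z2 \<otimes> A\<close> of
  \<open>\<Lambda>\<^sup>2 pplus \<otimes> galg\<close>, regarded as an alternating map on \<open>gminus\<close> through the Killing form.
  \<open>codiff\<close> extends the defining formula linearly to sums of such elements; the result does not
  depend on the chosen decomposition, as the formula is alternating in \<open>Z1, Z2\<close> and linear in
  each entry.
\<close>

definition decomp_form :: "gvec \<times> gvec \<times> gvec \<Rightarrow> gvec \<Rightarrow> gvec \<Rightarrow> gvec" where
  "decomp_form = (\<lambda>(Z1, Z2, A) X Y.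
     (killing Z1 X * killing Z2 Y - killing Z2 X * killing Z1 Y) *\<^sub>R A)"

definition decomp_codiff :: "gvec \<times> gvec \<times> gvec \<Rightarrow> gvec \<Rightarrow> gvec" where
  "decomp_codiff = (\<lambda>(Z1, Z2, A) X.
     - (killing Z2 X *\<^sub>R gbr Z1 A) + killing Z1 X *\<^sub>R gbr Z2 A - killing (gbr Z1 Z2) X *\<^sub>R A)"

definition codiff :: "(gvec \<Rightarrow> gvec \<Rightarrow> gvec) \<Rightarrow> gvec \<Rightarrow> gvec" where
  "codiff \<phi> X = (let ts = (SOME ts. set ts \<subseteq> pplus \<times> pplus \<times> galg \<and>
        (\<forall>X\<in>gminus. \<forall>Y\<in>gminus. \<phi> X Y = (\<Sum>t\<leftarrow>ts. decomp_form t X Y)))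
     in \<Sum>t\<leftarrow>ts. decomp_codiff t X)"

definition regular_connection ::
  "('g, 'f::euclidean_space) chart set \<Rightarrow> ('g \<Rightarrow> 'f \<Rightarrow> gvec) \<Rightarrow> bool" where
  "regular_connection B \<omega> \<longleftrightarrow> (\<forall>u\<in>mcarrier B. \<forall>k\<le>0. \<forall>X\<in>gminus. \<forall>Y\<in>gminus.
     curvature_comp k B \<omega> u X Y = 0)"

definition normal_connection ::
  "('g, 'f::euclidean_space) chart set \<Rightarrow> ('g \<Rightarrow> 'f \<Rightarrow> gvec) \<Rightarrow> bool" where
  "normal_connection B \<omega> \<longleftrightarrow>
     (\<forall>u\<in>mcarrier B. \<forall>X\<in>gminus. codiff (curvature B \<omega> u) X = 0)"


section \<open>Regular $(\mathfrak g, P)$-structures\<close>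

text \<open>
  \<open>E x\<close> is the filtration component $T^{-1}_xM$. A graded frame at \<open>x\<close> is a pair of maps on
  \<open>ggr (-2)\<close> and on \<open>ggr (-1)\<close>, the former with values in the quotient of the tangent space by
  \<open>E x\<close>, whose elements are the cosets \<open>(+) v ` E x\<close>. Both maps are extensional, so that frames
  are determined by their values on the respective grading component.
\<close>

type_synonym 'e gframe = "(gvec \<Rightarrow> 'e set) \<times> (gvec \<Rightarrow> 'e)"

definition gr_isos :: "'e::euclidean_space set \<Rightarrow> 'e gframe set" where
  "gr_isos E = {(\<alpha>, \<beta>).
     \<alpha> \<in> extensional (ggr (-2)) \<and>
     bij_betw \<alpha> (ggr (-2)) (range (\<lambda>v. (+) v ` E)) \<and>
     (\<forall>X\<in>ggr (-2). \<forall>Y\<in>ggr (-2). \<forall>s t. \<forall>v\<in>\<alpha> X. \<forall>w\<in>\<alpha> Y.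
        s *\<^sub>R v + t *\<^sub>R w \<in> \<alpha> (s *\<^sub>R X + t *\<^sub>R Y)) \<and>
     \<beta> \<in> extensional (ggr (-1)) \<and>
     bij_betw \<beta> (ggr (-1)) E \<and>
     (\<forall>X\<in>ggr (-1). \<forall>Y\<in>ggr (-1). \<forall>s t. \<beta> (s *\<^sub>R X + t *\<^sub>R Y) = s *\<^sub>R \<beta> X + t *\<^sub>R \<beta> Y)}"

definition frame_act :: "'e gframe \<Rightarrow> gelt \<Rightarrow> 'e gframe" where
  "frame_act f a = (restrict (fst f \<circ> Ad a) (ggr (-2)), restrict (snd f \<circ> Ad a) (ggr (-1)))"

definition smooth_section ::
  "('m, 'e::euclidean_space) chart set \<Rightarrow> ('m \<Rightarrow> 'e set) \<Rightarrow> 'm set \<Rightarrow> ('m \<Rightarrow> 'e) \<Rightarrow> bool" where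
  "smooth_section A E U \<xi> \<longleftrightarrow> smooth_vf A U \<xi> \<and> (\<forall>x\<in>U. \<xi> x \<in> E x)"

text \<open>
  The bracket $T^{-1}M \times T^{-1}M \to TM/T^{-1}M$ at \<open>x\<close>: the class of \<open>[\<xi>, \<eta>](x)\<close> for any local
  sections \<open>\<xi>\<close>, \<open>\<eta>\<close> through \<open>v\<close>, \<open>w\<close>, written as the union of these classes over all \<open>\<xi>\<close>, \<open>\<eta>\<close>.
\<close>

definition levi_bracket ::
  "('m, 'e::euclidean_space) chart set \<Rightarrow> ('m \<Rightarrow> 'e set) \<Rightarrow> 'm \<Rightarrow> 'e \<Rightarrow> 'e \<Rightarrow> 'e set" where
  "levi_bracket A E x v w = {lie_bracket A \<xi> \<eta> x + e | \<xi> \<eta> e U.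
     openin (mtopology A) U \<and> x \<in> U \<and> smooth_section A E U \<xi> \<and> smooth_section A E U \<eta> \<and>
     \<xi> x = v \<and> \<eta> x = w \<and> e \<in> E x}"

definition bracket_compatible ::
  "('m, 'e::euclidean_space) chart set \<Rightarrow> ('m \<Rightarrow> 'e set) \<Rightarrow> 'm \<Rightarrow> 'e gframe \<Rightarrow> bool" where
  "bracket_compatible A E x f \<longleftrightarrow> (\<forall>X\<in>ggr (-1). \<forall>Y\<in>ggr (-1).
     levi_bracket A E x (snd f X) (snd f Y) = fst f (gbr X Y))"

text \<open>
  \<open>Fr x\<close> is the set of graded frames at \<open>x\<close> belonging to the reduction to \<open>G0set\<close>; the second
  clause says that locally it is the orbit of a smooth family of graded frames.
\<close>

definition regular_gP_structure ::
  "('m, 'e::euclidean_space) chart set \<Rightarrow> ('m \<Rightarrow> 'e set) \<Rightarrow> ('m \<Rightarrow> 'e gframe set) \<Rightarrow> bool" where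
  "regular_gP_structure A E Fr \<longleftrightarrow>
     (\<forall>x\<in>mcarrier A. subspace (E x) \<and> Fr x \<subseteq> gr_isos (E x)) \<and>
     (\<forall>x\<in>mcarrier A. \<exists>U f. openin (mtopology A) U \<and> x \<in> U \<and>
        (\<forall>y\<in>U. f y \<in> gr_isos (E y) \<and> Fr y = frame_act (f y) ` G0set) \<and>
        (\<forall>X\<in>ggr (-1). smooth_vf A U (\<lambda>y. snd (f y) X)) \<and>
        (\<forall>X\<in>ggr (-2). \<exists>\<zeta>. smooth_vf A U \<zeta> \<and> (\<forall>y\<in>U. \<zeta> y \<in> fst (f y) X))) \<and>
     (\<forall>x\<in>mcarrier A. \<forall>f\<in>Fr x. bracket_compatible A E x f)"

definition abstract_hyperbolic_CR ::
  "('m, real^6) chart set \<Rightarrow> ('m \<Rightarrow> (real^6) set) \<Rightarrow> ('m \<Rightarrow> (real^6) gframe set) \<Rightarrow> bool" where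
  "abstract_hyperbolic_CR A E Fr \<longleftrightarrow> smooth_manifold A \<and> regular_gP_structure A E Fr"

definition proj_omega_inv ::
  "('m, 'e::euclidean_space) chart set \<Rightarrow> ('g, 'f::euclidean_space) chart set \<Rightarrow>
   ('g \<Rightarrow> 'm) \<Rightarrow> ('g \<Rightarrow> 'f \<Rightarrow> gvec) \<Rightarrow> gvec \<Rightarrow> 'g \<Rightarrow> 'e" where
  "proj_omega_inv A B p \<omega> X u = tmap B A p u (omega_inv \<omega> X u)"

definition induces_structure ::
  "('m, 'e::euclidean_space) chart set \<Rightarrow> ('m \<Rightarrow> 'e set) \<Rightarrow> ('m \<Rightarrow> 'e gframe set) \<Rightarrow>
   ('g, 'f::euclidean_space) chart set \<Rightarrow> ('g \<Rightarrow> 'm) \<Rightarrow> ('g \<Rightarrow> 'f \<Rightarrow> gvec) \<Rightarrow> bool" where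
  "induces_structure A E Fr B p \<omega> \<longleftrightarrow>
     (\<forall>u\<in>mcarrier B. E (p u) = (\<lambda>X. proj_omega_inv A B p \<omega> X u) ` gfilt (-1)) \<and>
     (\<forall>x\<in>mcarrier A. Fr x =
        {(restrict (\<lambda>X. (+) (proj_omega_inv A B p \<omega> X u) ` E x) (ggr (-2)),
          restrict (\<lambda>X. proj_omega_inv A B p \<omega> X u) (ggr (-1))) | u. u \<in> mcarrier B \<and> p u = x})"

definition canonical_cartan_geometry ::
  "('m, real^6) chart set \<Rightarrow> ('m \<Rightarrow> (real^6) set) \<Rightarrow> ('m \<Rightarrow> (real^6) gframe set) \<Rightarrow>
   ('g, real^16) chart set \<Rightarrow> ('g \<Rightarrow> 'm) \<Rightarrow> ('g \<Rightarrow> gelt \<Rightarrow> 'g) \<Rightarrow> ('g \<Rightarrow> real^16 \<Rightarrow> gvec) \<Rightarrow> bool" where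
  "canonical_cartan_geometry A E Fr B p r \<omega> \<longleftrightarrow>
     principal_P_bundle A B p r \<and> cartan_connection B r \<omega> \<and>
     regular_connection B \<omega> \<and> normal_connection B \<omega> \<and> induces_structure A E Fr B p \<omega>"

definition canonical_J ::
  "('m, 'e::euclidean_space) chart set \<Rightarrow> ('g, 'f::euclidean_space) chart set \<Rightarrow>
   ('g \<Rightarrow> 'm) \<Rightarrow> ('g \<Rightarrow> 'f \<Rightarrow> gvec) \<Rightarrow> 'm \<Rightarrow> 'e \<Rightarrow> 'e" where
  "canonical_J A B p \<omega> x v = (THE w. \<exists>u\<in>mcarrier B. \<exists>X\<in>ggr (-1). p u = x \<and>
     v = proj_omega_inv A B p \<omega> X u \<and> w = proj_omega_inv A B p \<omega> (cxm X) u)"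

text \<open>
  Complex tangent vectors \<open>v + \<i> w\<close> are represented as pairs \<open>(v, w)\<close>. The \<open>(0,1)\<close>-subspace is
  the \<open>- \<i>\<close>-eigenspace of the complex linear extension of \<open>J\<close>; note
  \<open>- \<i> (v + \<i> w) = w + \<i> (- v)\<close>.
\<close>

definition zero_one_space ::
  "('m \<Rightarrow> 'e::real_vector set) \<Rightarrow> ('m \<Rightarrow> 'e \<Rightarrow> 'e) \<Rightarrow> 'm \<Rightarrow> ('e \<times> 'e) set" where
  "zero_one_space E J x = {(v, w). v \<in> E x \<and> w \<in> E x \<and> J x v = w \<and> J x w = - v}"

definition complex_lie_bracket ::
  "('m, 'e::euclidean_space) chart set \<Rightarrow> ('m \<Rightarrow> 'e \<times> 'e) \<Rightarrow> ('m \<Rightarrow> 'e \<times> 'e) \<Rightarrow> 'm \<Rightarrow> 'e \<times> 'e" where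
  "complex_lie_bracket A Z W x =
     (lie_bracket A (fst \<circ> Z) (fst \<circ> W) x - lie_bracket A (snd \<circ> Z) (snd \<circ> W) x,
      lie_bracket A (fst \<circ> Z) (snd \<circ> W) x + lie_bracket A (snd \<circ> Z) (fst \<circ> W) x)"

definition smooth_complex_section ::
  "('m, 'e::euclidean_space) chart set \<Rightarrow> ('m \<Rightarrow> ('e \<times> 'e) set) \<Rightarrow> 'm set \<Rightarrow> ('m \<Rightarrow> 'e \<times> 'e) \<Rightarrow> bool" where
  "smooth_complex_section A D U Z \<longleftrightarrow> smooth_vf A U (fst \<circ> Z) \<and> smooth_vf A U (snd \<circ> Z) \<and>
     (\<forall>x\<in>U. Z x \<in> D x)"

definition complex_involutive ::
  "('m, 'e::euclidean_space) chart set \<Rightarrow> ('m \<Rightarrow> ('e \<times> 'e) set) \<Rightarrow> bool" where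
  "complex_involutive A D \<longleftrightarrow> (\<forall>U Z W. openin (mtopology A) U \<and>
     smooth_complex_section A D U Z \<and> smooth_complex_section A D U W \<longrightarrow>
     (\<forall>x\<in>U. complex_lie_bracket A Z W x \<in> D x))"

definition integrable_J ::
  "('m, 'e::euclidean_space) chart set \<Rightarrow> ('m \<Rightarrow> 'e set) \<Rightarrow> ('m \<Rightarrow> 'e \<Rightarrow> 'e) \<Rightarrow> bool" where
  "integrable_J A E J \<longleftrightarrow> complex_involutive A (zero_one_space E J)"


section \<open>Embedded hyperbolic CR-manifolds\<close>

abbreviation emb_atlas :: "(complex^4) set \<Rightarrow> (complex^4, real^6) chart set" where
  "emb_atlas M \<equiv> submanifold_charts M"

text \<open>The differential at \<open>x\<close> of the inclusion of \<open>M\<close>.\<close>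

definition emb_diff :: "(complex^4) set \<Rightarrow> complex^4 \<Rightarrow> real^6 \<Rightarrow> complex^4" where
  "emb_diff M x v = (let c = chart_at (emb_atlas M) x in
     frechet_derivative (cinv c) (at (snd c x)) v)"

definition emb_CR_space :: "(complex^4) set \<Rightarrow> complex^4 \<Rightarrow> (real^6) set" where
  "emb_CR_space M x = {v. \<exists>w. emb_diff M x v = \<i> *s emb_diff M x w}"

definition holomorphic_coords ::
  "(complex^4 \<Rightarrow> (complex^2) \<times> (complex^2)) \<Rightarrow> (complex^4) set \<Rightarrow> bool" where
  "holomorphic_coords F W \<longleftrightarrow> open W \<and> inj_on F W \<and> open (F ` W) \<and>
     (\<forall>x\<in>W. \<exists>D. (F has_derivative D) (at x) \<and>
        (\<forall>v. D (\<i> *s v) = (\<i> *s fst (D v), \<i> *s snd (D v)))) \<and>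
     (\<forall>q\<in>F ` W. \<exists>D. (inv_into W F has_derivative D) (at q) \<and>
        (\<forall>v. D (\<i> *s fst v, \<i> *s snd v) = \<i> *s D v))"

text \<open>
  In the coordinates \<open>F\<close>, the set \<open>M\<close> is the graph of \<open>v\<^sub>1\<close>, \<open>v\<^sub>2\<close> over \<open>(z, u)\<close>, where
  \<open>w = u + \<i> v\<close>; the remainders vanish to third order in \<open>(z, u)\<close>.
\<close>

definition hyperbolic_point :: "(complex^4) set \<Rightarrow> complex^4 \<Rightarrow> bool" where
  "hyperbolic_point M x \<longleftrightarrow> (\<exists>W F. holomorphic_coords F W \<and> x \<in> W \<and> F x = 0 \<and>
     (\<exists>N (R1 :: (complex^2) \<times> (real^2) \<Rightarrow> real) (R2 :: (complex^2) \<times> (real^2) \<Rightarrow> real).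
        open N \<and> 0 \<in> N \<and> smooth_on N R1 \<and> smooth_on N R2 \<and>
        R1 \<in> O[at 0](\<lambda>q. norm q ^ 3) \<and> R2 \<in> O[at 0](\<lambda>q. norm q ^ 3) \<and>
        F ` (M \<inter> W) = {(z, w) \<in> F ` W.
          Im (w$1) = (cmod (z$1))\<^sup>2 + R1 (z, \<chi> j. Re (w$j)) \<and>
          Im (w$2) = (cmod (z$2))\<^sup>2 + R2 (z, \<chi> j. Re (w$j))}))"

definition embedded_hyperbolic_CR :: "(complex^4) set \<Rightarrow> bool" where
  "embedded_hyperbolic_CR M \<longleftrightarrow> mcarrier (emb_atlas M) = M \<and>
     (\<forall>x\<in>M. dim (emb_CR_space M x) = 4) \<and> (\<forall>x\<in>M. hyperbolic_point M x)"

definition emb_frames :: "(complex^4) set \<Rightarrow> complex^4 \<Rightarrow> (real^6) gframe set" where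
  "emb_frames M x = {f \<in> gr_isos (emb_CR_space M x).
     (\<forall>X\<in>ggr (-1). emb_diff M x (snd f (cxm X)) = \<i> *s emb_diff M x (snd f X)) \<and>
     bracket_compatible (emb_atlas M) (emb_CR_space M) x f}"

end

theory Submission
  imports Defs
begin

text \<open>
  A section \<open>\<xi>\<close> of \<open>E\<close> lifts to a vector field on the total space on which \<open>\<omega>\<close> takes values
  \<open>f\<close> in \<open>ggr (-1)\<close>, and brackets of such lifts project to brackets of the sections. If \<open>h\<close> belongs
  to a second section \<open>\<eta>\<close>, then \<open>\<omega>\<close> maps the bracket of the lifts to
  \<open>\<xi>\<cdot>h - \<eta>\<cdot>f + gbr f h - curvature f h\<close>, where regularity removes the \<open>ggr (-2)\<close> part of
  the curvature and the \<open>palg\<close> part is vertical. Since \<open>J \<xi>\<close> has the lift with values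
  \<open>cxm f\<close> and \<open>gbr\<close> on \<open>ggr (-1)\<close> is invariant under \<open>cxm\<close>, the
  derivative terms cancel in the condition that the bracket of two \<open>(0,1)\<close>-sections is again of type \<open>(0,1)\<close>;
  what remains is four times \<open>cxm\<close> of the part of the torsion that is antilinear in both arguments.
  For an embedded manifold the same cancellation takes place for the derivatives of the map
  from the total space to \<open>\<complex>\<^sup>4\<close>.
\<close>


section \<open>Smooth functions on open sets\<close>

text \<open>All identities are proved at one point \<open>u0\<close>, in the charts that
  \<open>chart_at\<close> selects there, so tangent coordinates need no conversion at that point,
  and a lift has to be differentiable there only. The lift itself exists pointwise:
  \<open>push u\<close> is a bijection from \<open>ggr (-1)\<close> onto the fibre of
  \<open>E\<close>, so requiring values in \<open>ggr (-1)\<close> makes the lift unique and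
  replaces the choice of a local section of the bundle. Verticality of \<open>palg\<close> is the
  other obstacle: the connection is prescribed on velocities of curves through exponentials, while
  the charts of \<open>P_atlas\<close> are given only implicitly. The exponentials are computed in
  the single degrees 0, 1, 2, where they are diagonal or polynomial; linearity of
  \<open>push u\<close> then covers \<open>palg\<close>. Let s and t be the derivative terms along
  the real and imaginary parts. Up to curvature, the bracket of two (0,1)-sections has real part
  \<open>s - cxm t\<close> and imaginary part \<open>cxm s + t\<close>, and the latter is
  \<open>cxm\<close> of the former. For embedded manifolds the fields with constant \<omega> replace
  the lifts, so that s and t are zero.\<close>

lemma Ck_on_cong:
  assumes "open U" "\<And>x. x \<in> U \<Longrightarrow> f x = g x" "Ck_on k U f"
  shows "Ck_on k U g"
  using assms(2,3)
proof (induction k arbitrary: f g)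
  case 0
  then show ?case by (metis Ck_on.simps(1) continuous_on_cong)
next
  case (Suc k)
  have 1: "(g has_derivative frechet_derivative f (at x)) (at x)" if "x \<in> U" for x
    using Suc.prems that frechet_derivative_works has_derivative_transform_within_open[OF _ assms(1)]
    by (metis Ck_on.simps(2))
  then have 2: "frechet_derivative f (at x) = frechet_derivative g (at x)" if "x \<in> U" for x
    using frechet_derivative_at that by blast
  have "Ck_on k U (\<lambda>x. frechet_derivative g (at x) v)" for v
    by (rule Suc.IH[of "\<lambda>x. frechet_derivative f (at x) v"]) (use 2 Suc.prems in auto)
  then show ?case
    using 1 by (auto simp: differentiable_def)
qed

lemma Ck_on_imp_continuous_on: "Ck_on k U f \<Longrightarrow> continuous_on U f"
  by (cases k) (auto intro!: continuous_at_imp_continuous_on differentiable_imp_continuous_within)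

lemma Ck_on_Suc_imp: "Ck_on (Suc k) U f \<Longrightarrow> Ck_on k U f"
proof (induction k arbitrary: f)
  case 0
  then show ?case using Ck_on_imp_continuous_on by fastforce
next
  case (Suc k)
  then show ?case by (metis Ck_on.simps(2))
qed

lemma Ck_on_const: "Ck_on k U (\<lambda>x. c)"
  by (induction k arbitrary: c) (auto simp: frechet_derivative_const)

lemma Ck_on_bounded_linear: "bounded_linear f \<Longrightarrow> Ck_on k U f"
proof (cases k)
  case 0
  assume "bounded_linear f"
  then show ?thesis using 0 by (simp add: linear_continuous_on)
next
  case (Suc k)
  assume f: "bounded_linear f"
  then have "frechet_derivative f (at x) = f" for x
    by (metis bounded_linear_imp_has_derivative frechet_derivative_at)
  then show ?thesis
    using Suc f by (auto simp: Ck_on_const bounded_linear_imp_differentiable)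
qed

text \<open>Lets the closure properties below be proved by induction with a derivative supplied by
  the calculus rules, without computing \<open>frechet_derivative\<close>.\<close>

lemma Ck_on_SucI:
  assumes "open U" "\<And>x. x \<in> U \<Longrightarrow> (f has_derivative f' x) (at x)"
    "\<And>v. Ck_on k U (\<lambda>x. f' x v)"
  shows "Ck_on (Suc k) U f"
proof -
  have "frechet_derivative f (at x) = f' x" if "x \<in> U" for x
    using assms(2) frechet_derivative_at that by metis
  then have "Ck_on k U (\<lambda>x. frechet_derivative f (at x) v)" for v
    by (intro Ck_on_cong[OF assms(1) _ assms(3)]) auto
  then show ?thesis
    using assms(2) by (auto simp: differentiable_def)
qed

lemma Ck_on_SucD:
  assumes "Ck_on (Suc k) U f" "x \<in> U"
  shows "(f has_derivative frechet_derivative f (at x)) (at x)"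
  using assms frechet_derivative_works by auto

lemma Ck_on_add:
  assumes "open U" "Ck_on k U f" "Ck_on k U g"
  shows "Ck_on k U (\<lambda>x. f x + g x)"
  using assms(2,3)
proof (induction k arbitrary: f g)
  case (Suc k)
  show ?case
    by (rule Ck_on_SucI[OF assms(1) has_derivative_add[OF Ck_on_SucD[OF Suc.prems(1)] Ck_on_SucD[OF Suc.prems(2)]]])
      (use Suc in auto)
qed (auto intro: continuous_intros)

lemma Ck_on_sum:
  assumes "open U" "\<And>i. i \<in> I \<Longrightarrow> Ck_on k U (f i)"
  shows "Ck_on k U (\<lambda>x. \<Sum>i\<in>I. f i x)"
  using assms by (induction I rule: infinite_finite_induct) (auto intro: Ck_on_const Ck_on_add)

lemma Ck_on_scaleR:
  assumes "open U" "Ck_on k U f" "Ck_on k U g"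
  shows "Ck_on k U (\<lambda>x. f x *\<^sub>R g x)"
  using assms(2,3)
proof (induction k arbitrary: f g)
  case (Suc k)
  show ?case
    by (rule Ck_on_SucI[OF assms(1) has_derivative_scaleR[OF Ck_on_SucD[OF Suc.prems(1)] Ck_on_SucD[OF Suc.prems(2)]]])
      (use Suc Ck_on_Suc_imp[OF Suc.prems(1)] Ck_on_Suc_imp[OF Suc.prems(2)] in
        \<open>auto intro!: Ck_on_add[OF assms(1)] Suc.IH\<close>)
qed (auto intro: continuous_intros)

lemma Ck_on_inner_right:
  assumes "open U" "Ck_on k U f"
  shows "Ck_on k U (\<lambda>x. f x \<bullet> b)"
  using assms(2)
proof (induction k arbitrary: f)
  case (Suc k)
  show ?case
    by (rule Ck_on_SucI[OF assms(1) has_derivative_inner_left[OF Ck_on_SucD[OF Suc.prems]]])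
      (use Suc in auto)
qed (auto intro: continuous_intros)

lemma linear_eq_sum_Basis:
  fixes f :: "'a::euclidean_space \<Rightarrow> 'b::real_vector"
  assumes "linear f"
  shows "f x = (\<Sum>b\<in>Basis. (x \<bullet> b) *\<^sub>R f b)"
  by (subst euclidean_representation[of x, symmetric])
    (simp add: linear_sum[OF assms] linear_scale[OF assms] del: euclidean_representation)

text \<open>In the chain rule the base point and the argument of the derivative of \<open>g\<close>
  both vary with \<open>x\<close>. Expanding the argument in \<open>Basis\<close> leaves a finite
  sum of products, and the induction hypothesis, general in \<open>g\<close>, applies to each factor
  \<open>frechet_derivative g (at (f x)) b\<close>.\<close>

lemma Ck_on_compose:
  fixes f :: "'a::real_normed_vector \<Rightarrow> 'b::euclidean_space" and g :: "'b \<Rightarrow> 'c::real_normed_vector"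
  assumes "open U" "f ` U \<subseteq> V" "Ck_on k U f" "Ck_on k V g"
  shows "Ck_on k U (\<lambda>x. g (f x))"
  using assms(3,4)
proof (induction k arbitrary: g)
  case 0
  then show ?case using assms(2) continuous_on_compose2 by auto
next
  case (Suc k)
  have lin: "linear (frechet_derivative g (at (f x)))" if "x \<in> U" for x
    using Ck_on_SucD[OF Suc.prems(2), of "f x"] that assms(2)
    by (auto intro!: has_derivative_linear)
  have "((\<lambda>x. g (f x)) has_derivative
      (\<lambda>v. \<Sum>b\<in>Basis. (frechet_derivative f (at x) v \<bullet> b) *\<^sub>R frechet_derivative g (at (f x)) b)) (at x)"
    if x: "x \<in> U" for x
  proof -
    have "((\<lambda>x. g (f x)) has_derivative
      (\<lambda>v. frechet_derivative g (at (f x)) (frechet_derivative f (at x) v))) (at x)"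
      using x assms(2)
      by (intro has_derivative_compose[OF Ck_on_SucD[OF Suc.prems(1) x] Ck_on_SucD[OF Suc.prems(2)]]) auto
    then show ?thesis
      by (subst (asm) linear_eq_sum_Basis[OF lin[OF x]])
  qed
  moreover have "Ck_on k U
      (\<lambda>x. \<Sum>b\<in>Basis. (frechet_derivative f (at x) v \<bullet> b) *\<^sub>R frechet_derivative g (at (f x)) b)" for v
    using Suc Ck_on_Suc_imp
    by (intro Ck_on_sum Ck_on_scaleR Ck_on_inner_right assms Suc.IH[of "\<lambda>x. frechet_derivative g (at x) b" for b]) auto
  ultimately show ?case
    by (intro Ck_on_SucI[OF assms(1)]) auto
qed

lemma smooth_on_compose:
  fixes f :: "'a::real_normed_vector \<Rightarrow> 'b::euclidean_space" and g :: "'b \<Rightarrow> 'c::real_normed_vector"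
  assumes "open U" "f ` U \<subseteq> V" "smooth_on U f" "smooth_on V g"
  shows "smooth_on U (\<lambda>x. g (f x))"
  using assms Ck_on_compose unfolding smooth_on_def by blast

lemma smooth_on_cong:
  assumes "open U" "\<And>x. x \<in> U \<Longrightarrow> f x = g x" "smooth_on U f"
  shows "smooth_on U g"
  using assms Ck_on_cong unfolding smooth_on_def by blast

lemma smooth_on_bounded_linear: "bounded_linear f \<Longrightarrow> smooth_on U f"
  using Ck_on_bounded_linear unfolding smooth_on_def by blast

lemma smooth_on_has_derivative:
  assumes "smooth_on U f" "x \<in> U"
  shows "(f has_derivative frechet_derivative f (at x)) (at x)"
  using assms Ck_on_SucD unfolding smooth_on_def by blast

lemma smooth_on_differentiable: "smooth_on U f \<Longrightarrow> x \<in> U \<Longrightarrow> f differentiable (at x)"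
  using smooth_on_has_derivative differentiable_def by blast

lemma smooth_on_frechet_derivative:
  "smooth_on U f \<Longrightarrow> smooth_on U (\<lambda>x. frechet_derivative f (at x) v)"
  unfolding smooth_on_def by (metis Ck_on.simps(2))

lemma smooth_on_continuous_on: "smooth_on U f \<Longrightarrow> continuous_on U f"
  unfolding smooth_on_def using Ck_on_imp_continuous_on by blast

section \<open>Symmetry of second derivatives\<close>

text \<open>The mean value theorem is used twice: in direction \<open>v\<close> for the difference
  of the two opposite edges of the parallelogram, then in direction \<open>w\<close> for the
  derivative along \<open>v\<close>.\<close>

lemma second_difference_mvt:
  fixes g :: "'a::real_normed_vector \<Rightarrow> real"
  assumes U: "open U" and g: "smooth_on U g" and h: "0 < h"
    and par: "\<And>s t. 0 \<le> s \<Longrightarrow> s \<le> h \<Longrightarrow> 0 \<le> t \<Longrightarrow> t \<le> h \<Longrightarrow> x + s *\<^sub>R v + t *\<^sub>R w \<in> U"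
  shows "\<exists>s t. 0 < s \<and> s < h \<and> 0 < t \<and> t < h \<and>
    g (x + h *\<^sub>R v + h *\<^sub>R w) - g (x + h *\<^sub>R v) - g (x + h *\<^sub>R w) + g x =
    h * h * frechet_derivative (\<lambda>y. frechet_derivative g (at y) v) (at (x + s *\<^sub>R v + t *\<^sub>R w)) w"
proof -
  define g1 where "g1 y = frechet_derivative g (at y) v" for y
  have g1: "smooth_on U g1"
    unfolding g1_def using smooth_on_frechet_derivative[OF g] .
  have d: "((\<lambda>s. f (a + s *\<^sub>R e)) has_real_derivative frechet_derivative f (at (a + s *\<^sub>R e)) e) (at s)"
    if f: "smooth_on U f" and m: "a + s *\<^sub>R e \<in> U" for f :: "'a \<Rightarrow> real" and a e s
  proof -
    have fd: "(f has_derivative frechet_derivative f (at (a + s *\<^sub>R e))) (at (a + s *\<^sub>R e))"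
      using smooth_on_has_derivative[OF f m] .
    have "((\<lambda>s. a + s *\<^sub>R e) has_derivative (\<lambda>r. r *\<^sub>R e)) (at s)"
      by (auto intro!: derivative_eq_intros)
    from has_derivative_compose[OF this fd]
    have "((\<lambda>s. f (a + s *\<^sub>R e)) has_derivative (\<lambda>r. frechet_derivative f (at (a + s *\<^sub>R e)) (r *\<^sub>R e))) (at s)" .
    then show ?thesis
      by (simp add: has_field_derivative_def linear_scale[OF has_derivative_linear[OF fd]] mult.commute[of _ "frechet_derivative f _ e"])
  qed
  have "\<exists>z>0. z < h \<and> (g (x + h *\<^sub>R w + h *\<^sub>R v) - g (x + h *\<^sub>R v)) - (g (x + h *\<^sub>R w + 0 *\<^sub>R v) - g (x + 0 *\<^sub>R v))
      = (h - 0) * (g1 (x + h *\<^sub>R w + z *\<^sub>R v) - g1 (x + z *\<^sub>R v))"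
  proof (rule MVT2[OF h, of "\<lambda>s. g (x + h *\<^sub>R w + s *\<^sub>R v) - g (x + s *\<^sub>R v)"])
    fix s assume "0 \<le> s" "s \<le> h"
    then have "x + h *\<^sub>R w + s *\<^sub>R v \<in> U" "x + s *\<^sub>R v \<in> U"
      using par[of s h] par[of s 0] h by (auto simp: algebra_simps)
    then show "((\<lambda>s. g (x + h *\<^sub>R w + s *\<^sub>R v) - g (x + s *\<^sub>R v)) has_real_derivative
        g1 (x + h *\<^sub>R w + s *\<^sub>R v) - g1 (x + s *\<^sub>R v)) (at s)"
      unfolding g1_def by (intro DERIV_diff d g)
  qed
  then obtain s where s: "0 < s" "s < h" and
    e1: "g (x + h *\<^sub>R w + h *\<^sub>R v) - g (x + h *\<^sub>R v) - (g (x + h *\<^sub>R w) - g x) =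
      h * (g1 (x + h *\<^sub>R w + s *\<^sub>R v) - g1 (x + s *\<^sub>R v))" by auto
  have "\<exists>z>0. z < h \<and> g1 (x + s *\<^sub>R v + h *\<^sub>R w) - g1 (x + s *\<^sub>R v + 0 *\<^sub>R w)
      = (h - 0) * frechet_derivative g1 (at (x + s *\<^sub>R v + z *\<^sub>R w)) w"
  proof (rule MVT2[OF h, of "\<lambda>t. g1 (x + s *\<^sub>R v + t *\<^sub>R w)"])
    fix t assume "0 \<le> t" "t \<le> h"
    then show "((\<lambda>t. g1 (x + s *\<^sub>R v + t *\<^sub>R w)) has_real_derivative
        frechet_derivative g1 (at (x + s *\<^sub>R v + t *\<^sub>R w)) w) (at t)"
      using par[of s t] s by (intro d g1) auto
  qed
  then obtain t where t: "0 < t" "t < h" and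
    e2: "g1 (x + s *\<^sub>R v + h *\<^sub>R w) - g1 (x + s *\<^sub>R v) = h * frechet_derivative g1 (at (x + s *\<^sub>R v + t *\<^sub>R w)) w"
    by auto
  show ?thesis
    using s t e1 e2 unfolding g1_def
    by (intro exI[of _ s] exI[of _ t]) (simp add: algebra_simps)
qed

text \<open>The second difference is symmetric in \<open>v\<close> and \<open>w\<close>, so the two
  mixed derivatives take equal values at two points of an arbitrarily small parallelogram;
  continuity moves both points to \<open>x\<close>.\<close>

lemma frechet_derivative_symmetric_real:
  fixes g :: "'a::real_normed_vector \<Rightarrow> real"
  assumes U: "open U" and g: "smooth_on U g" and x: "x \<in> U"
  shows "frechet_derivative (\<lambda>y. frechet_derivative g (at y) v) (at x) w =
    frechet_derivative (\<lambda>y. frechet_derivative g (at y) w) (at x) v"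
proof -
  define A where "A y = frechet_derivative (\<lambda>y. frechet_derivative g (at y) v) (at y) w" for y
  define B where "B y = frechet_derivative (\<lambda>y. frechet_derivative g (at y) w) (at y) v" for y
  have sA: "smooth_on U A" and sB: "smooth_on U B"
    unfolding A_def B_def by (intro smooth_on_frechet_derivative g)+
  have cA: "isCont A x" and cB: "isCont B x"
    using smooth_on_continuous_on[OF sA] smooth_on_continuous_on[OF sB] U x
    by (auto simp: continuous_on_eq_continuous_at)
  obtain \<epsilon> where \<epsilon>: "\<epsilon> > 0" "ball x \<epsilon> \<subseteq> U"
    using U x open_contains_ball by blast
  \<comment> \<open>A parallelogram with parameter \<open>h\<close> has diameter at most of order
    \<open>h * K\<close>; the summand 1 keeps \<open>K\<close> positive when \<open>v\<close> and
    \<open>w\<close> vanish.\<close>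
  define K where "K = norm v + norm w + 1"
  have K: "K > 0" by (simp add: K_def add_nonneg_pos)
  have near: "norm (s *\<^sub>R v + t *\<^sub>R w) < e"
    if "0 \<le> s" "s \<le> h" "0 \<le> t" "t \<le> h" "h * K < e" "0 < h" for s t h e
  proof -
    have "norm (s *\<^sub>R v + t *\<^sub>R w) \<le> s * norm v + t * norm w"
      using that by (smt (verit) norm_scaleR norm_triangle_ineq)
    also have "\<dots> \<le> h * norm v + h * norm w"
      using that by (intro add_mono mult_right_mono) auto
    also have "\<dots> \<le> h * K" using that by (simp add: K_def algebra_simps)
    finally show ?thesis using that by simp
  qed
  have "A x = B x"
  proof (rule ccontr)
    assume "A x \<noteq> B x"
    define e where "e = \<bar>A x - B x\<bar> / 2"
    have "e > 0" using \<open>A x \<noteq> B x\<close> by (simp add: e_def)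
    obtain d1 where d1: "d1 > 0" "\<And>y. norm (y - x) < d1 \<Longrightarrow> \<bar>A y - A x\<bar> < e"
      using cA \<open>e > 0\<close> unfolding continuous_at_eps_delta by (auto simp: dist_norm)
    obtain d2 where d2: "d2 > 0" "\<And>y. norm (y - x) < d2 \<Longrightarrow> \<bar>B y - B x\<bar> < e"
      using cB \<open>e > 0\<close> unfolding continuous_at_eps_delta by (auto simp: dist_norm)
    define m where "m = min \<epsilon> (min d1 d2)"
    have m: "m > 0" using \<epsilon> d1 d2 by (simp add: m_def)
    define h where "h = m / (2 * K)"
    have h: "h > 0" "h * K < m" using m K by (auto simp: h_def)
    have *: "x + s *\<^sub>R v + t *\<^sub>R w \<in> U" if "0 \<le> s" "s \<le> h" "0 \<le> t" "t \<le> h" for s t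
    proof -
      have "norm (s *\<^sub>R v + t *\<^sub>R w) < \<epsilon>"
        using near[OF that, of \<epsilon>] h by (simp add: m_def)
      then have "x + (s *\<^sub>R v + t *\<^sub>R w) \<in> ball x \<epsilon>"
        unfolding mem_ball dist_norm by (metis add_diff_cancel_left' norm_minus_commute)
      then show ?thesis using \<epsilon>(2) by (auto simp: add.assoc)
    qed
    obtain s t where st: "0 < s" "s < h" "0 < t" "t < h"
      "g (x + h *\<^sub>R v + h *\<^sub>R w) - g (x + h *\<^sub>R v) - g (x + h *\<^sub>R w) + g x = h * h * A (x + s *\<^sub>R v + t *\<^sub>R w)"
      using second_difference_mvt[OF U g h(1) *] unfolding A_def[symmetric] by blast
    have star2: "x + s *\<^sub>R w + t *\<^sub>R v \<in> U" if "0 \<le> s" "s \<le> h" "0 \<le> t" "t \<le> h" for s t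
      using *[of t s] that by (simp add: algebra_simps)
    obtain s' t' where st': "0 < s'" "s' < h" "0 < t'" "t' < h"
      "g (x + h *\<^sub>R w + h *\<^sub>R v) - g (x + h *\<^sub>R w) - g (x + h *\<^sub>R v) + g x = h * h * B (x + s' *\<^sub>R w + t' *\<^sub>R v)"
      using second_difference_mvt[OF U g h(1) star2] unfolding B_def[symmetric] by blast
    have "h * h * A (x + s *\<^sub>R v + t *\<^sub>R w) = h * h * B (x + s' *\<^sub>R w + t' *\<^sub>R v)"
      using st(5) st'(5) by (simp add: algebra_simps)
    then have eq: "A (x + (s *\<^sub>R v + t *\<^sub>R w)) = B (x + (t' *\<^sub>R v + s' *\<^sub>R w))"
      using h by (simp add: algebra_simps)
    have "norm (s *\<^sub>R v + t *\<^sub>R w) < d1" "norm (t' *\<^sub>R v + s' *\<^sub>R w) < d2"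
      using near[of s h t d1] near[of t' h s' d2] st st' h by (auto simp: m_def)
    then have "\<bar>A (x + (s *\<^sub>R v + t *\<^sub>R w)) - A x\<bar> < e" "\<bar>B (x + (t' *\<^sub>R v + s' *\<^sub>R w)) - B x\<bar> < e"
      using d1(2) d2(2) by auto
    moreover have "2 * e = \<bar>A x - B x\<bar>" by (simp add: e_def)
    ultimately show False using eq by linarith
  qed
  then show ?thesis by (simp add: A_def B_def)
qed

lemma frechet_derivative_symmetric:
  fixes g :: "'a::real_normed_vector \<Rightarrow> 'b::euclidean_space"
  assumes U: "open U" and g: "smooth_on U g" and x: "x \<in> U"
  shows "frechet_derivative (\<lambda>y. frechet_derivative g (at y) v) (at x) w =
    frechet_derivative (\<lambda>y. frechet_derivative g (at y) w) (at x) v"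
proof (rule euclidean_eqI)
  fix b :: 'b assume "b \<in> Basis"
  have gb: "smooth_on U (\<lambda>y. g y \<bullet> b)"
    using g Ck_on_inner_right[OF U] unfolding smooth_on_def by blast
  have D: "frechet_derivative (\<lambda>y. h y \<bullet> b) (at y) a = frechet_derivative h (at y) a \<bullet> b"
    if "smooth_on U h" "y \<in> U" for h :: "'a \<Rightarrow> 'b" and y a
    using has_derivative_inner_left[OF smooth_on_has_derivative[OF that]]
      frechet_derivative_at by metis
  have D2: "frechet_derivative (\<lambda>y. frechet_derivative (\<lambda>y. g y \<bullet> b) (at y) a) (at x) c =
      frechet_derivative (\<lambda>y. frechet_derivative g (at y) a) (at x) c \<bullet> b" for a c
  proof -
    have "((\<lambda>y. frechet_derivative g (at y) a \<bullet> b) has_derivative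
       (\<lambda>c. frechet_derivative (\<lambda>y. frechet_derivative g (at y) a) (at x) c \<bullet> b)) (at x)"
      using has_derivative_inner_left smooth_on_has_derivative smooth_on_frechet_derivative g x by blast
    then have "((\<lambda>y. frechet_derivative (\<lambda>y. g y \<bullet> b) (at y) a) has_derivative
       (\<lambda>c. frechet_derivative (\<lambda>y. frechet_derivative g (at y) a) (at x) c \<bullet> b)) (at x)"
      by (rule has_derivative_transform_within_open[OF _ U x]) (simp add: D[OF g])
    then show ?thesis using frechet_derivative_at by metis
  qed
  show "frechet_derivative (\<lambda>y. frechet_derivative g (at y) v) (at x) w \<bullet> b =
    frechet_derivative (\<lambda>y. frechet_derivative g (at y) w) (at x) v \<bullet> b"
    using frechet_derivative_symmetric_real[OF U gb x, of v w] unfolding D2 .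
qed

section \<open>Linear systems with differentiable coefficients\<close>

lemma linear_family_frechet_linear:
  fixes G :: "'a::real_normed_vector \<Rightarrow> 'b::euclidean_space \<Rightarrow> 'c::real_normed_vector"
  assumes N: "open N" "x \<in> N" and lin: "\<And>y. y \<in> N \<Longrightarrow> linear (G y)"
    and d: "\<And>w. (\<lambda>y. G y w) differentiable (at x)"
  shows "linear (\<lambda>w. frechet_derivative (\<lambda>y. G y w) (at x) v)"
proof -
  have 1: "((\<lambda>y. G y w) has_derivative frechet_derivative (\<lambda>y. G y w) (at x)) (at x)" for w
    using d frechet_derivative_works by blast
  show ?thesis
  proof (rule linearI)
    fix w1 w2
    have "((\<lambda>y. G y (w1 + w2)) has_derivative (\<lambda>v. frechet_derivative (\<lambda>y. G y w1) (at x) v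
        + frechet_derivative (\<lambda>y. G y w2) (at x) v)) (at x)"
      by (rule has_derivative_transform_within_open[OF has_derivative_add[OF 1 1] N])
        (simp add: linear_add[OF lin])
    then show "frechet_derivative (\<lambda>y. G y (w1 + w2)) (at x) v = frechet_derivative (\<lambda>y. G y w1) (at x) v
        + frechet_derivative (\<lambda>y. G y w2) (at x) v"
      using frechet_derivative_at by metis
  next
    fix r w
    have "((\<lambda>y. G y (r *\<^sub>R w)) has_derivative (\<lambda>v. r *\<^sub>R frechet_derivative (\<lambda>y. G y w) (at x) v)) (at x)"
      by (rule has_derivative_transform_within_open[OF has_derivative_scaleR_right[OF 1] N])
        (simp add: linear_scale[OF lin])
    then show "frechet_derivative (\<lambda>y. G y (r *\<^sub>R w)) (at x) v = r *\<^sub>R frechet_derivative (\<lambda>y. G y w) (at x) v"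
      using frechet_derivative_at by metis
  qed
qed

text \<open>Product rule for a family of linear maps known to be differentiable on each fixed vector
  only; expansion in the finite \<open>Basis\<close> makes this sufficient.\<close>

lemma linear_family_has_derivative:
  fixes G :: "'a::real_normed_vector \<Rightarrow> 'b::euclidean_space \<Rightarrow> 'c::real_normed_vector"
  assumes N: "open N" "x \<in> N" and lin: "\<And>y. y \<in> N \<Longrightarrow> linear (G y)"
    and d: "\<And>w. (\<lambda>y. G y w) differentiable (at x)"
    and w: "(w has_derivative w') (at x)"
  shows "((\<lambda>y. G y (w y)) has_derivative
    (\<lambda>v. frechet_derivative (\<lambda>y. G y (w x)) (at x) v + G x (w' v))) (at x)"
proof -
  have 1: "((\<lambda>y. G y w) has_derivative frechet_derivative (\<lambda>y. G y w) (at x)) (at x)" for w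
    using d frechet_derivative_works by blast
  have "((\<lambda>y. \<Sum>b\<in>Basis. (w y \<bullet> b) *\<^sub>R G y b) has_derivative
      (\<lambda>v. \<Sum>b\<in>Basis. (w x \<bullet> b) *\<^sub>R frechet_derivative (\<lambda>y. G y b) (at x) v + (w' v \<bullet> b) *\<^sub>R G x b)) (at x)"
    by (intro has_derivative_sum has_derivative_scaleR has_derivative_inner_left w 1)
  moreover have "(\<Sum>b\<in>Basis. (w x \<bullet> b) *\<^sub>R frechet_derivative (\<lambda>y. G y b) (at x) v + (w' v \<bullet> b) *\<^sub>R G x b)
     = frechet_derivative (\<lambda>y. G y (w x)) (at x) v + G x (w' v)" for v
    using linear_eq_sum_Basis[OF linear_family_frechet_linear[OF N lin d], where x="w x"]
      linear_eq_sum_Basis[OF lin[OF N(2)], of "w' v"]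
    by (simp add: sum.distrib)
  ultimately have "((\<lambda>y. \<Sum>b\<in>Basis. (w y \<bullet> b) *\<^sub>R G y b) has_derivative
      (\<lambda>v. frechet_derivative (\<lambda>y. G y (w x)) (at x) v + G x (w' v))) (at x)" by simp
  then show ?thesis
    by (rule has_derivative_transform_within_open[OF _ N]) (simp add: linear_eq_sum_Basis[OF lin, symmetric])
qed

text \<open>A differentiable \<open>u\<close> that vanishes at \<open>x\<close> is at most of order
  \<open>norm (y - x)\<close>, and the factor \<open>c\<close> tending to 0 turns this bound into
  little-o.\<close>

lemma has_derivative_zero_if_bounded_by_product:
  fixes u :: "'a::real_normed_vector \<Rightarrow> 'b::real_normed_vector"
  assumes u: "u differentiable (at x)" "u x = 0" and c: "(c \<longlongrightarrow> 0) (at x)"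
    and le: "\<forall>\<^sub>F y in at x. norm (e y) \<le> c y * norm (u y)" "e x = 0"
    and c0: "\<And>y. 0 \<le> c y"
  shows "(e has_derivative (\<lambda>v. 0)) (at x)"
proof -
  obtain u' where u': "(u has_derivative u') (at x)"
    using u(1) differentiable_def by blast
  obtain B where B: "B > 0" "\<And>h. norm (u' h) \<le> norm h * B"
    using bounded_linear.pos_bounded[OF has_derivative_bounded_linear[OF u']] by blast
  define q where "q y = norm (u y - u x - u' (y - x)) / norm (y - x)" for y
  have q: "(q \<longlongrightarrow> 0) (at x)"
    using u' unfolding has_derivative_iff_norm q_def by simp
  have "((\<lambda>y. norm (e y - e x - 0) / norm (y - x)) \<longlongrightarrow> 0) (at x)"
  proof (rule Lim_null_comparison)
    show "((\<lambda>y. c y * (B + q y)) \<longlongrightarrow> 0) (at x)"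
      using tendsto_mult[OF c tendsto_add[OF tendsto_const[of B] q]] by simp
    show "\<forall>\<^sub>F y in at x. norm (norm (e y - e x - 0) / norm (y - x)) \<le> c y * (B + q y)"
      using le(1) eventually_neq_at_within[of x x UNIV]
    proof (eventually_elim, goal_cases)
      case (1 y)
      then have yx: "norm (y - x) > 0" by auto
      have "norm (u y) \<le> norm (u' (y - x)) + norm (u y - u x - u' (y - x))"
        using norm_triangle_ineq[of "u' (y - x)" "u y - u x - u' (y - x)"] u(2) by simp
      also have "\<dots> \<le> (B + q y) * norm (y - x)"
        using B(2)[of "y - x"] yx by (simp add: q_def field_simps)
      finally have "norm (u y) \<le> (B + q y) * norm (y - x)" .
      then have "norm (e y) \<le> c y * ((B + q y) * norm (y - x))"
        using 1(1) mult_left_mono[OF _ c0, of "norm (u y)" _ y] by fastforce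
      then show ?case using yx le(2) by (simp add: field_simps)
    qed
  qed
  then show ?thesis
    unfolding has_derivative_iff_norm by simp
qed

text \<open>A left inverse \<open>g\<close> of \<open>G x\<close> makes \<open>g (G y w)\<close> a
  small perturbation of \<open>w\<close>, so the solution is its first-order guess up to an error of
  higher order. Nothing is assumed about \<open>f\<close>, and injectivity at the single point
  \<open>x\<close> suffices; overdetermined systems are allowed, which is how the lifts are
  obtained.\<close>

lemma linear_family_solution_differentiable:
  fixes G :: "'a::real_normed_vector \<Rightarrow> 'b::euclidean_space \<Rightarrow> 'c::euclidean_space"
  assumes N: "open N" "x \<in> N" and lin: "\<And>y. y \<in> N \<Longrightarrow> linear (G y)"
    and d: "\<And>w. (\<lambda>y. G y w) differentiable (at x)"
    and v: "v differentiable (at x)"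
    and eq: "\<And>y. y \<in> N \<Longrightarrow> G y (f y) = v y" and inj: "inj (G x)"
  shows "f differentiable (at x)"
proof -
  obtain g where g: "linear g" "g \<circ> G x = id"
    using linear_injective_left_inverse[OF lin[OF N(2)] inj] by blast
  have gd: "(\<lambda>y. g (h y)) differentiable (at x)" if "h differentiable (at x)" for h :: "'a \<Rightarrow> 'c"
    using that bounded_linear.has_derivative[OF linear_conv_bounded_linear[THEN iffD1, OF g(1)]]
    unfolding differentiable_def by blast
  \<comment> \<open>A guess for \<open>f y - f x\<close> that is differentiable because
    \<open>f\<close> enters only through the constant \<open>f x\<close>.\<close>
  define u where "u y = g (v y) - g (G y (f x))" for y
  have ud: "u differentiable (at x)"
    unfolding u_def by (intro differentiable_diff gd v d)
  have u0: "u x = 0"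
    using eq[OF N(2)] by (simp add: u_def)
  define c where "c y = (\<Sum>b\<in>Basis. norm (g (G y b) - b))" for y
  have cc: "isCont (\<lambda>y. g (G y b)) x" for b
    using gd[OF d] differentiable_imp_continuous_within by blast
  have gx: "g (G x b) = b" for b
    using g(2) by (metis comp_apply id_apply)
  have "isCont c x"
    unfolding c_def by (intro continuous_intros cc)
  moreover have "c x = 0" by (simp add: c_def gx)
  ultimately have c: "(c \<longlongrightarrow> 0) (at x)" by (simp add: isCont_def)
  have c0: "0 \<le> c y" for y
    unfolding c_def by (simp add: sum_nonneg)
  have cb: "norm (g (G y w) - w) \<le> c y * norm w" if y: "y \<in> N" for y w
  proof -
    have lg: "linear (\<lambda>w. g (G y w) - w)"
      by (intro linear_compose_sub linear_compose[OF lin[OF y] g(1), unfolded comp_def] linear_id[unfolded id_def])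
    have "norm (g (G y w) - w) = norm (\<Sum>b\<in>Basis. (w \<bullet> b) *\<^sub>R (g (G y b) - b))"
      by (subst linear_eq_sum_Basis[OF lg]) simp
    also have "\<dots> \<le> (\<Sum>b\<in>Basis. norm w * norm (g (G y b) - b))"
      by (rule sum_norm_le) (auto intro!: mult_right_mono Basis_le_norm)
    finally show ?thesis by (simp add: c_def sum_distrib_left mult.commute)
  qed
  define e where "e y = f y - f x - u y" for y
  have "(e has_derivative (\<lambda>v. 0)) (at x)"
  proof (rule has_derivative_zero_if_bounded_by_product[of u x "\<lambda>y. 2 * c y"])
    show "((\<lambda>y. 2 * c y) \<longlongrightarrow> 0) (at x)"
      using tendsto_mult_left[OF c, of 2] by simp
    have "\<forall>\<^sub>F y in at x. y \<in> N"
      using N eventually_at_topological by blast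
    moreover have "\<forall>\<^sub>F y in at x. c y < 1 / 2"
      using order_tendstoD(2)[OF c, of "1 / 2"] by simp
    ultimately show "\<forall>\<^sub>F y in at x. norm (e y) \<le> 2 * c y * norm (u y)"
    proof eventually_elim
      case (elim y)
      let ?r = "f y - f x"
      have "u y = g (G y ?r)"
        using eq[OF elim(1)] by (simp add: u_def linear_diff[OF lin[OF elim(1)]] linear_diff[OF g(1)])
      then have 1: "norm (e y) \<le> c y * norm ?r"
        using cb[OF elim(1), of ?r] by (simp add: e_def norm_minus_commute)
      \<comment> \<open>As \<open>c y < 1 / 2\<close>, the error is at most half of
        \<open>norm ?r\<close> and can be absorbed; this bounds the unknown increment by
        \<open>u y\<close>.\<close>
      have "norm ?r \<le> norm (u y) + norm (e y)"
        using norm_triangle_ineq[of "u y" "e y"] by (simp add: e_def)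
      also have "\<dots> \<le> norm (u y) + 1 / 2 * norm ?r"
        using 1 elim(2) mult_right_mono[of "c y" "1/2" "norm ?r"] by simp
      finally have "norm ?r \<le> 2 * norm (u y)" by simp
      then show ?case
        using 1 mult_left_mono[OF _ c0[of y], of "norm ?r" "2 * norm (u y)"] by simp
    qed
  qed (use u0 ud c0 in \<open>auto simp: e_def\<close>)
  then have "e differentiable (at x)" using differentiable_def by blast
  then have "(\<lambda>y. e y + u y + f x) differentiable (at x)"
    using ud by (intro differentiable_add) auto
  then show ?thesis by (simp add: e_def)
qed

text \<open>The formula for the exterior derivative of a one-form in coordinates. The last bracket,
  with both vectors frozen at \<open>x\<close>, is the exterior derivative of \<open>G\<close> and
  depends only on the values of the fields at \<open>x\<close>.\<close>

lemma one_form_bracket: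
  fixes G :: "'a::euclidean_space \<Rightarrow> 'a \<Rightarrow> 'c::real_normed_vector"
  assumes N: "open N" "x \<in> N" and lin: "\<And>y. y \<in> N \<Longrightarrow> linear (G y)"
    and d: "\<And>w. (\<lambda>y. G y w) differentiable (at x)"
    and \<xi>: "\<xi> differentiable (at x)" and \<eta>: "\<eta> differentiable (at x)"
  shows "G x (frechet_derivative \<eta> (at x) (\<xi> x) - frechet_derivative \<xi> (at x) (\<eta> x)) =
    frechet_derivative (\<lambda>y. G y (\<eta> y)) (at x) (\<xi> x) - frechet_derivative (\<lambda>y. G y (\<xi> y)) (at x) (\<eta> x)
    - (frechet_derivative (\<lambda>y. G y (\<eta> x)) (at x) (\<xi> x) - frechet_derivative (\<lambda>y. G y (\<xi> x)) (at x) (\<eta> x))"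
proof -
  have *: "frechet_derivative (\<lambda>y. G y (\<zeta> y)) (at x) v =
      frechet_derivative (\<lambda>y. G y (\<zeta> x)) (at x) v + G x (frechet_derivative \<zeta> (at x) v)"
    if "\<zeta> differentiable (at x)" for \<zeta> v
    using frechet_derivative_at[OF linear_family_has_derivative[OF N lin d that[unfolded frechet_derivative_works]], symmetric]
    by simp
  have "a - b = (c + a) - (d + b) - (c - d)" for a b c d :: 'c
    by (simp add: algebra_simps)
  then show ?thesis
    unfolding linear_diff[OF lin[OF N(2)]] *[OF \<xi>, of "\<eta> x"] *[OF \<eta>, of "\<xi> x"] .
qed

lemma smooth_map_bracket:
  fixes P :: "'a::euclidean_space \<Rightarrow> 'c::euclidean_space"
  assumes N: "open N" "x \<in> N" and P: "smooth_on N P"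
    and \<xi>: "\<xi> differentiable (at x)" and \<eta>: "\<eta> differentiable (at x)"
  shows "frechet_derivative P (at x) (frechet_derivative \<eta> (at x) (\<xi> x) - frechet_derivative \<xi> (at x) (\<eta> x)) =
    frechet_derivative (\<lambda>y. frechet_derivative P (at y) (\<eta> y)) (at x) (\<xi> x)
    - frechet_derivative (\<lambda>y. frechet_derivative P (at y) (\<xi> y)) (at x) (\<eta> x)"
proof -
  have "linear (frechet_derivative P (at y))" if "y \<in> N" for y
    using has_derivative_linear[OF smooth_on_has_derivative[OF P that]] .
  moreover have "(\<lambda>y. frechet_derivative P (at y) w) differentiable (at x)" for w
    using smooth_on_differentiable[OF smooth_on_frechet_derivative[OF P] N(2)] .
  ultimately show ?thesis
    using one_form_bracket[OF N _ _ \<xi> \<eta>, of "\<lambda>y. frechet_derivative P (at y)"]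
      frechet_derivative_symmetric[OF N(1) P N(2)] by simp
qed

section \<open>Charts and tangent maps\<close>

text \<open>Only injectivity of the charts is assumed, not their compatibility, because the lemma
  also serves \<open>prod_atlas B P_atlas\<close>, whose charts are only shown to be injective with
  open images.\<close>

lemma openin_mtopology:
  assumes "\<And>c. c \<in> A \<Longrightarrow> inj_on (snd c) (fst c)"
  shows "openin (mtopology A) U \<longleftrightarrow> U \<subseteq> mcarrier A \<and> (\<forall>c\<in>A. open (snd c ` (U \<inter> fst c)))"
proof -
  have "istopology (\<lambda>U. U \<subseteq> mcarrier A \<and> (\<forall>c\<in>A. open (snd c ` (U \<inter> fst c))))"
    unfolding istopology_def
  proof (intro conjI allI impI ballI)
    fix S T c
    assume S: "S \<subseteq> mcarrier A \<and> (\<forall>c\<in>A. open (snd c ` (S \<inter> fst c)))"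
      and T: "T \<subseteq> mcarrier A \<and> (\<forall>c\<in>A. open (snd c ` (T \<inter> fst c)))" and c: "c \<in> A"
    have "snd c ` (S \<inter> T \<inter> fst c) = snd c ` ((S \<inter> fst c) \<inter> (T \<inter> fst c))"
      by (rule arg_cong[of _ _ "image _"]) auto
    also have "\<dots> = snd c ` (S \<inter> fst c) \<inter> snd c ` (T \<inter> fst c)"
      by (rule inj_on_image_Int[OF assms[OF c]]) auto
    finally show "open (snd c ` (S \<inter> T \<inter> fst c))"
      using S T c by auto
  next
    fix \<K> c
    assume "\<forall>K\<in>\<K>. K \<subseteq> mcarrier A \<and> (\<forall>c\<in>A. open (snd c ` (K \<inter> fst c)))" "c \<in> A"
    moreover have "snd c ` (\<Union>\<K> \<inter> fst c) = (\<Union>K\<in>\<K>. snd c ` (K \<inter> fst c))" by blast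
    ultimately show "open (snd c ` (\<Union>\<K> \<inter> fst c))" by auto
  qed auto
  then show ?thesis
    unfolding mtopology_def by simp
qed

lemma topspace_mtopology:
  assumes "\<And>c. c \<in> A \<Longrightarrow> inj_on (snd c) (fst c)" "\<And>c. c \<in> A \<Longrightarrow> open (snd c ` fst c)"
  shows "topspace (mtopology A) = mcarrier A"
proof -
  have "mcarrier A \<inter> fst c = fst c" if "c \<in> A" for c
    using that by (auto simp: mcarrier_def)
  then have "openin (mtopology A) (mcarrier A)"
    using assms by (simp add: openin_mtopology)
  moreover have "openin (mtopology A) U \<Longrightarrow> U \<subseteq> mcarrier A" for U
    using assms(1) by (simp add: openin_mtopology)
  ultimately show ?thesis
    by (meson openin_subset openin_topspace subset_antisym)
qed

text \<open>Turns convergence of chart coordinates into convergence in \<open>mtopology\<close>. The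
  curve has to stay in the chart domain, since outside of it the coordinates do not determine the
  point.\<close>

lemma eventually_in_openin_mtopology:
  assumes "\<And>c. c \<in> A \<Longrightarrow> inj_on (snd c) (fst c)" "c \<in> A" "openin (mtopology A) U"
    "x \<in> U" "x \<in> fst c" "\<forall>\<^sub>F t in F. \<gamma> t \<in> fst c" "((\<lambda>t. snd c (\<gamma> t)) \<longlongrightarrow> snd c x) F"
  shows "\<forall>\<^sub>F t in F. \<gamma> t \<in> U"
proof -
  have "open (snd c ` (U \<inter> fst c))"
    using assms by (simp add: openin_mtopology)
  then have "\<forall>\<^sub>F t in F. snd c (\<gamma> t) \<in> snd c ` (U \<inter> fst c)"
    using assms by (intro topological_tendstoD[OF assms(7)]) auto
  with assms(6) show ?thesis
  proof eventually_elim
    case (elim t)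
    then show ?case using assms(1)[OF assms(2)] by (auto dest: inj_onD)
  qed
qed

text \<open>The inverse of \<open>tcoord A c x\<close>. For fixed \<open>w\<close> it yields the
  coordinate vector fields of the chart \<open>c\<close>.\<close>

definition tvec :: "('a, 'e::euclidean_space) chart set \<Rightarrow> ('a, 'e) chart \<Rightarrow> 'a \<Rightarrow> 'e \<Rightarrow> 'e" where
  "tvec A c x w = frechet_derivative (snd (chart_at A x) \<circ> cinv c) (at (snd c x)) w"

locale atlas =
  fixes A :: "('a, 'e::euclidean_space) chart set"
  assumes smooth_atlas: "smooth_atlas A"
begin

lemma inj_on_chart: "c \<in> A \<Longrightarrow> inj_on (snd c) (fst c)"
  and open_chart_image: "c \<in> A \<Longrightarrow> open (snd c ` fst c)"
  and open_chart_overlap: "c \<in> A \<Longrightarrow> d \<in> A \<Longrightarrow> open (snd c ` (fst c \<inter> fst d))"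
  and smooth_transition: "c \<in> A \<Longrightarrow> d \<in> A \<Longrightarrow> smooth_on (snd c ` (fst c \<inter> fst d)) (snd d \<circ> cinv c)"
  using smooth_atlas by (auto simp: smooth_atlas_def)

lemma openin_iff: "openin (mtopology A) U \<longleftrightarrow> U \<subseteq> mcarrier A \<and> (\<forall>c\<in>A. open (snd c ` (U \<inter> fst c)))"
  using openin_mtopology inj_on_chart by blast

lemma topspace_eq: "topspace (mtopology A) = mcarrier A"
  using topspace_mtopology inj_on_chart open_chart_image by blast

lemma openin_chart: "c \<in> A \<Longrightarrow> openin (mtopology A) (fst c)"
  using open_chart_overlap by (auto simp: openin_iff mcarrier_def Int_commute)

lemma cinv_left [simp]: "c \<in> A \<Longrightarrow> x \<in> fst c \<Longrightarrow> cinv c (snd c x) = x"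
  using inj_on_chart by (simp add: cinv_def)

lemma chart_at_in:
  assumes "x \<in> mcarrier A"
  shows "chart_at A x \<in> A" "x \<in> fst (chart_at A x)"
proof -
  have "\<exists>c. c \<in> A \<and> x \<in> fst c" using assms by (auto simp: mcarrier_def)
  from someI_ex[OF this] show "chart_at A x \<in> A" "x \<in> fst (chart_at A x)"
    unfolding chart_at_def by auto
qed

lemma in_mcarrier: "c \<in> A \<Longrightarrow> x \<in> fst c \<Longrightarrow> x \<in> mcarrier A"
  by (auto simp: mcarrier_def)

lemma transition_has_derivative:
  assumes "c \<in> A" "d \<in> A" "x \<in> fst c" "x \<in> fst d"
  shows "((snd d \<circ> cinv c) has_derivative frechet_derivative (snd d \<circ> cinv c) (at (snd c x))) (at (snd c x))"
  using smooth_on_has_derivative[OF smooth_transition] assms by auto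

lemma transition_compose:
  assumes "c \<in> A" "d \<in> A" "e \<in> A" "x \<in> fst c" "x \<in> fst d" "x \<in> fst e"
  shows "frechet_derivative (snd e \<circ> cinv d) (at (snd d x))
      (frechet_derivative (snd d \<circ> cinv c) (at (snd c x)) v) =
    frechet_derivative (snd e \<circ> cinv c) (at (snd c x)) v"
proof -
  have "((\<lambda>y. (snd e \<circ> cinv d) ((snd d \<circ> cinv c) y)) has_derivative
      (\<lambda>v. frechet_derivative (snd e \<circ> cinv d) (at (snd d x))
        (frechet_derivative (snd d \<circ> cinv c) (at (snd c x)) v))) (at (snd c x))"
    using has_derivative_compose[OF transition_has_derivative[of c d x], of "snd e \<circ> cinv d"]
      transition_has_derivative[of d e x] assms by simp
  then have "((snd e \<circ> cinv c) has_derivative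
      (\<lambda>v. frechet_derivative (snd e \<circ> cinv d) (at (snd d x))
        (frechet_derivative (snd d \<circ> cinv c) (at (snd c x)) v))) (at (snd c x))"
  proof (rule has_derivative_transform_within_open)
    show "open (snd c ` (fst c \<inter> fst d))" using open_chart_overlap assms by simp
    show "snd c x \<in> snd c ` (fst c \<inter> fst d)" using assms by simp
  qed (use assms in auto)
  then show ?thesis
    using frechet_derivative_at by metis
qed

lemma transition_refl:
  assumes "c \<in> A" "x \<in> fst c"
  shows "frechet_derivative (snd c \<circ> cinv c) (at (snd c x)) v = v"
proof -
  have "((\<lambda>y. y) has_derivative (\<lambda>v. v)) (at (snd c x))" by simp
  then have "((snd c \<circ> cinv c) has_derivative (\<lambda>v. v)) (at (snd c x))"
  proof (rule has_derivative_transform_within_open)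
    show "open (snd c ` fst c)" using open_chart_image assms by simp
    show "snd c x \<in> snd c ` fst c" using assms by simp
  qed (use assms in auto)
  then show ?thesis
    using frechet_derivative_at by metis
qed

lemma tcoord_chart_at:
  "x \<in> mcarrier A \<Longrightarrow> tcoord A (chart_at A x) x v = v"
  using chart_at_in transition_refl unfolding tcoord_def by blast

lemma tvec_linear: "c \<in> A \<Longrightarrow> x \<in> fst c \<Longrightarrow> linear (tvec A c x)"
  using transition_has_derivative[of c "chart_at A x" x] chart_at_in in_mcarrier
  unfolding tvec_def by (simp add: has_derivative_linear)

lemma tcoord_tvec':
  assumes "c \<in> A" "d \<in> A" "x \<in> fst c" "x \<in> fst d"
  shows "tcoord A d x (tvec A c x w) = frechet_derivative (snd d \<circ> cinv c) (at (snd c x)) w"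
  unfolding tcoord_def tvec_def using transition_compose[of c "chart_at A x" d x w] chart_at_in in_mcarrier assms
  by simp

lemma tcoord_tvec [simp]: "c \<in> A \<Longrightarrow> x \<in> fst c \<Longrightarrow> tcoord A c x (tvec A c x w) = w"
  using tcoord_tvec' transition_refl by simp

lemma tvec_tcoord [simp]:
  assumes "c \<in> A" "x \<in> fst c"
  shows "tvec A c x (tcoord A c x v) = v"
  unfolding tcoord_def tvec_def
  using transition_compose[of "chart_at A x" c "chart_at A x" x v] chart_at_in in_mcarrier assms
    transition_refl[of "chart_at A x" x v] by simp

lemma smooth_vf_tvec:
  assumes "c \<in> A"
  shows "smooth_vf A (fst c) (\<lambda>x. tvec A c x w)"
  unfolding smooth_vf_def
proof
  fix d assume d: "d \<in> A"
  let ?U = "snd d ` (fst d \<inter> fst c)"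
  define H where "H z = frechet_derivative (snd d \<circ> cinv c) (at z) w" for z
  have "smooth_on ?U (\<lambda>y. H ((snd c \<circ> cinv d) y))"
  proof (rule smooth_on_compose[where f="snd c \<circ> cinv d" and g=H])
    show "smooth_on (snd c ` (fst c \<inter> fst d)) H"
      unfolding H_def using smooth_on_frechet_derivative[OF smooth_transition] assms d by blast
    show "smooth_on ?U (snd c \<circ> cinv d)" "open ?U"
      using smooth_transition open_chart_overlap assms d by blast+
    show "(snd c \<circ> cinv d) ` ?U \<subseteq> snd c ` (fst c \<inter> fst d)" using d by auto
  qed
  then show "smooth_on ?U (vf_rep A d (\<lambda>x. tvec A c x w))"
    by (rule smooth_on_cong[rotated 2])
      (use open_chart_overlap[OF d assms] assms d tcoord_tvec'[OF assms d] in \<open>auto simp: vf_rep_def H_def\<close>)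
qed

text \<open>Smoothness of a form is defined by testing on smooth fields; the coordinate fields of
  \<open>c\<close> are such fields and give the coefficients in \<open>c\<close>.\<close>

lemma smooth_one_form_rep:
  assumes \<omega>: "smooth_one_form A \<omega>" and c: "c \<in> A"
  shows "smooth_on (snd c ` fst c) (\<lambda>y. \<omega> (cinv c y) (tvec A c (cinv c y) w))"
proof -
  have "smooth_fun A (fst c) (\<lambda>x. \<omega> x (tvec A c x w))"
    using \<omega> smooth_vf_tvec[OF c] openin_chart[OF c] unfolding smooth_one_form_def by blast
  then show ?thesis
    using c by (auto simp: smooth_fun_def comp_def)
qed

lemma one_form_rep_linear:
  assumes \<omega>: "smooth_one_form A \<omega>" and c: "c \<in> A" "y \<in> snd c ` fst c"
  shows "linear (\<lambda>w. \<omega> (cinv c y) (tvec A c (cinv c y) w))"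
proof -
  obtain x where x: "x \<in> fst c" "y = snd c x" using c by auto
  then show ?thesis
    using linear_compose[OF tvec_linear[OF c(1) x(1)], of "\<omega> x"] \<omega> c in_mcarrier
    by (auto simp: smooth_one_form_def comp_def)
qed

end

lemma smooth_map_rep:
  assumes A: "smooth_atlas A" and B: "smooth_atlas B" and f: "smooth_map A B f"
    and c: "c \<in> A" and d: "d \<in> B"
  shows "open (snd c ` (fst c \<inter> f -` fst d))"
    "smooth_on (snd c ` (fst c \<inter> f -` fst d)) (snd d \<circ> f \<circ> cinv c)"
proof -
  interpret A: atlas A by (rule atlas.intro[OF A])
  interpret B: atlas B by (rule atlas.intro[OF B])
  have "openin (mtopology A) {x \<in> topspace (mtopology A). f x \<in> fst d}"
    using f B.openin_chart[OF d] unfolding smooth_map_def continuous_map_def by blast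
  then have "open (snd c ` ({x \<in> mcarrier A. f x \<in> fst d} \<inter> fst c))"
    using c by (simp add: A.openin_iff A.topspace_eq)
  moreover have "{x \<in> mcarrier A. f x \<in> fst d} \<inter> fst c = fst c \<inter> f -` fst d"
    using A.in_mcarrier[OF c] by auto
  ultimately show "open (snd c ` (fst c \<inter> f -` fst d))" by simp
  show "smooth_on (snd c ` (fst c \<inter> f -` fst d)) (snd d \<circ> f \<circ> cinv c)"
    using f c d unfolding smooth_map_def by blast
qed

lemma smooth_map_in_mcarrier:
  assumes A: "smooth_atlas A" and B: "smooth_atlas B" and f: "smooth_map A B f" and x: "x \<in> mcarrier A"
  shows "f x \<in> mcarrier B"
  using f x atlas.topspace_eq[OF atlas.intro[OF A]] atlas.topspace_eq[OF atlas.intro[OF B]]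
  unfolding smooth_map_def continuous_map_def by auto

text \<open>Both sides come from the derivative of one map, \<open>f\<close> read from the selected
  chart at \<open>x\<close> to \<open>d\<close>: it factors through the selected chart at
  \<open>f x\<close> and also through \<open>c\<close>.\<close>

lemma tcoord_tmap:
  assumes A: "smooth_atlas A" and B: "smooth_atlas B" and f: "smooth_map A B f"
    and c: "c \<in> A" "x \<in> fst c" and d: "d \<in> B" "f x \<in> fst d"
  shows "tcoord B d (f x) (tmap A B f x v) =
    frechet_derivative (snd d \<circ> f \<circ> cinv c) (at (snd c x)) (tcoord A c x v)"
proof -
  interpret A: atlas A by (rule atlas.intro[OF A])
  interpret B: atlas B by (rule atlas.intro[OF B])
  define c' d' where "c' = chart_at A x" and "d' = chart_at B (f x)"
  have c': "c' \<in> A" "x \<in> fst c'" and d': "d' \<in> B" "f x \<in> fst d'"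
    unfolding c'_def d'_def using A.chart_at_in B.chart_at_in A.in_mcarrier B.in_mcarrier c d by auto
  have D: "((snd b \<circ> f \<circ> cinv a) has_derivative frechet_derivative (snd b \<circ> f \<circ> cinv a) (at (snd a x))) (at (snd a x))"
    if "a \<in> A" "x \<in> fst a" "b \<in> B" "f x \<in> fst b" for a b
    using smooth_on_has_derivative[OF smooth_map_rep(2)[OF A B f that(1,3)]] that by auto
  have "((\<lambda>y. (snd d \<circ> cinv d') ((snd d' \<circ> f \<circ> cinv c') y)) has_derivative
    (\<lambda>v. frechet_derivative (snd d \<circ> cinv d') (at (snd d' (f x))) (frechet_derivative (snd d' \<circ> f \<circ> cinv c') (at (snd c' x)) v)))
    (at (snd c' x))"
    using has_derivative_compose[OF D[OF c' d'], of "snd d \<circ> cinv d'"] B.transition_has_derivative[OF d'(1) d(1) d'(2) d(2)] c'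
    by simp
  then have 1: "((snd d \<circ> f \<circ> cinv c') has_derivative
    (\<lambda>v. frechet_derivative (snd d \<circ> cinv d') (at (snd d' (f x))) (frechet_derivative (snd d' \<circ> f \<circ> cinv c') (at (snd c' x)) v)))
    (at (snd c' x))"
  proof (rule has_derivative_transform_within_open)
    show "open (snd c' ` (fst c' \<inter> f -` fst d'))" using smooth_map_rep(1)[OF A B f] c' d' by blast
  qed (use c' d' in auto)
  have "((\<lambda>y. (snd d \<circ> f \<circ> cinv c) ((snd c \<circ> cinv c') y)) has_derivative
    (\<lambda>v. frechet_derivative (snd d \<circ> f \<circ> cinv c) (at (snd c x)) (frechet_derivative (snd c \<circ> cinv c') (at (snd c' x)) v)))
    (at (snd c' x))"
    using has_derivative_compose[OF A.transition_has_derivative[OF c'(1) c(1) c'(2) c(2)], of "snd d \<circ> f \<circ> cinv c"] D[OF c d] c'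
    by simp
  then have 2: "((snd d \<circ> f \<circ> cinv c') has_derivative
    (\<lambda>v. frechet_derivative (snd d \<circ> f \<circ> cinv c) (at (snd c x)) (frechet_derivative (snd c \<circ> cinv c') (at (snd c' x)) v)))
    (at (snd c' x))"
  proof (rule has_derivative_transform_within_open)
    show "open (snd c' ` (fst c' \<inter> fst c))" using A.open_chart_overlap c c' by blast
  qed (use c' c in auto)
  show ?thesis
    using fun_cong[OF has_derivative_unique[OF 1 2], of v] unfolding tcoord_def tmap_def c'_def d'_def by simp
qed

section \<open>The graded Lie algebra\<close>

lemma pos3_simps [simp]: "pos3 1 = 1" "pos3 2 = 2" "pos3 3 = 3"
  by (simp_all add: pos3_def)

lemma cmat3_eq_iff: "X = Y \<longleftrightarrow> X$1$1 = Y$1$1 \<and> X$1$2 = Y$1$2 \<and> X$1$3 = Y$1$3 \<and>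
    X$2$1 = Y$2$1 \<and> X$2$2 = Y$2$2 \<and> X$2$3 = Y$2$3 \<and>
    X$3$1 = Y$3$1 \<and> X$3$2 = Y$3$2 \<and> X$3$3 = Y$3$3" for X Y :: cmat3
  by (auto simp: vec_eq_iff forall_3)

lemma cmat3_mult: "(X ** Y)$i$j = X$i$1 * Y$1$j + X$i$2 * Y$2$j + X$i$3 * Y$3$j" for X Y :: cmat3
  by (simp add: matrix_matrix_mult_def sum_3)

lemma Smat_simps [simp]:
  "Smat$1$1 = 0" "Smat$1$2 = 0" "Smat$1$3 = 1"
  "Smat$2$1 = 0" "Smat$2$2 = 1" "Smat$2$3 = 0"
  "Smat$3$1 = 1" "Smat$3$2 = 0" "Smat$3$3 = 0"
  by (simp_all add: Smat_def)

lemma ctranspose_nth [simp]: "ctranspose X$i$j = cnj (X$j$i)"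
  by (simp add: ctranspose_def)

text \<open>Conjugation by \<open>Smat\<close> makes the adjoint a reflection in the antidiagonal:
  entry \<open>(i, j)\<close> is paired with \<open>(4 - j, 4 - i)\<close>, up to sign and complex
  conjugation.\<close>

lemma su21_iff: "X \<in> su21 \<longleftrightarrow> X$1$1 + X$2$2 + X$3$3 = 0 \<and>
    X$3$3 = - cnj (X$1$1) \<and> X$2$2 = - cnj (X$2$2) \<and> X$2$3 = - cnj (X$1$2) \<and>
    X$3$2 = - cnj (X$2$1) \<and> X$1$3 = - cnj (X$1$3) \<and> X$3$1 = - cnj (X$3$1)"
proof -
  have "a + b = 0 \<longleftrightarrow> b = - a" "cnj a + b = 0 \<longleftrightarrow> cnj b + a = 0" for a b :: complex
    by (auto simp: complex_eq_iff add_eq_0_iff2)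
  then show ?thesis
    by (simp add: su21_def cmat3_eq_iff cmat3_mult trace_def sum_3) (auto simp: complex_eq_iff)
qed

lemma subspace_su21: "subspace su21"
  by (auto simp: subspace_def su21_iff algebra_simps complex_eq_iff)
    (metis distrib_left mult_zero_right)

lemma subspace_su21_grade: "subspace (su21_grade k)"
  using subspace_su21 unfolding subspace_def su21_grade_def by auto

lemma subspace_galg: "subspace galg"
  unfolding galg_def by (intro subspace_Times subspace_su21)

lemma subspace_ggr: "subspace (ggr k)"
  unfolding ggr_def by (intro subspace_Times subspace_su21_grade)

lemma ggr_subset_galg: "ggr k \<subseteq> galg"
  by (auto simp: ggr_def galg_def su21_grade_def)

lemma su21_grade_minus1: "X \<in> su21_grade (-1) \<longleftrightarrow> X$1$1 = 0 \<and> X$1$2 = 0 \<and> X$1$3 = 0 \<and>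
    X$2$2 = 0 \<and> X$2$3 = 0 \<and> X$3$1 = 0 \<and> X$3$3 = 0 \<and> X$3$2 = - cnj (X$2$1)"
  by (auto simp: su21_grade_def su21_iff forall_3)

lemma gproj_linear: "linear (gproj k)"
  by (rule linearI) (auto simp: gproj_def Let_def vec_eq_iff)

lemma gproj_in_ggr: "X \<in> galg \<Longrightarrow> gproj k X \<in> ggr k"
  by (auto simp: gproj_def ggr_def galg_def su21_grade_def su21_iff Let_def)

lemma gproj_ggr: "X \<in> ggr j \<Longrightarrow> gproj k X = (if k = j then X else 0)"
  by (auto simp: gproj_def ggr_def su21_grade_def Let_def vec_eq_iff prod_eq_iff zero_prod_def)

lemma sum_gproj: "(\<Sum>k\<in>{-2..2}. gproj k X) = X"
proof -
  have *: "{-2..2} = {-2, -1, 0, 1, 2::int}" by auto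
  show ?thesis
    unfolding * by (simp add: prod_eq_iff cmat3_eq_iff gproj_def)
qed

text \<open>An element of \<open>galg\<close> is the sum of its \<open>gproj\<close> components, and
  vanishing of the entries below degree \<open>k\<close> kills the components of lower
  degree.\<close>

lemma gfilt_iff: "X \<in> gfilt k \<longleftrightarrow> X \<in> galg \<and>
    (\<forall>i j. pos3 j - pos3 i < k \<longrightarrow> fst X$i$j = 0 \<and> snd X$i$j = 0)"
proof -
  define S where "S = {X \<in> galg. \<forall>i j. pos3 j - pos3 i < k \<longrightarrow> fst X$i$j = 0 \<and> snd X$i$j = 0}"
  have "subspace S"
    using subspace_galg unfolding subspace_def S_def by simp
  moreover have "(\<Union>j\<in>{k..}. ggr j) \<subseteq> S"
    using ggr_subset_galg by (fastforce simp: ggr_def su21_grade_def S_def)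
  ultimately have "gfilt k \<subseteq> S"
    unfolding gfilt_def using span_minimal by blast
  moreover have "X \<in> gfilt k" if X: "X \<in> S" for X
  proof -
    have "gproj j X \<in> gfilt k" for j
    proof (cases "j < k")
      case True
      then have "gproj j X = 0"
        using X by (auto simp: gproj_def Let_def prod_eq_iff vec_eq_iff S_def)
      then show ?thesis by (simp add: gfilt_def span_zero)
    next
      case False
      then show ?thesis
        unfolding gfilt_def using X gproj_in_ggr by (intro span_base UN_I[of j]) (auto simp: S_def)
    qed
    then have "(\<Sum>k\<in>{-2..2}. gproj k X) \<in> gfilt k"
      unfolding gfilt_def by (intro span_sum) auto
    then show "X \<in> gfilt k" by (simp add: sum_gproj)
  qed
  ultimately show ?thesis unfolding S_def by blast
qed

lemma subspace_gfilt: "subspace (gfilt k)"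
  unfolding gfilt_def by (rule subspace_span)

lemma ggr_subset_gfilt: "k \<le> j \<Longrightarrow> ggr j \<subseteq> gfilt k"
  unfolding gfilt_def by (auto intro: span_base)

lemma ggr_subset_gminus: "ggr (-1) \<subseteq> gminus" "ggr (-2) \<subseteq> gminus"
  unfolding gminus_def by (auto intro: span_base)

lemma gfilt_minus1_decomp:
  assumes "X \<in> galg" "gproj (-2) X = 0"
  obtains Z where "Z \<in> palg" "X = gproj (-1) X + Z"
proof
  have *: "{-2..2} = {-2, -1, 0, 1, 2::int}" by auto
  show "X = gproj (-1) X + (gproj 0 X + gproj 1 X + gproj 2 X)"
    using sum_gproj[of X] assms(2) unfolding * by (simp add: add.assoc)
  show "gproj 0 X + gproj 1 X + gproj 2 X \<in> palg"
    using gproj_in_ggr[OF assms(1)] ggr_subset_gfilt[of 0 0] ggr_subset_gfilt[of 0 1] ggr_subset_gfilt[of 0 2]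
    by (intro subspace_add[OF subspace_gfilt]) auto
qed

text \<open>Reduces claims on \<open>palg\<close> that are linear to the three degrees in which
  exponentials are computed explicitly.\<close>

lemma palg_span: "palg = span (ggr 0 \<union> ggr 1 \<union> ggr 2)"
proof -
  have "ggr j \<subseteq> span (ggr 0 \<union> ggr 1 \<union> ggr 2)" if "0 \<le> j" for j
  proof (cases "j \<le> 2")
    case True
    then have "j = 0 \<or> j = 1 \<or> j = 2" using that by linarith
    then show ?thesis by (auto intro: span_base)
  next
    case False
    have "X = 0" if "X \<in> ggr j" for X
      using that False by (auto simp: ggr_def su21_grade_def prod_eq_iff cmat3_eq_iff)
    then show ?thesis using span_zero by (metis subsetI)
  qed
  then have "palg \<subseteq> span (ggr 0 \<union> ggr 1 \<union> ggr 2)"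
    unfolding gfilt_def by (intro span_minimal subspace_span) auto
  moreover have "span (ggr 0 \<union> ggr 1 \<union> ggr 2) \<subseteq> palg"
    unfolding gfilt_def by (intro span_mono Un_least UN_upper) auto
  ultimately show ?thesis by blast
qed

lemma cxm_linear: "linear cxm"
  by (rule linearI) (auto simp: cxm_def Let_def vec_eq_iff algebra_simps)

lemma cxm_in_ggr: "X \<in> ggr (-1) \<Longrightarrow> cxm X \<in> ggr (-1)"
  by (simp add: cxm_def Let_def ggr_def su21_grade_minus1 mem_Times_iff)

lemma cxm_cxm: "X \<in> ggr (-1) \<Longrightarrow> cxm (cxm X) = - X"
  by (simp add: cxm_def Let_def ggr_def su21_grade_minus1 mem_Times_iff prod_eq_iff cmat3_eq_iff)

lemma gbr_in_galg: "X \<in> galg \<Longrightarrow> Y \<in> galg \<Longrightarrow> gbr X Y \<in> galg"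
  by (simp add: gbr_def galg_def mem_Times_iff su21_iff cmat3_mult) (simp add: algebra_simps complex_eq_iff)

lemma gbr_ggr_minus1: "X \<in> ggr (-1) \<Longrightarrow> Y \<in> ggr (-1) \<Longrightarrow> gbr X Y \<in> ggr (-2)"
  by (simp add: gbr_def ggr_def su21_grade_def su21_iff mem_Times_iff forall_3 cmat3_mult)

text \<open>If x and y are the entries \<open>$2$1\<close> in one factor, then the only nonzero
  entry of the bracket is \<open>x * cnj y - y * cnj x\<close>, an imaginary multiple of the
  imaginary part of a Hermitian form. It does not change when x and y are both multiplied by
  \<open>\<i>\<close>.\<close>

lemma gbr_cxm_cxm: "X \<in> ggr (-1) \<Longrightarrow> Y \<in> ggr (-1) \<Longrightarrow> gbr (cxm X) (cxm Y) = gbr X Y"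
  by (simp add: gbr_def cxm_def Let_def ggr_def su21_grade_minus1 mem_Times_iff prod_eq_iff cmat3_eq_iff
      cmat3_mult algebra_simps)

lemma gbr_cxm_add: "X \<in> ggr (-1) \<Longrightarrow> Y \<in> ggr (-1) \<Longrightarrow> gbr X (cxm Y) + gbr (cxm X) Y = 0"
  by (simp add: gbr_def cxm_def Let_def ggr_def su21_grade_minus1 mem_Times_iff prod_eq_iff cmat3_eq_iff
      cmat3_mult algebra_simps)

section \<open>The structure group\<close>

lemma carrier_SU21: "A \<in> carrier SU21 \<longleftrightarrow> ctranspose A ** Smat ** A = Smat \<and> det A = 1"
  by (simp add: SU21_def)

lemma mult_SU21 [simp]: "A \<otimes>\<^bsub>SU21\<^esub> B = A ** B"
  by (simp add: SU21_def)

lemma one_SU21 [simp]: "\<one>\<^bsub>SU21\<^esub> = mat 1"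
  by (simp add: SU21_def)

lemma mat1_nth: "(mat c :: cmat3)$1$1 = c" "(mat c :: cmat3)$1$2 = 0" "(mat c :: cmat3)$1$3 = 0"
  "(mat c :: cmat3)$2$1 = 0" "(mat c :: cmat3)$2$2 = c" "(mat c :: cmat3)$2$3 = 0"
  "(mat c :: cmat3)$3$1 = 0" "(mat c :: cmat3)$3$2 = 0" "(mat c :: cmat3)$3$3 = c"
  by (simp_all add: mat_def)

lemma Smat_Smat: "Smat ** Smat = mat 1"
  by (simp add: cmat3_eq_iff cmat3_mult mat1_nth)

lemma ctranspose_mult: "ctranspose (A ** B) = ctranspose B ** ctranspose A"
  by (simp add: cmat3_eq_iff cmat3_mult algebra_simps)

lemma matrix_inv_eq:
  fixes A B :: "'a::field^'n^'n"
  assumes "A ** B = mat 1"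
  shows "matrix_inv A = B"
proof -
  have B: "B ** A = mat 1" using assms matrix_left_right_inverse by blast
  have "A ** matrix_inv A = mat 1 \<and> matrix_inv A ** A = mat 1"
    unfolding matrix_inv_def by (rule someI[of _ B]) (use assms B in simp)
  then show ?thesis
    by (metis B matrix_mul_assoc matrix_mul_lid matrix_mul_rid)
qed

lemma
  assumes "A \<in> carrier SU21"
  shows SU21_inv_eq: "matrix_inv A = Smat ** ctranspose A ** Smat"
    and SU21_inv: "A ** matrix_inv A = mat 1" "matrix_inv A ** A = mat 1"
proof -
  have "(Smat ** ctranspose A ** Smat) ** A = Smat ** (ctranspose A ** Smat ** A)"
    by (simp add: matrix_mul_assoc)
  also have "\<dots> = mat 1" using assms by (simp add: carrier_SU21 Smat_Smat)
  finally have 1: "(Smat ** ctranspose A ** Smat) ** A = mat 1" .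
  then have 2: "A ** (Smat ** ctranspose A ** Smat) = mat 1"
    using matrix_left_right_inverse by blast
  show *: "matrix_inv A = Smat ** ctranspose A ** Smat" using matrix_inv_eq[OF 2] .
  show "A ** matrix_inv A = mat 1" "matrix_inv A ** A = mat 1" using 1 2 * by simp_all
qed

lemma SU21_one: "mat 1 \<in> carrier SU21"
  by (simp add: carrier_SU21 cmat3_eq_iff cmat3_mult mat1_nth)

lemma SU21_mult:
  assumes "A \<in> carrier SU21" "B \<in> carrier SU21"
  shows "A ** B \<in> carrier SU21"
proof -
  have "ctranspose (A ** B) ** Smat ** (A ** B) = ctranspose B ** (ctranspose A ** Smat ** A) ** B"
    by (simp add: ctranspose_mult matrix_mul_assoc)
  then show ?thesis using assms by (simp add: carrier_SU21 det_mul)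
qed

lemma SU21_inverse:
  assumes "A \<in> carrier SU21"
  shows "matrix_inv A \<in> carrier SU21"
proof -
  have "ctranspose (matrix_inv A) ** Smat ** matrix_inv A =
      ctranspose (matrix_inv A) ** (ctranspose A ** Smat ** A) ** matrix_inv A"
    using assms by (simp add: carrier_SU21)
  also have "\<dots> = ctranspose (A ** matrix_inv A) ** Smat ** (A ** matrix_inv A)"
    by (simp add: ctranspose_mult matrix_mul_assoc)
  also have "\<dots> = Smat"
    using SU21_one by (simp add: SU21_inv[OF assms] carrier_SU21)
  finally show ?thesis
    using assms arg_cong[OF SU21_inv(1)[OF assms], of det] by (simp add: carrier_SU21 det_mul)
qed

lemma Zthree_coset: "Zthree #>\<^bsub>SU21\<^esub> A = {mat \<zeta> ** A |\<zeta>. \<zeta>^3 = 1}"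
  by (auto simp: r_coset_def Zthree_def)

lemma mat_mult_mat: "(mat a ** A) ** (mat b ** B) = mat (a * b) ** (A ** B)" for A B :: cmat3
  by (simp add: cmat3_eq_iff cmat3_mult mat1_nth algebra_simps)

lemma Zthree_coset_mult:
  "(Zthree #>\<^bsub>SU21\<^esub> A) <#>\<^bsub>SU21\<^esub> (Zthree #>\<^bsub>SU21\<^esub> B) = Zthree #>\<^bsub>SU21\<^esub> (A ** B)"
proof (intro equalityI subsetI)
  fix X assume "X \<in> (Zthree #>\<^bsub>SU21\<^esub> A) <#>\<^bsub>SU21\<^esub> (Zthree #>\<^bsub>SU21\<^esub> B)"
  then obtain a b where "X = (mat a ** A) ** (mat b ** B)" "a^3 = 1" "b^3 = 1"
    unfolding set_mult_def Zthree_coset by auto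
  then have "X = mat (a * b) ** (A ** B)" "(a * b)^3 = 1"
    by (simp_all only: mat_mult_mat power_mult_distrib mult_1)
  then show "X \<in> Zthree #>\<^bsub>SU21\<^esub> (A ** B)"
    unfolding Zthree_coset by blast
next
  fix X assume "X \<in> Zthree #>\<^bsub>SU21\<^esub> (A ** B)"
  then obtain z where "X = mat z ** (A ** B)" and z: "z^3 = 1"
    unfolding Zthree_coset by blast
  then have X: "X = (mat z ** A) \<otimes>\<^bsub>SU21\<^esub> (mat 1 ** B)"
    by (simp add: matrix_mul_assoc)
  have "mat z ** A \<in> Zthree #>\<^bsub>SU21\<^esub> A" "mat 1 ** B \<in> Zthree #>\<^bsub>SU21\<^esub> B"
    unfolding Zthree_coset using z power_one by blast+
  then show "X \<in> (Zthree #>\<^bsub>SU21\<^esub> A) <#>\<^bsub>SU21\<^esub> (Zthree #>\<^bsub>SU21\<^esub> B)"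
    unfolding set_mult_def X by blast
qed

text \<open>The scalars in \<open>Zthree\<close> are central, so conjugation does not see which
  representative \<open>Ad\<close> selects from the coset.\<close>

lemma Zthree_coset_rep:
  assumes "A \<in> carrier SU21"
  shows "(SOME A'. A' \<in> Zthree #>\<^bsub>SU21\<^esub> A) ** Y ** matrix_inv (SOME A'. A' \<in> Zthree #>\<^bsub>SU21\<^esub> A) =
    A ** Y ** matrix_inv A"
proof -
  have "mat 1 ** A \<in> Zthree #>\<^bsub>SU21\<^esub> A"
    unfolding Zthree_coset by (intro CollectI exI[of _ 1]) simp
  then have "(SOME A'. A' \<in> Zthree #>\<^bsub>SU21\<^esub> A) \<in> Zthree #>\<^bsub>SU21\<^esub> A"
    by (rule someI)
  then obtain z where z: "(SOME A'. A' \<in> Zthree #>\<^bsub>SU21\<^esub> A) = mat z ** A" "z^3 = 1"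
    unfolding Zthree_coset by blast
  have z0: "z \<noteq> 0" using z(2) by auto
  have "matrix_inv (mat z ** A) = mat (1/z) ** matrix_inv A"
    by (rule matrix_inv_eq) (use z0 in \<open>simp add: mat_mult_mat SU21_inv[OF assms]\<close>)
  then have "(mat z ** A) ** Y ** matrix_inv (mat z ** A) = (mat z ** (A ** Y)) ** (mat (1/z) ** matrix_inv A)"
    by (simp add: matrix_mul_assoc)
  also have "\<dots> = A ** Y ** matrix_inv A"
    using z0 by (simp add: mat_mult_mat)
  finally show ?thesis by (simp add: z(1))
qed

abbreviation SUSU :: "(cmat3 \<times> cmat3) set" where
  "SUSU \<equiv> carrier SU21 \<times> carrier SU21"

lemma Ad_gquot:
  assumes "AB \<in> SUSU"
  shows "Ad (gquot s AB) X = (let Y = (if s then prod.swap X else X) in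
    (fst AB ** fst Y ** matrix_inv (fst AB), snd AB ** snd Y ** matrix_inv (snd AB)))"
  using assms by (auto simp: Ad_def gquot_def Let_def Zthree_coset_rep)

text \<open>The multiplication of \<open>Ggrp\<close> lifted to pairs of matrices, where
  \<open>s\<close> is the component of the left factor in the group of order two. It is linear in
  the right argument.\<close>

definition gmul :: "bool \<Rightarrow> cmat3 \<times> cmat3 \<Rightarrow> cmat3 \<times> cmat3 \<Rightarrow> cmat3 \<times> cmat3" where
  "gmul s AB CD = (let EF = (if s then prod.swap CD else CD) in (fst AB ** fst EF, snd AB ** snd EF))"

lemma gmul_SUSU: "AB \<in> SUSU \<Longrightarrow> CD \<in> SUSU \<Longrightarrow> gmul s AB CD \<in> SUSU"
  by (auto simp: gmul_def Let_def SU21_mult)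

lemma gquot_mult: "gquot s AB \<otimes>\<^bsub>Ggrp\<^esub> gquot t CD = gquot (s \<noteq> t) (gmul s AB CD)"
  by (auto simp: gquot_def Ggrp_def gmul_def Let_def DirProd_def FactGroup_def Zthree_coset_mult)

lemma Ggrp_one: "\<one>\<^bsub>Ggrp\<^esub> = gquot False (mat 1, mat 1)"
proof -
  have "Zthree #>\<^bsub>SU21\<^esub> mat 1 = Zthree"
    unfolding Zthree_coset by (auto simp: Zthree_def)
  then show ?thesis by (simp add: gquot_def Ggrp_def DirProd_def FactGroup_def)
qed

lemma gquot_carrier: "AB \<in> SUSU \<Longrightarrow> gquot s AB \<in> carrier Ggrp"
  by (auto simp: gquot_def Ggrp_def DirProd_def FactGroup_def RCOSETS_def)

lemma Ggrp_cases:
  assumes "a \<in> carrier Ggrp"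
  obtains s AB where "AB \<in> SUSU" "a = gquot s AB"
proof -
  obtain C D s where a: "a = ((C, D), s)" by (metis surj_pair)
  with assms obtain A B where "A \<in> carrier SU21" "C = Zthree #>\<^bsub>SU21\<^esub> A" "B \<in> carrier SU21" "D = Zthree #>\<^bsub>SU21\<^esub> B"
    by (auto simp: Ggrp_def DirProd_def FactGroup_def RCOSETS_def)
  with a that[of "(A, B)" s] show ?thesis by (auto simp: gquot_def)
qed

lemma Ad_mult:
  assumes "AB \<in> SUSU" "CD \<in> SUSU"
  shows "Ad (gquot (s \<noteq> t) (gmul s AB CD)) X = Ad (gquot s AB) (Ad (gquot t CD) X)"
proof -
  have *: "matrix_inv (A ** C) = matrix_inv C ** matrix_inv A" if "A \<in> carrier SU21" "C \<in> carrier SU21" for A C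
  proof (rule matrix_inv_eq)
    have "A ** C ** (matrix_inv C ** matrix_inv A) = A ** (C ** matrix_inv C) ** matrix_inv A"
      by (simp add: matrix_mul_assoc)
    then show "A ** C ** (matrix_inv C ** matrix_inv A) = mat 1"
      by (simp add: SU21_inv that)
  qed
  have "gmul s AB CD \<in> SUSU" using gmul_SUSU assms by blast
  then show ?thesis
    using assms by (cases s; cases t) (auto simp: Ad_gquot gmul_def Let_def * matrix_mul_assoc)
qed

lemma conj_su21:
  assumes A: "A \<in> carrier SU21" and Y: "Y \<in> su21"
  shows "A ** Y ** matrix_inv A \<in> su21"
proof -
  let ?I = "matrix_inv A"
  have S: "ctranspose A ** Smat ** A = Smat" using A by (simp add: carrier_SU21)
  have AS: "ctranspose A ** Smat = Smat ** ?I"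
  proof -
    have "ctranspose A ** Smat = (ctranspose A ** Smat ** A) ** ?I"
      by (simp add: SU21_inv[OF A] flip: matrix_mul_assoc)
    then show ?thesis by (simp add: S)
  qed
  have IS: "ctranspose ?I ** Smat = Smat ** A"
  proof -
    have "ctranspose ?I ** Smat = ctranspose ?I ** (ctranspose A ** Smat ** A)" by (simp add: S)
    also have "\<dots> = ctranspose (A ** ?I) ** Smat ** A" by (simp add: ctranspose_mult matrix_mul_assoc)
    also have "\<dots> = Smat ** A"
      by (simp add: SU21_inv(1)[OF A]) (simp add: cmat3_eq_iff cmat3_mult mat1_nth)
    finally show ?thesis .
  qed
  have Y0: "ctranspose Y ** Smat = - (Smat ** Y)"
    using Y by (simp add: su21_def eq_neg_iff_add_eq_0)
  have neg: "U ** (- V) = - (U ** V)" "(- V) ** U = - (V ** U)" for U V :: cmat3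
    by (simp_all add: cmat3_eq_iff cmat3_mult)
  have "ctranspose (A ** Y ** ?I) ** Smat = ctranspose ?I ** ctranspose Y ** (ctranspose A ** Smat)"
    by (simp add: ctranspose_mult matrix_mul_assoc)
  also have "\<dots> = ctranspose ?I ** (ctranspose Y ** Smat) ** ?I" by (simp add: AS matrix_mul_assoc)
  also have "\<dots> = - (ctranspose ?I ** Smat ** Y ** ?I)" by (simp add: Y0 neg matrix_mul_assoc)
  also have "\<dots> = - (Smat ** (A ** Y ** ?I))" by (simp add: IS matrix_mul_assoc)
  finally have 1: "ctranspose (A ** Y ** ?I) ** Smat + Smat ** (A ** Y ** ?I) = 0" by simp
  have "trace (A ** Y ** ?I) = trace (?I ** (A ** Y))" by (rule trace_mul_sym)
  also have "\<dots> = trace Y" by (simp add: matrix_mul_assoc SU21_inv[OF A])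
  finally have "trace (A ** Y ** ?I) = 0" using Y by (simp add: su21_def)
  with 1 show ?thesis by (simp add: su21_def)
qed

lemma Ad_galg: "AB \<in> SUSU \<Longrightarrow> X \<in> galg \<Longrightarrow> Ad (gquot s AB) X \<in> galg"
  by (auto simp: Ad_gquot Let_def galg_def conj_su21)

lemma Ad_linear: "AB \<in> SUSU \<Longrightarrow> linear (Ad (gquot s AB))"
  by (rule linearI) (auto simp: Ad_gquot Let_def cmat3_eq_iff cmat3_mult algebra_simps)

lemma conj_cancel:
  assumes "A \<in> carrier SU21" "A ** Y ** matrix_inv A = A ** Z ** matrix_inv A"
  shows "Y = Z"
proof -
  have "matrix_inv A ** (A ** Y ** matrix_inv A) ** A = matrix_inv A ** (A ** Z ** matrix_inv A) ** A"
    using assms(2) by simp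
  then have "(matrix_inv A ** A) ** Y ** (matrix_inv A ** A) = (matrix_inv A ** A) ** Z ** (matrix_inv A ** A)"
    by (simp only: matrix_mul_assoc)
  then show ?thesis by (simp add: SU21_inv[OF assms(1)])
qed

lemma Ad_inj:
  assumes "AB \<in> SUSU"
  shows "inj (Ad (gquot s AB))"
proof (rule injI)
  fix X Y assume "Ad (gquot s AB) X = Ad (gquot s AB) Y"
  moreover define X' Y' where "X' = (if s then prod.swap X else X)" and "Y' = (if s then prod.swap Y else Y)"
  ultimately have "fst AB ** fst X' ** matrix_inv (fst AB) = fst AB ** fst Y' ** matrix_inv (fst AB)"
    "snd AB ** snd X' ** matrix_inv (snd AB) = snd AB ** snd Y' ** matrix_inv (snd AB)"
    using assms by (simp_all add: Ad_gquot Let_def)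
  then have "fst X' = fst Y'" "snd X' = snd Y'"
    using conj_cancel assms by (metis mem_Times_iff)+
  then have "X' = Y'" by (simp add: prod_eq_iff)
  then have "(if s then prod.swap X else X) = (if s then prod.swap Y else Y)"
    by (simp add: X'_def Y'_def)
  then show "X = Y" by (cases s) (auto simp: prod_eq_iff)
qed

lemma Ad_one: "Ad (gquot False (mat 1, mat 1)) X = X"
  by (simp add: Ad_gquot SU21_one matrix_inv_eq[of "mat 1" "mat 1"])

lemma one_in_G0set: "\<one>\<^bsub>Ggrp\<^esub> \<in> G0set"
  by (auto simp: Ggrp_one Pset_def G0set_def Ad_one gquot_carrier SU21_one)

text \<open>\<open>Pset\<close> asks for inclusions only; as \<open>Ad\<close> is injective and
  linear, equality follows by dimension.\<close>

lemma Ad_gfilt_eq: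
  assumes "AB \<in> SUSU" "gquot s AB \<in> Pset"
  shows "Ad (gquot s AB) ` gfilt k = gfilt k"
proof (rule subspace_dim_equal)
  show "subspace (Ad (gquot s AB) ` gfilt k)"
    by (rule linear_subspace_image[OF Ad_linear[OF assms(1)] subspace_gfilt])
  show "dim (gfilt k) \<le> dim (Ad (gquot s AB) ` gfilt k)"
    using dim_image_eq[OF Ad_linear[OF assms(1)] inj_on_subset[OF Ad_inj[OF assms(1)] subset_UNIV]]
    by simp
  show "Ad (gquot s AB) ` gfilt k \<subseteq> gfilt k" using assms(2) by (simp add: Pset_def)
qed (rule subspace_gfilt)

text \<open>Because the filtration is preserved with equality, left translation by an element of
  \<open>Pset\<close> also reflects membership in \<open>Pset\<close>. This is what allows charts to
  be moved to the identity.\<close>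

lemma Pset_mult_iff:
  assumes "AB \<in> SUSU" "CD \<in> SUSU" "gquot s AB \<in> Pset"
  shows "gquot (s \<noteq> t) (gmul s AB CD) \<in> Pset \<longleftrightarrow> gquot t CD \<in> Pset"
proof -
  have "Ad (gquot (s \<noteq> t) (gmul s AB CD)) ` gfilt k = Ad (gquot s AB) ` Ad (gquot t CD) ` gfilt k" for k
    using Ad_mult[OF assms(1,2)] by (simp add: image_image)
  moreover have "Ad (gquot s AB) ` V \<subseteq> gfilt k \<longleftrightarrow> V \<subseteq> gfilt k" for V k
    using Ad_gfilt_eq[OF assms(1,3), of k] Ad_inj[OF assms(1), of s]
    by (metis inj_image_subset_iff)
  ultimately show ?thesis
    using assms gmul_SUSU by (simp add: Pset_def gquot_carrier)
qed

definition cxm1 :: "cmat3 \<Rightarrow> cmat3" where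
  "cxm1 Y = (\<chi> i j. if i = 2 \<and> j = 1 then \<i> * Y$2$1 else if i = 3 \<and> j = 2 then - \<i> * Y$3$2 else 0)"

lemma cxm_eq: "cxm X = (cxm1 (fst X), cxm1 (snd X))"
  by (simp add: cxm_def cxm1_def Let_def)

text \<open>Testing the hypothesis on one real matrix \<open>E\<close> forces the first row of
  \<open>A\<close> to be concentrated in \<open>A$1$1\<close>. Then conjugation multiplies the entry
  \<open>$2$1\<close> by the complex number \<open>A$2$2 / A$1$1\<close>, hence commutes with
  multiplication by \<open>\<i>\<close>.\<close>

lemma conj_cxm1:
  assumes A: "A \<in> carrier SU21"
    and pres: "\<And>Y. Y \<in> su21_grade (-1) \<Longrightarrow> A ** Y ** matrix_inv A \<in> su21_grade (-1)"
    and Y: "Y \<in> su21_grade (-1)"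
  shows "A ** cxm1 Y ** matrix_inv A = cxm1 (A ** Y ** matrix_inv A)"
proof -
  define Z where "Z U = A ** U ** matrix_inv A" for U
  have ZA: "Z U ** A = A ** U" for U
    by (simp add: Z_def SU21_inv[OF A] flip: matrix_mul_assoc)
  define E :: cmat3 where "E = (\<chi> i j. if i = 2 \<and> j = 1 then 1 else if i = 3 \<and> j = 2 then -1 else 0)"
  have E: "E \<in> su21_grade (-1)" by (simp add: su21_grade_minus1 E_def)
  have "(Z E ** A)$1$1 = (A ** E)$1$1" "(Z E ** A)$1$2 = (A ** E)$1$2" by (simp_all add: ZA)
  then have A1: "A$1$2 = 0" "A$1$3 = 0"
    using pres[OF E] by (simp_all add: cmat3_mult su21_grade_minus1 E_def Z_def[symmetric])
  have "(A ** matrix_inv A)$1$1 = 1" by (simp add: SU21_inv[OF A] mat1_nth)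
  then have A11: "A$1$1 \<noteq> 0" using A1 by (auto simp: cmat3_mult)
  have cY: "cxm1 Y \<in> su21_grade (-1)"
    using Y by (simp add: su21_grade_minus1 cxm1_def)
  have "Z U$2$1 * A$1$1 = A$2$2 * U$2$1" if "U \<in> su21_grade (-1)" for U
    using arg_cong[OF ZA[of U], of "\<lambda>M. M$2$1"] pres[OF that] that
    by (simp add: cmat3_mult su21_grade_minus1 Z_def[symmetric])
  from this[OF Y] this[OF cY] have "Z (cxm1 Y)$2$1 * A$1$1 = \<i> * Z Y$2$1 * A$1$1"
    by (simp add: cxm1_def)
  then have "Z (cxm1 Y)$2$1 = \<i> * Z Y$2$1" using A11 by simp
  then have "Z (cxm1 Y) = cxm1 (Z Y)"
    using pres[OF Y] pres[OF cY]
    unfolding Z_def[symmetric] by (simp add: su21_grade_minus1 cmat3_eq_iff cxm1_def)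
  then show ?thesis by (simp add: Z_def)
qed

lemma G0set_cxm:
  assumes a: "a \<in> G0set" and X: "X \<in> ggr (-1)"
  shows "Ad a (cxm X) = cxm (Ad a X)"
proof -
  have "a \<in> carrier Ggrp" using a by (auto simp: G0set_def Pset_def)
  then obtain s A B where AB: "(A, B) \<in> SUSU" "a = gquot s (A, B)"
    using Ggrp_cases by (metis surj_pair)
  have zero: "0 \<in> su21_grade (-1)" by (simp add: su21_grade_minus1)
  have pres: "Ad a (U, V) \<in> ggr (-1)" if "U \<in> su21_grade (-1)" "V \<in> su21_grade (-1)" for U V
    using a that by (force simp: G0set_def ggr_def)
  \<comment> \<open>The pair \<open>(Y, Y)\<close> is fixed by the swap, so it tests both matrices
    for either value of \<open>s\<close>.\<close>
  have "A ** Y ** matrix_inv A \<in> su21_grade (-1) \<and> B ** Y ** matrix_inv B \<in> su21_grade (-1)"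
    if "Y \<in> su21_grade (-1)" for Y
    using pres[OF that that] AB by (cases s) (auto simp: Ad_gquot ggr_def)
  then have "A ** cxm1 Y ** matrix_inv A = cxm1 (A ** Y ** matrix_inv A)"
    "B ** cxm1 Y ** matrix_inv B = cxm1 (B ** Y ** matrix_inv B)" if "Y \<in> su21_grade (-1)" for Y
    using conj_cxm1[of A Y] conj_cxm1[of B Y] AB that by auto
  then show ?thesis
    using X AB by (auto simp: Ad_gquot cxm_eq Let_def ggr_def)
qed

section \<open>Exponentials of homogeneous elements of \<open>palg\<close>\<close>

lemma mexp_nilpotent:
  assumes "X$1$1 = 0" "X$2$1 = 0" "X$2$2 = 0" "X$3$1 = 0" "X$3$2 = 0" "X$3$3 = 0"
  shows "mexp X = mat 1 + X + (1/2) *\<^sub>R (X ** X)"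
proof -
  have "X ** (X ** (X ** Q)) = 0" for Q :: cmat3
    using assms by (simp add: cmat3_eq_iff cmat3_mult)
  then have "mpow X (3 + n) = 0" for n by (simp add: eval_nat_numeral)
  then have "(1 / fact n) *\<^sub>R mpow X n = 0" if "n \<notin> {..<3}" for n
    using that by (metis le_add_diff_inverse lessThan_iff not_less scaleR_zero_right)
  then have "(\<lambda>n. (1 / fact n) *\<^sub>R mpow X n) sums (\<Sum>n<3. (1 / fact n) *\<^sub>R mpow X n)"
    by (intro sums_finite) auto
  then show ?thesis
    unfolding mexp_def by (simp add: sums_iff eval_nat_numeral lessThan_Suc)
qed

lemma mexp_diagonal:
  assumes "\<And>i j. i \<noteq> j \<Longrightarrow> X$i$j = 0"
  shows "mexp X = (\<chi> i j. if i = j then exp (X$i$i) else 0)"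
proof -
  have X: "X$1$2 = 0" "X$1$3 = 0" "X$2$1 = 0" "X$2$3 = 0" "X$3$1 = 0" "X$3$2 = 0"
    using assms by simp_all
  have mp: "mpow X n = (\<chi> i j. if i = j then X$i$i ^ n else 0)" for n
    by (induction n) (use X in \<open>simp_all add: cmat3_eq_iff cmat3_mult mat1_nth\<close>)
  have "(\<lambda>n. (1 / fact n) *\<^sub>R mpow X n) sums (\<chi> i j. if i = j then exp (X$i$i) else 0)"
    unfolding sums_def
  proof (intro vec_tendstoI)
    fix i j :: 3
    have "(\<lambda>n. (1 / fact n) *\<^sub>R (if i = j then X$i$i ^ n else 0)) sums (if i = j then exp (X$i$i) else 0)"
      using exp_converges[of "X$i$i"] by (cases "i = j") (auto simp: divide_inverse)
    then show "(\<lambda>n. (\<Sum>n<n. (1 / fact n) *\<^sub>R mpow X n)$i$j) \<longlonglongrightarrow>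
        (\<chi> i j. if i = j then exp (X$i$i) else 0)$i$j"
      by (simp add: sums_def mp)
  qed
  then show ?thesis unfolding mexp_def by (simp add: sums_iff)
qed

lemma su21_grade_0: "X \<in> su21_grade 0 \<longleftrightarrow> X$1$1 + X$2$2 + X$3$3 = 0 \<and>
    X$3$3 = - cnj (X$1$1) \<and> X$2$2 = - cnj (X$2$2) \<and> (\<forall>i j. i \<noteq> j \<longrightarrow> X$i$j = 0)"
  by (auto simp: su21_grade_def su21_iff forall_3)

lemma su21_grade_pos: "X \<in> su21_grade 1 \<or> X \<in> su21_grade 2 \<Longrightarrow> X$1$1 = 0 \<and> X$2$1 = 0 \<and> X$2$2 = 0 \<and>
    X$3$1 = 0 \<and> X$3$2 = 0 \<and> X$3$3 = 0 \<and> X$2$3 = - cnj (X$1$2) \<and> X$1$3 = - cnj (X$1$3)"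
  by (auto simp: su21_grade_def su21_iff forall_3)

text \<open>In a single degree the exponential is explicit: diagonal in degree 0, quadratic in the
  strictly upper triangular degrees. The group equations can thus be checked entry by entry.\<close>

lemma mexp_SU21:
  assumes "X \<in> su21_grade k" "k \<in> {0, 1, 2}"
  shows "mexp X \<in> carrier SU21" "pos3 j < pos3 i \<Longrightarrow> mexp X$i$j = 0"
proof -
  have "mexp X \<in> carrier SU21 \<and> mexp X$2$1 = 0 \<and> mexp X$3$1 = 0 \<and> mexp X$3$2 = 0"
  proof (cases "k = 0")
    case True
    then have X: "X$1$1 + X$2$2 + X$3$3 = 0" "X$3$3 = - cnj (X$1$1)" "X$2$2 = - cnj (X$2$2)"
       "\<And>i j. i \<noteq> j \<Longrightarrow> X$i$j = 0"
      using assms by (auto simp: su21_grade_0)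
    have "exp (X$1$1) * exp (X$2$2) * exp (X$3$3) = 1"
      using X(1) by (simp flip: exp_add)
    moreover have "exp (cnj (X$2$2)) * exp (X$2$2) = 1"
      using X(3) by (simp flip: exp_add add: eq_neg_iff_add_eq_0 add.commute)
    moreover have "exp (cnj (X$1$1)) * exp (X$3$3) = 1" "exp (cnj (X$3$3)) * exp (X$1$1) = 1"
      using X(2) by (simp_all flip: exp_add)
    ultimately show ?thesis
      by (simp add: mexp_diagonal[OF X(4)] carrier_SU21 cmat3_eq_iff cmat3_mult det_3 exp_cnj)
  next
    case False
    then have X: "X$1$1 = 0 \<and> X$2$1 = 0 \<and> X$2$2 = 0 \<and>
      X$3$1 = 0 \<and> X$3$2 = 0 \<and> X$3$3 = 0 \<and> X$2$3 = - cnj (X$1$2) \<and> X$1$3 = - cnj (X$1$3)"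
      using assms by (intro su21_grade_pos) auto
    then have "cnj (X$1$3) + X$1$3 = 0" by (metis add.right_inverse add.commute)
    then show ?thesis
      using X by (simp add: mexp_nilpotent carrier_SU21 cmat3_eq_iff cmat3_mult det_3 mat1_nth)
       (simp add: algebra_simps scaleR_conv_of_real)
  qed
  then show "mexp X \<in> carrier SU21" and "pos3 j < pos3 i \<Longrightarrow> mexp X$i$j = 0"
    using exhaust_3[of i] exhaust_3[of j] by auto
qed

lemma scaleR_mult_scaleR: "(s *\<^sub>R X) ** (t *\<^sub>R Y) = (s * t) *\<^sub>R (X ** Y)" for X Y :: cmat3
  by (simp add: cmat3_eq_iff cmat3_mult scaleR_add_right mult.commute[of s])

lemma mexp_tendsto:
  assumes "X \<in> su21_grade k" "k \<in> {0, 1, 2}"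
  shows "((\<lambda>t. mexp (t *\<^sub>R X)) \<longlongrightarrow> mat 1) (at 0)" "mexp 0 = mat 1"
proof -
  have "((\<lambda>t. mexp (t *\<^sub>R X)) \<longlongrightarrow> mat 1) (at 0) \<and> mexp (0 *\<^sub>R X) = mat 1"
  proof (cases "k = 0")
    case True
    then have "X$i$j = 0" if "i \<noteq> j" for i j
      using assms that by (auto simp: su21_grade_0)
    then have e: "mexp (t *\<^sub>R X) = (\<chi> i j. if i = j then exp (t *\<^sub>R X$i$i) else 0)" for t
      by (subst mexp_diagonal) (auto simp: vec_eq_iff)
    have "((\<lambda>t. if i = j then exp (t *\<^sub>R X$i$i) else 0) \<longlongrightarrow> mat 1$i$j) (at 0)" for i j
      by (cases "i = j") (auto simp: mat_def intro!: tendsto_eq_intros)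
    then show ?thesis
      unfolding e by (auto intro!: vec_tendstoI simp: mat_def vec_eq_iff)
  next
    case False
    then have X: "X$1$1 = 0 \<and> X$2$1 = 0 \<and> X$2$2 = 0 \<and> X$3$1 = 0 \<and> X$3$2 = 0 \<and> X$3$3 = 0"
      using assms su21_grade_pos[of X] by auto
    then have e: "mexp (t *\<^sub>R X) = mat 1 + t *\<^sub>R X + (t * t / 2) *\<^sub>R (X ** X)" for t
      by (subst mexp_nilpotent) (auto simp: scaleR_mult_scaleR)
    show ?thesis
      unfolding e by (auto intro!: tendsto_eq_intros)
  qed
  then show "((\<lambda>t. mexp (t *\<^sub>R X)) \<longlongrightarrow> mat 1) (at 0)" "mexp 0 = mat 1"
    by auto
qed

text \<open>An upper triangular element of \<open>SU21\<close> has upper triangular inverse, as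
  \<open>Smat ** ctranspose C ** Smat\<close> shows. A summand
  \<open>C$i$m * Y$m$l * matrix_inv C$l$j\<close> can be nonzero only for m not before i and l not
  after j, so degrees can only increase.\<close>

lemma upper_triangular_in_Pset:
  assumes A: "A \<in> carrier SU21" "\<And>i j. pos3 j < pos3 i \<Longrightarrow> A$i$j = 0"
    and B: "B \<in> carrier SU21" "\<And>i j. pos3 j < pos3 i \<Longrightarrow> B$i$j = 0"
  shows "gquot False (A, B) \<in> Pset"
proof -
  have *: "(C ** Y ** matrix_inv C)$i$j = 0"
    if C: "C \<in> carrier SU21" "\<And>i j. pos3 j < pos3 i \<Longrightarrow> C$i$j = 0"
      and Y: "\<And>i j. pos3 j - pos3 i < k \<Longrightarrow> Y$i$j = 0" and ij: "pos3 j - pos3 i < k"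
    for C Y k i j
  proof -
    have "C$2$1 = 0" "C$3$1 = 0" "C$3$2 = 0" using C(2) by simp_all
    then have "matrix_inv C$2$1 = 0 \<and> matrix_inv C$3$1 = 0 \<and> matrix_inv C$3$2 = 0"
      by (simp add: SU21_inv_eq[OF C(1)] cmat3_mult)
    then have I: "matrix_inv C$l$j = 0" if "pos3 j < pos3 l" for l
      using that exhaust_3[of l] exhaust_3[of j] by auto
    have "C$i$m * Y$m$l * matrix_inv C$l$j = 0" for m l
    proof (cases "pos3 m < pos3 i \<or> pos3 j < pos3 l")
      case True
      then show ?thesis using C(2) I by auto
    next
      case False
      then have "pos3 l - pos3 m < k" using ij by linarith
      then show ?thesis using Y by simp
    qed
    then show ?thesis
      by (simp add: matrix_matrix_mult_def sum_distrib_right) (auto intro!: sum.neutral)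
  qed
  have "Ad (gquot False (A, B)) X \<in> gfilt k" if "X \<in> gfilt k" for X k
  proof -
    have "Ad (gquot False (A, B)) X \<in> galg"
      using that A B by (intro Ad_galg) (auto simp: gfilt_iff)
    then show ?thesis
      using that A B *[of A k "fst X"] *[of B k "snd X"] by (simp add: gfilt_iff Ad_gquot)
  qed
  then show ?thesis
    using A B by (auto simp: Pset_def gquot_carrier)
qed

lemma gexp_curve:
  assumes X: "X \<in> ggr k" and k: "k \<in> {0, 1, 2}"
  shows "gexp (t *\<^sub>R X) = gquot False (mexp (t *\<^sub>R fst X), mexp (t *\<^sub>R snd X))"
    and "(mexp (t *\<^sub>R fst X), mexp (t *\<^sub>R snd X)) \<in> {AB \<in> SUSU. gquot False AB \<in> Pset}"
    and "((\<lambda>t. (mexp (t *\<^sub>R fst X), mexp (t *\<^sub>R snd X))) \<longlongrightarrow> (mat 1, mat 1)) (at 0)"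
    and "gexp (0 *\<^sub>R X) = \<one>\<^bsub>Ggrp\<^esub>"
proof -
  have 1: "t *\<^sub>R fst X \<in> su21_grade k" "t *\<^sub>R snd X \<in> su21_grade k" for t
    using X by (auto simp: ggr_def intro!: subspace_scale[OF subspace_su21_grade])
  show "gexp (t *\<^sub>R X) = gquot False (mexp (t *\<^sub>R fst X), mexp (t *\<^sub>R snd X))"
    by (simp add: gexp_def)
  show "(mexp (t *\<^sub>R fst X), mexp (t *\<^sub>R snd X)) \<in> {AB \<in> SUSU. gquot False AB \<in> Pset}"
    using mexp_SU21[OF 1(1) k] mexp_SU21[OF 1(2) k] by (auto intro!: upper_triangular_in_Pset)
  show "((\<lambda>t. (mexp (t *\<^sub>R fst X), mexp (t *\<^sub>R snd X))) \<longlongrightarrow> (mat 1, mat 1)) (at 0)"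
    using X k by (intro tendsto_Pair mexp_tendsto[of _ k]) (auto simp: ggr_def)
  show "gexp (0 *\<^sub>R X) = \<one>\<^bsub>Ggrp\<^esub>"
    using mexp_tendsto(2)[OF 1(1) k] by (simp add: gexp_def Ggrp_one)
qed

section \<open>Charts of \<open>Pset\<close> around the identity\<close>

abbreviation Plift :: "bool \<Rightarrow> (cmat3 \<times> cmat3) set" where
  "Plift s \<equiv> {AB \<in> SUSU. gquot s AB \<in> Pset}"

lemma P_atlas_cases:
  assumes "c \<in> P_atlas"
  obtains s U where "fst c = gquot s ` U" "(U, snd c \<circ> gquot s) \<in> submanifold_charts (Plift s)"
    "inj_on (gquot s) U"
proof -
  obtain s U \<phi> where "c = (gquot s ` U, \<phi>)" "(U, \<phi> \<circ> gquot s) \<in> submanifold_charts (Plift s)"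
    "inj_on (gquot s) U"
    using assms unfolding P_atlas_def by blast
  then show ?thesis using that[of s U] by simp
qed

lemma P_atlas_inj_open:
  assumes "c \<in> P_atlas"
  shows "inj_on (snd c) (fst c)" "open (snd c ` fst c)"
proof -
  obtain s U where *: "fst c = gquot s ` U" "(U, snd c \<circ> gquot s) \<in> submanifold_charts (Plift s)"
    by (rule P_atlas_cases[OF assms])
  then have "inj_on (snd c \<circ> gquot s) U" "open ((snd c \<circ> gquot s) ` U)"
    unfolding submanifold_charts_def by blast+
  then show "inj_on (snd c) (fst c)" "open (snd c ` fst c)"
    using inj_on_imageI[of "snd c" "gquot s" U] by (simp_all only: *(1) image_comp)
qed

text \<open>A submanifold chart is the restriction of a map \<Phi> that is continuous on an open set
  of matrices, so convergence of the lifted curve as matrices is enough.\<close>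

lemma P_chart_tendsto:
  assumes c: "c \<in> P_atlas" and a: "\<one>\<^bsub>Ggrp\<^esub> \<in> fst c"
    and m: "\<And>t. m t \<in> Plift False" "(m \<longlongrightarrow> (mat 1, mat 1)) F"
    and U: "fst c = gquot False ` U" "(U, snd c \<circ> gquot False) \<in> submanifold_charts (Plift False)"
      "(mat 1, mat 1) \<in> U"
  shows "\<forall>\<^sub>F t in F. gquot False (m t) \<in> fst c"
    "((\<lambda>t. snd c (gquot False (m t))) \<longlongrightarrow> snd c \<one>\<^bsub>Ggrp\<^esub>) F"
proof -
  obtain W \<Phi> where W: "open W" "U = Plift False \<inter> W" "smooth_on W \<Phi>"
    "\<And>x. x \<in> U \<Longrightarrow> (snd c \<circ> gquot False) x = \<Phi> x"
    using U(2) unfolding submanifold_charts_def by blast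
  have "\<forall>\<^sub>F t in F. m t \<in> W"
    using topological_tendstoD[OF m(2) W(1)] U(3) W(2) by blast
  then have ev: "\<forall>\<^sub>F t in F. m t \<in> U"
    by eventually_elim (use m(1) W(2) in blast)
  then show "\<forall>\<^sub>F t in F. gquot False (m t) \<in> fst c"
    by eventually_elim (simp add: U(1))
  have "isCont \<Phi> (mat 1, mat 1)"
    using smooth_on_continuous_on[OF W(3)] W(1,2) U(3) by (auto simp: continuous_on_eq_continuous_at)
  then have "((\<lambda>t. \<Phi> (m t)) \<longlongrightarrow> \<Phi> (mat 1, mat 1)) F"
    using isCont_tendsto_compose m(2) by blast
  then have "((\<lambda>t. snd c (gquot False (m t))) \<longlongrightarrow> \<Phi> (mat 1, mat 1)) F"
    by (rule Lim_transform_eventually) (use ev in eventually_elim, use W(4) in fastforce)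
  then show "((\<lambda>t. snd c (gquot False (m t))) \<longlongrightarrow> snd c \<one>\<^bsub>Ggrp\<^esub>) F"
    using W(4)[OF U(3)] by (simp add: Ggrp_one)
qed

lemma gmul_linear: "linear (gmul s AB)"
  by (rule linearI) (auto simp: gmul_def Let_def cmat3_eq_iff cmat3_mult algebra_simps)

text \<open>Left translation carries a chart around any element to a chart around the identity.\<close>

lemma P_atlas_chart_one:
  assumes c0: "c0 \<in> P_atlas" "fst c0 \<noteq> {}"
  obtains c U where "c \<in> P_atlas" "fst c = gquot False ` U"
    "(U, snd c \<circ> gquot False) \<in> submanifold_charts (Plift False)" "(mat 1, mat 1) \<in> U"
proof -
  obtain s U where U: "fst c0 = gquot s ` U" "(U, snd c0 \<circ> gquot s) \<in> submanifold_charts (Plift s)"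
    "inj_on (gquot s) U"
    by (rule P_atlas_cases[OF c0(1)])
  define \<psi> where "\<psi> = snd c0 \<circ> gquot s"
  obtain W \<Phi> where W: "open W" "U = Plift s \<inter> W" "smooth_on W \<Phi>" "\<And>x. x \<in> U \<Longrightarrow> \<psi> x = \<Phi> x"
    "inj_on \<psi> U" "open (\<psi> ` U)" "smooth_on (\<psi> ` U) (inv_into U \<psi>)"
    using U(2) unfolding submanifold_charts_def \<psi>_def[symmetric] by blast
  obtain A B where AB: "(A, B) \<in> U" using U(1) c0(2) by fastforce
  then have ABS: "(A, B) \<in> SUSU" "gquot s (A, B) \<in> Pset" using W(2) by auto
  define L where "L = gmul s (A, B)"
  \<comment> \<open>\<open>T\<close> inverts the left translation \<open>L\<close>. Both are linear
    on all pairs of matrices, so the transported chart and its inverse inherit smoothness by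
    composition.\<close>
  define T where "T EF = (let H = gmul False (matrix_inv A, matrix_inv B) EF in if s then prod.swap H else H)" for EF
  have AI: "A ** (matrix_inv A ** C) = C" "matrix_inv A ** (A ** C) = C" for C :: cmat3
    using ABS SU21_inv[of A] by (simp_all add: matrix_mul_assoc)
  have BI: "B ** (matrix_inv B ** C) = C" "matrix_inv B ** (B ** C) = C" for C :: cmat3
    using ABS SU21_inv[of B] by (simp_all add: matrix_mul_assoc)
  have LT: "L (T EF) = EF" and TL: "T (L EF) = EF" for EF
    by (cases EF; cases s; simp add: L_def T_def gmul_def AI BI Let_def)+
  have "linear (\<lambda>X :: gvec. prod.swap X)" by (rule linearI) (auto simp: prod_eq_iff)
  then have "linear T"
    using linear_compose[OF gmul_linear[of False "(matrix_inv A, matrix_inv B)"], of prod.swap]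
      gmul_linear[of False "(matrix_inv A, matrix_inv B)"]
    unfolding T_def Let_def by (cases s) (simp_all add: comp_def)
  then have bL: "bounded_linear L" and bT: "bounded_linear T"
    unfolding L_def using gmul_linear by (auto simp: linear_conv_bounded_linear[symmetric])
  have L_SUSU: "L CD \<in> SUSU" if "CD \<in> SUSU" for CD
    unfolding L_def by (rule gmul_SUSU[OF ABS(1) that])
  have "T EF \<in> SUSU" if "EF \<in> SUSU" for EF
  proof -
    have "gmul False (matrix_inv A, matrix_inv B) EF \<in> SUSU"
      by (rule gmul_SUSU[OF _ that]) (use SU21_inverse ABS in auto)
    then show ?thesis by (cases s) (auto simp: T_def Let_def)
  qed
  then have L_SUSU_iff: "L CD \<in> SUSU \<longleftrightarrow> CD \<in> SUSU" for CD
    using L_SUSU TL by metis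
  have L_Plift: "L CD \<in> Plift s \<longleftrightarrow> CD \<in> Plift False" for CD
    using Pset_mult_iff[OF ABS(1) _ ABS(2), of CD False] L_SUSU_iff unfolding L_def by auto
  define U' where "U' = L -` U"
  define \<phi> where "\<phi> g = snd c0 (gquot s (A, B) \<otimes>\<^bsub>Ggrp\<^esub> g)" for g
  have \<phi>: "\<phi> \<circ> gquot False = \<psi> \<circ> L"
    by (auto simp: \<phi>_def \<psi>_def L_def gquot_mult)
  have LU': "L ` U' = U" unfolding U'_def using LT by (metis surjI surj_image_vimage_eq)
  have img: "(\<psi> \<circ> L) ` U' = \<psi> ` U" unfolding image_comp[symmetric] LU' ..
  have injL: "inj L" using TL by (metis injI)
  have inj: "inj_on (\<psi> \<circ> L) U'"
    using W(5) LU' injL by (intro comp_inj_on) (auto intro: inj_on_subset)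
  have "(U', \<psi> \<circ> L) \<in> submanifold_charts (Plift False)"
  proof -
    have 1: "open (L -` W)"
      using W(1) bL by (simp add: open_vimage linear_continuous_on continuous_on_eq_continuous_at)
    have 2: "U' = Plift False \<inter> L -` W" using L_Plift W(2) by (auto simp: U'_def)
    have 3: "smooth_on (L -` W) (\<lambda>x. \<Phi> (L x))"
      using smooth_on_compose[OF 1 _ smooth_on_bounded_linear[OF bL] W(3)] by auto
    have 4: "(\<psi> \<circ> L) x = \<Phi> (L x)" if "x \<in> U'" for x using W(4) that by (simp add: U'_def)
    have "smooth_on (\<psi> ` U) (\<lambda>q. T (inv_into U \<psi> q))"
      using smooth_on_compose[OF W(6) _ W(7) smooth_on_bounded_linear[OF bT], of UNIV] by auto
    then have 5: "smooth_on (\<psi> ` U) (inv_into U' (\<psi> \<circ> L))"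
    proof (rule smooth_on_cong[OF W(6), rotated])
      fix q assume "q \<in> \<psi> ` U"
      then obtain x where x: "x \<in> U" "q = \<psi> x" by blast
      then have "T x \<in> U'" "(\<psi> \<circ> L) (T x) = q" by (simp_all add: U'_def LT)
      then have "inv_into U' (\<psi> \<circ> L) q = T x" using inj by (metis inv_into_f_f)
      then show "T (inv_into U \<psi> q) = inv_into U' (\<psi> \<circ> L) q" using x W(5) by simp
    qed
    show ?thesis
      unfolding submanifold_charts_def using 1 2 3 4 inj img W(6) 5
      by (intro CollectI case_prodI exI[of _ "L -` W"] exI[of _ "\<lambda>x. \<Phi> (L x)"]) simp
  qed
  moreover have "inj_on (gquot False) U'"
  proof (rule inj_onI)
    fix CD CD' assume *: "CD \<in> U'" "CD' \<in> U'" "gquot False CD = gquot False CD'"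
    have "gquot s (L CD) = gquot s (L CD')"
      using gquot_mult[of s "(A, B)" False CD] gquot_mult[of s "(A, B)" False CD'] *(3)
      by (simp add: L_def)
    then have "L CD = L CD'" using * U(3) by (auto simp: U'_def dest: inj_onD)
    then show "CD = CD'" using injL by (simp add: inj_eq)
  qed
  ultimately have "(gquot False ` U', \<phi>) \<in> P_atlas"
    unfolding P_atlas_def using \<phi> by (intro CollectI exI[of _ False] exI[of _ U'] exI[of _ \<phi>]) simp
  moreover have "(mat 1, mat 1) \<in> U'"
    using AB by (simp add: U'_def L_def gmul_def)
  ultimately show ?thesis
    using that[of "(gquot False ` U', \<phi>)" U'] \<open>(U', \<psi> \<circ> L) \<in> _\<close> \<phi> by simp
qed

section \<open>Verticality of \<open>palg\<close> in the principal bundle\<close>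

locale P_geometry =
  fixes A :: "('m, 'e::euclidean_space) chart set" and B :: "('g, 'f::euclidean_space) chart set"
    and p :: "'g \<Rightarrow> 'm" and r :: "'g \<Rightarrow> gelt \<Rightarrow> 'g" and \<omega> :: "'g \<Rightarrow> 'f \<Rightarrow> gvec"
  assumes principal: "principal_P_bundle A B p r" and connection: "cartan_connection B r \<omega>"
begin

lemma smooth_atlas_base: "smooth_atlas A" and smooth_atlas_total: "smooth_atlas B"
  and smooth_proj: "smooth_map B A p"
  using principal by (auto simp: principal_P_bundle_def smooth_manifold_def)

sublocale base: atlas A by (rule atlas.intro[OF smooth_atlas_base])
sublocale total: atlas B by (rule atlas.intro[OF smooth_atlas_total])

lemma proj_in: "u \<in> mcarrier B \<Longrightarrow> p u \<in> mcarrier A"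
  using smooth_map_in_mcarrier[OF smooth_atlas_total smooth_atlas_base smooth_proj] .

lemma smooth_omega: "smooth_one_form B \<omega>"
  using connection by (simp add: cartan_connection_def)

lemma omega_linear: "u \<in> mcarrier B \<Longrightarrow> linear (\<omega> u)"
  using smooth_omega by (simp add: smooth_one_form_def)

lemma omega_bij: "u \<in> mcarrier B \<Longrightarrow> bij_betw (\<omega> u) UNIV galg"
  using connection by (simp add: cartan_connection_def)

lemma omega_in: "u \<in> mcarrier B \<Longrightarrow> \<omega> u v \<in> galg"
  using omega_bij by (meson bij_betwE UNIV_I)

lemma omega_omega_inv: "u \<in> mcarrier B \<Longrightarrow> X \<in> galg \<Longrightarrow> \<omega> u (omega_inv \<omega> X u) = X"
  using omega_bij unfolding omega_inv_def by (metis bij_betw_inv_into_right)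

lemma omega_inv_omega: "u \<in> mcarrier B \<Longrightarrow> omega_inv \<omega> (\<omega> u v) u = v"
  using omega_bij unfolding omega_inv_def by (metis bij_betw_inv_into_left UNIV_I)

abbreviation push :: "'g \<Rightarrow> gvec \<Rightarrow> 'e" where
  "push u X \<equiv> proj_omega_inv A B p \<omega> X u"

lemma tmap_proj_linear:
  assumes "u \<in> mcarrier B"
  shows "linear (tmap B A p u)"
proof -
  note c = total.chart_at_in[OF assms] and d = base.chart_at_in[OF proj_in[OF assms]]
  have "((snd (chart_at A (p u)) \<circ> p \<circ> cinv (chart_at B u)) has_derivative tmap B A p u) (at (snd (chart_at B u) u))"
    unfolding tmap_def
    using smooth_on_has_derivative[OF smooth_map_rep(2)[OF smooth_atlas_total smooth_atlas_base smooth_proj c(1) d(1)]] c d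
    by simp
  then show ?thesis by (rule has_derivative_linear)
qed

lemma push_omega: "u \<in> mcarrier B \<Longrightarrow> push u (\<omega> u v) = tmap B A p u v"
  by (simp add: proj_omega_inv_def omega_inv_omega)

lemma push_add:
  assumes u: "u \<in> mcarrier B" and "X \<in> galg" "Y \<in> galg"
  shows "push u (X + Y) = push u X + push u Y"
proof -
  have "omega_inv \<omega> (X + Y) u = omega_inv \<omega> X u + omega_inv \<omega> Y u"
    using assms omega_inv_omega[OF u] omega_omega_inv[OF u] linear_add[OF omega_linear[OF u]] by metis
  then show ?thesis
    by (simp add: proj_omega_inv_def linear_add[OF tmap_proj_linear[OF u]])
qed

lemma push_scaleR:
  assumes u: "u \<in> mcarrier B" and "X \<in> galg"
  shows "push u (s *\<^sub>R X) = s *\<^sub>R push u X"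
proof -
  have "omega_inv \<omega> (s *\<^sub>R X) u = s *\<^sub>R omega_inv \<omega> X u"
    using assms omega_inv_omega[OF u] omega_omega_inv[OF u] linear_scale[OF omega_linear[OF u]] by metis
  then show ?thesis
    by (simp add: proj_omega_inv_def linear_scale[OF tmap_proj_linear[OF u]])
qed

text \<open>That \<open>P_atlas\<close> has a nonempty chart is read off from a local
  trivialization, which sends \<open>u\<close> into the carrier of a product atlas.\<close>

lemma P_chart_exists:
  assumes u: "u \<in> mcarrier B"
  obtains c where "c \<in> P_atlas" "fst c \<noteq> {}"
proof -
  obtain U \<psi> where U: "p u \<in> U"
    "diffeomorphism (restrict_atlas B (p -` U)) (prod_atlas (restrict_atlas A U) P_atlas) (\<lambda>u. (p u, \<psi> u))"
    using principal proj_in[OF u] unfolding principal_P_bundle_def by blast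
  have "u \<in> mcarrier (restrict_atlas B (p -` U))"
    using u U(1) by (auto simp: mcarrier_def restrict_atlas_def)
  then have "(p u, \<psi> u) \<in> mcarrier (prod_atlas (restrict_atlas A U) P_atlas)"
    using U(2) unfolding diffeomorphism_def bij_betw_def by blast
  then show ?thesis
    using that by (force simp: mcarrier_def prod_atlas_def)
qed

text \<open>The velocity of the orbit curve is formed with the coordinate map at \<open>u\<close>,
  which says nothing about points outside its domain. Continuity of the action on the product atlas
  keeps the curve inside for small parameters.\<close>

lemma fundamental_curve_in_chart:
  assumes u: "u \<in> mcarrier B" and X: "X \<in> ggr k" "k \<in> {0, 1, 2}"
  shows "\<forall>\<^sub>F t in at 0. r u (gexp (t *\<^sub>R X)) \<in> fst (chart_at B u)"
proof -
  note b = total.chart_at_in[OF u]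
  obtain c0 where "c0 \<in> P_atlas" "fst c0 \<noteq> {}" by (rule P_chart_exists[OF u])
  then obtain c U where c: "c \<in> P_atlas" "fst c = gquot False ` U"
    "(U, snd c \<circ> gquot False) \<in> submanifold_charts (Plift False)" "(mat 1, mat 1) \<in> U"
    by (rule P_atlas_chart_one)
  have one: "\<one>\<^bsub>Ggrp\<^esub> \<in> fst c" using c by (simp add: Ggrp_one)
  let ?AP = "prod_atlas B P_atlas"
  let ?e = "(fst (chart_at B u) \<times> fst c, map_prod (snd (chart_at B u)) (snd c))"
  have e: "?e \<in> ?AP"
    unfolding prod_atlas_def by (rule image_eqI[of _ _ "(chart_at B u, c)"]) (use b c in auto)
  have inj: "inj_on (snd d) (fst d)" and op: "open (snd d ` fst d)" if dAP: "d \<in> ?AP" for d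
  proof -
    obtain b' c' where d: "b' \<in> B" "c' \<in> P_atlas" "fst d = fst b' \<times> fst c'" "snd d = map_prod (snd b') (snd c')"
      using dAP unfolding prod_atlas_def by fastforce
    show "inj_on (snd d) (fst d)"
      unfolding d by (rule map_prod_inj_on[OF total.inj_on_chart[OF d(1)] P_atlas_inj_open(1)[OF d(2)]])
    have "snd d ` fst d = snd b' ` fst b' \<times> snd c' ` fst c'"
      unfolding d by (rule map_prod_surj_on) auto
    then show "open (snd d ` fst d)"
      using total.open_chart_image[OF d(1)] P_atlas_inj_open(2)[OF d(2)] by (simp add: open_Times)
  qed
  have tsp: "topspace (mtopology ?AP) = mcarrier ?AP"
    by (rule topspace_mtopology) (erule inj op)+
  let ?V = "{q \<in> mcarrier ?AP. (case q of (u, a) \<Rightarrow> r u a) \<in> fst (chart_at B u)}"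
  have "continuous_map (mtopology ?AP) (mtopology B) (\<lambda>(u, a). r u a)"
    using principal unfolding principal_P_bundle_def smooth_map_def by blast
  from openin_continuous_map_preimage[OF this total.openin_chart[OF b(1)]]
  have V: "openin (mtopology ?AP) ?V"
    unfolding tsp .
  have "r u \<one>\<^bsub>Ggrp\<^esub> = u" using principal u unfolding principal_P_bundle_def by blast
  moreover have "(u, \<one>\<^bsub>Ggrp\<^esub>) \<in> mcarrier ?AP" unfolding mcarrier_def using b one by (intro UN_I[OF e]) simp
  ultimately have uV: "(u, \<one>\<^bsub>Ggrp\<^esub>) \<in> ?V" using b by simp
  define m where "m t = (mexp (t *\<^sub>R fst X), mexp (t *\<^sub>R snd X))" for t
  have m: "m t \<in> Plift False" "(m \<longlongrightarrow> (mat 1, mat 1)) (at 0)" "gexp (t *\<^sub>R X) = gquot False (m t)" for t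
    using gexp_curve[OF X] unfolding m_def by blast+
  note ct = P_chart_tendsto[OF c(1) one m(1) m(2) c(2,3,4)]
  have "\<forall>\<^sub>F t in at 0. (u, gquot False (m t)) \<in> ?V"
  proof (rule eventually_in_openin_mtopology[OF inj e V uV])
    show "(u, \<one>\<^bsub>Ggrp\<^esub>) \<in> fst ?e" using b one by simp
    show "\<forall>\<^sub>F t in at 0. (u, gquot False (m t)) \<in> fst ?e"
      using ct(1) by eventually_elim (use b in simp)
    show "((\<lambda>t. snd ?e (u, gquot False (m t))) \<longlongrightarrow> snd ?e (u, \<one>\<^bsub>Ggrp\<^esub>)) (at 0)"
      using ct(2) by (auto intro!: tendsto_Pair)
  qed
  then show ?thesis
    by eventually_elim (simp add: m(3))
qed

text \<open>The projection is constant along the orbit, so its coordinate expression along the curve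
  is constant near 0, and the chain rule makes \<open>tmap\<close> vanish on the velocity.\<close>

lemma tmap_fundamental_velocity:
  assumes u: "u \<in> mcarrier B" and X: "X \<in> ggr k" "k \<in> {0, 1, 2}"
    and v: "((\<lambda>t. snd (chart_at B u) (r u (gexp (t *\<^sub>R X)))) has_vector_derivative v) (at 0)"
  shows "tmap B A p u v = 0"
proof -
  define c d where "c = chart_at B u" and "d = chart_at A (p u)"
  have c: "c \<in> B" "u \<in> fst c" and d: "d \<in> A" "p u \<in> fst d"
    unfolding c_def d_def using total.chart_at_in[OF u] base.chart_at_in[OF proj_in[OF u]] by auto
  define \<gamma> where "\<gamma> t = r u (gexp (t *\<^sub>R X))" for t
  have \<gamma>0: "\<gamma> 0 = u"
    using principal u gexp_curve(4)[OF X] unfolding \<gamma>_def principal_P_bundle_def by simp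
  have "gexp (t *\<^sub>R X) \<in> Pset" for t
    using gexp_curve(1,2)[OF X, of t] by simp
  then have p\<gamma>: "p (\<gamma> t) = p u" for t
    using principal u unfolding \<gamma>_def principal_P_bundle_def by blast
  let ?Q = "snd d \<circ> p \<circ> cinv c"
  have "(?Q has_derivative tmap B A p u) (at (snd c u))"
    unfolding tmap_def c_def[symmetric] d_def[symmetric]
    using smooth_on_has_derivative[OF smooth_map_rep(2)[OF smooth_atlas_total smooth_atlas_base smooth_proj c(1) d(1)]] c d
    by simp
  then have Q: "(?Q has_derivative tmap B A p u) (at (snd c (\<gamma> 0)))" by (simp add: \<gamma>0)
  have "((\<lambda>t. snd c (\<gamma> t)) has_derivative (\<lambda>s. s *\<^sub>R v)) (at 0)"
    using v unfolding has_vector_derivative_def \<gamma>_def c_def .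
  from has_derivative_compose[OF this Q]
  have "((\<lambda>t. ?Q (snd c (\<gamma> t))) has_derivative (\<lambda>s. tmap B A p u (s *\<^sub>R v))) (at 0)" .
  moreover have "\<forall>\<^sub>F t in at 0. ?Q (snd c (\<gamma> t)) = snd d (p u)"
    using fundamental_curve_in_chart[OF u X] unfolding \<gamma>_def[symmetric] c_def[symmetric]
    by eventually_elim (simp add: c p\<gamma>)
  ultimately have "((\<lambda>t. snd d (p u)) has_derivative (\<lambda>s. tmap B A p u (s *\<^sub>R v))) (at 0)"
    by (rule has_derivative_transform_eventually) (simp_all add: \<gamma>0 c)
  then have "(\<lambda>s. tmap B A p u (s *\<^sub>R v)) = (\<lambda>s. 0)"
    by (rule has_derivative_unique) (rule has_derivative_const)
  from fun_cong[OF this, of 1] show ?thesis by simp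
qed

text \<open>
  No differentiability of the exponential curves is needed: if the curve of \<open>X\<close> were not
  differentiable, \<open>vector_derivative\<close> would return a junk value that does not depend on the curve.
  As \<open>\<omega>\<close> maps the velocity to \<open>X\<close>, this cannot happen for both \<open>X\<close> and \<open>2 X\<close>
  unless \<open>X = 0\<close>.
\<close>

lemma push_vertical:
  assumes u: "u \<in> mcarrier B" and X: "X \<in> palg"
  shows "push u X = 0"
proof -
  have "push u X = 0" if X: "X \<in> ggr k" "k \<in> {0, 1, 2}" for X k
  proof -
    define z where "z Y t = snd (chart_at B u) (r u (gexp (t *\<^sub>R Y)))" for Y t
    have vel: "\<omega> u (vector_derivative (z Y) (at 0)) = Y" if Y: "Y \<in> ggr k" for Y
    proof -
      have "Y \<in> palg" using Y \<open>k \<in> {0, 1, 2}\<close> ggr_subset_gfilt[of 0 k] by auto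
      \<comment> \<open>The curve starts at \<open>u\<close>, so \<open>curve_velocity\<close> uses
        the same chart as \<open>z\<close>.\<close>
      moreover have "r u (gexp (0 *\<^sub>R Y)) = u"
        using principal u gexp_curve(4)[OF Y \<open>k \<in> {0, 1, 2}\<close>] unfolding principal_P_bundle_def by simp
      ultimately show ?thesis
        using connection u unfolding cartan_connection_def curve_velocity_def z_def by metis
    qed
    have good: "push u Y = 0" if Y: "Y \<in> ggr k" and ex: "\<exists>v. (z Y has_vector_derivative v) (at 0)" for Y
    proof -
      have "(z Y has_vector_derivative vector_derivative (z Y) (at 0)) (at 0)"
        using ex vector_derivative_at by metis
      then have "tmap B A p u (vector_derivative (z Y) (at 0)) = 0"
        using tmap_fundamental_velocity[OF u Y \<open>k \<in> {0, 1, 2}\<close>] unfolding z_def by blast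
      then show ?thesis
        using push_omega[OF u] vel[OF Y] by metis
    qed
    have bad: "Y = \<omega> u (SOME v. False)" if Y: "Y \<in> ggr k" and ex: "\<nexists>v. (z Y has_vector_derivative v) (at 0)" for Y
      using vel[OF Y] ex by (simp add: vector_derivative_def)
    have X2: "2 *\<^sub>R X \<in> ggr k" using X by (intro subspace_scale[OF subspace_ggr])
    have Xg: "X \<in> galg" using X ggr_subset_galg by blast
    consider "\<exists>v. (z X has_vector_derivative v) (at 0)" | "\<exists>v. (z (2 *\<^sub>R X) has_vector_derivative v) (at 0)"
      | "X = 2 *\<^sub>R X"
      using bad[OF X(1)] bad[OF X2] by metis
    then show ?thesis
    proof cases
      case 1
      then show ?thesis using good X(1) by blast
    next
      case 2
      then have "2 *\<^sub>R push u X = 0" using good[OF X2] push_scaleR[OF u Xg, of 2] by metis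
      then show ?thesis by simp
    next
      case 3
      then have "X = 0" by (simp add: scaleR_2)
      then show ?thesis using push_scaleR[OF u Xg, of 0] by simp
    qed
  qed
  then have "ggr 0 \<union> ggr 1 \<union> ggr 2 \<subseteq> {X \<in> galg. push u X = 0}"
    using ggr_subset_galg by blast
  moreover have "subspace {X \<in> galg. push u X = 0}"
    using subspace_galg push_add[OF u] push_scaleR[OF u] push_scaleR[OF u, of 0 0]
    by (auto simp: subspace_def)
  ultimately show ?thesis
    using X unfolding palg_span using span_minimal by blast
qed

end

section \<open>Cartan geometries in local coordinates\<close>

lemma frechet_derivative_cong_open:
  assumes "f differentiable (at x)" "open N" "x \<in> N" "\<And>y. y \<in> N \<Longrightarrow> f y = g y"
  shows "frechet_derivative g (at x) = frechet_derivative f (at x)" "g differentiable (at x)"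
proof -
  have "(f has_derivative frechet_derivative f (at x)) (at x)"
    using assms(1) frechet_derivative_works by blast
  from has_derivative_transform_within_open[OF this assms(2,3,4)]
  have g: "(g has_derivative frechet_derivative f (at x)) (at x)" by simp
  show "frechet_derivative g (at x) = frechet_derivative f (at x)"
    using frechet_derivative_at[OF g] by simp
  show "g differentiable (at x)" using g differentiable_def by blast
qed

lemma frechet_derivative_linear_comp:
  fixes f :: "'a::real_normed_vector \<Rightarrow> 'b::euclidean_space"
  assumes "f differentiable (at x)" "linear L"
  shows "frechet_derivative (\<lambda>y. L (f y)) (at x) v = L (frechet_derivative f (at x) v)"
    "(\<lambda>y. L (f y)) differentiable (at x)"
proof -
  have "(f has_derivative frechet_derivative f (at x)) (at x)"
    using assms(1) frechet_derivative_works by blast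
  from bounded_linear.has_derivative[OF _ this, of L]
  have *: "((\<lambda>y. L (f y)) has_derivative (\<lambda>v. L (frechet_derivative f (at x) v))) (at x)"
    using assms(2) by (simp add: linear_conv_bounded_linear)
  show "frechet_derivative (\<lambda>y. L (f y)) (at x) v = L (frechet_derivative f (at x) v)"
    using frechet_derivative_at[OF *] by metis
  show "(\<lambda>y. L (f y)) differentiable (at x)"
    using * differentiable_def by blast
qed

text \<open>Unlike \<open>gproj (-1)\<close>, this real-linear projection has values in
  \<open>ggr (-1)\<close> on all pairs of matrices, not only on \<open>galg\<close>. It shows that
  the derivative of a \<open>ggr (-1)\<close>-valued function is again in
  \<open>ggr (-1)\<close>.\<close>

definition gminus1_proj :: "gvec \<Rightarrow> gvec" where
  "gminus1_proj X = (let \<pi> = (\<lambda>Y::cmat3. \<chi> i j. if i = 2 \<and> j = 1 then Y$2$1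
      else if i = 3 \<and> j = 2 then - cnj (Y$2$1) else 0) in (\<pi> (fst X), \<pi> (snd X)))"

lemma gminus1_proj_linear: "linear gminus1_proj"
  by (rule linearI) (auto simp: gminus1_proj_def Let_def vec_eq_iff)

lemma gminus1_proj_in: "gminus1_proj X \<in> ggr (-1)"
  by (simp add: gminus1_proj_def Let_def ggr_def su21_grade_minus1)

lemma gminus1_proj_id: "X \<in> ggr (-1) \<Longrightarrow> gminus1_proj X = X"
  by (auto simp: gminus1_proj_def Let_def ggr_def su21_grade_minus1 prod_eq_iff cmat3_eq_iff)

section \<open>The connection and its curvature in coordinates at one point\<close>

locale P_geometry_at = P_geometry A B p r \<omega>
  for A :: "('m, 'e::euclidean_space) chart set" and B :: "('g, 'f::euclidean_space) chart set"
    and p :: "'g \<Rightarrow> 'm" and r :: "'g \<Rightarrow> gelt \<Rightarrow> 'g" and \<omega> :: "'g \<Rightarrow> 'f \<Rightarrow> gvec" +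
  fixes u0 :: 'g
  assumes u0: "u0 \<in> mcarrier B"
begin

text \<open>These are the charts in which tangent vectors at \<open>u0\<close> and at
  \<open>p u0\<close> are represented. At \<open>y0\<close> the coefficient form \<open>Om\<close>
  is therefore \<open>\<omega> u0\<close> itself, and the derivative of \<open>P\<close> is
  \<open>tmap\<close>.\<close>

definition "c = chart_at B u0"
definition "d = chart_at A (p u0)"
definition "y0 = snd c u0"
definition "Om y v = \<omega> (cinv c y) (tvec B c (cinv c y) v)"
definition "N = snd c ` (fst c \<inter> p -` fst d)"
definition "P = snd d \<circ> p \<circ> cinv c"

abbreviation "DP y \<equiv> frechet_derivative P (at y)"

lemma c_in: "c \<in> B" "u0 \<in> fst c" and d_in: "d \<in> A" "p u0 \<in> fst d"
  unfolding c_def d_def using total.chart_at_in[OF u0] base.chart_at_in[OF proj_in[OF u0]] by auto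

lemma cinv_y0: "cinv c y0 = u0"
  unfolding y0_def using c_in by simp

lemma open_N: "open N" and y0_in: "y0 \<in> N" and smooth_P: "smooth_on N P"
  unfolding N_def P_def y0_def
  using smooth_map_rep[OF smooth_atlas_total smooth_atlas_base smooth_proj c_in(1) d_in(1)] c_in d_in
  by auto

lemma N_cases:
  assumes "y \<in> N"
  obtains u where "u \<in> fst c" "u \<in> mcarrier B" "p u \<in> fst d" "y = snd c u" "cinv c y = u" "P y = snd d (p u)"
  using assms c_in total.in_mcarrier[OF c_in(1)] unfolding N_def P_def by auto

lemma N_chart: "y \<in> N \<Longrightarrow> y \<in> snd c ` fst c"
  unfolding N_def by blast

lemma Om_linear: "y \<in> N \<Longrightarrow> linear (Om y)"
  using total.one_form_rep_linear[OF smooth_omega c_in(1) N_chart] unfolding Om_def .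

lemma Om_differentiable: "(\<lambda>y. Om y v) differentiable (at y0)"
  using smooth_on_differentiable[OF total.smooth_one_form_rep[OF smooth_omega c_in(1)] N_chart[OF y0_in]]
  unfolding Om_def .

lemma Om_y0: "Om y0 v = \<omega> u0 v"
  using total.transition_refl[OF c_in] unfolding Om_def cinv_y0 tvec_def c_def[symmetric] by simp

lemma Om_tcoord: "u \<in> fst c \<Longrightarrow> Om (snd c u) (tcoord B c u v) = \<omega> u v"
  unfolding Om_def using c_in(1) by simp

lemma omega_inj: "inj (\<omega> u0)"
  using omega_bij[OF u0] bij_betw_def by blast

lemma DP_tcoord:
  assumes "u \<in> fst c" "p u \<in> fst d"
  shows "DP (snd c u) (tcoord B c u v) = tcoord A d (p u) (tmap B A p u v)"
  unfolding P_def using tcoord_tmap[OF smooth_atlas_total smooth_atlas_base smooth_proj c_in(1) assms(1) d_in(1) assms(2)]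
  by simp

lemma DP_y0: "DP y0 v = tmap B A p u0 v"
  unfolding P_def y0_def tmap_def c_def d_def ..

lemma DP_push: "DP y0 v = push u0 (\<omega> u0 v)"
  by (simp add: DP_y0 push_omega[OF u0])

definition "rep X = vf_rep B c (omega_inv \<omega> X)"

lemma Om_rep: "X \<in> galg \<Longrightarrow> y \<in> N \<Longrightarrow> Om y (rep X y) = X"
  by (erule N_cases) (simp add: rep_def vf_rep_def Om_tcoord omega_omega_inv)

text \<open>A Cartan connection is given as a smooth form; that the fields with constant \<omega>
  are differentiable follows because they solve the linear system
  \<open>Om y (rep X y) = X\<close>.\<close>

lemma rep_differentiable:
  assumes "X \<in> galg"
  shows "rep X differentiable (at y0)"
proof (rule linear_family_solution_differentiable[OF open_N y0_in Om_linear Om_differentiable])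
  show "(\<lambda>y. X) differentiable (at y0)" by simp
  show "inj (Om y0)" using omega_inj by (simp add: Om_y0 inj_def)
qed (use Om_rep[OF assms] in auto)

lemma rep_y0: "rep X y0 = omega_inv \<omega> X u0"
  unfolding rep_def vf_rep_def cinv_y0 using total.tcoord_chart_at[OF u0] by (simp add: c_def)

text \<open>The exterior derivative of \<omega> at \<open>u0\<close>, in the chart
  \<open>c\<close>.\<close>

definition "dOm v w = frechet_derivative (\<lambda>y. Om y w) (at y0) v - frechet_derivative (\<lambda>y. Om y v) (at y0) w"

lemma Om_bracket:
  assumes "\<xi> differentiable (at y0)" "\<eta> differentiable (at y0)"
  shows "\<omega> u0 (frechet_derivative \<eta> (at y0) (\<xi> y0) - frechet_derivative \<xi> (at y0) (\<eta> y0)) =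
    frechet_derivative (\<lambda>y. Om y (\<eta> y)) (at y0) (\<xi> y0) - frechet_derivative (\<lambda>y. Om y (\<xi> y)) (at y0) (\<eta> y0)
    - dOm (\<xi> y0) (\<eta> y0)"
  using one_form_bracket[OF open_N y0_in Om_linear Om_differentiable assms] by (simp add: Om_y0 dOm_def)

lemma lie_bracket_rep: "lie_bracket B (omega_inv \<omega> X) (omega_inv \<omega> Y) u0 =
    frechet_derivative (rep Y) (at y0) (rep X y0) - frechet_derivative (rep X) (at y0) (rep Y y0)"
  unfolding lie_bracket_def Let_def rep_y0 by (simp add: rep_def c_def y0_def)

text \<open>The structure equation: on fields with constant \<omega> the derivative terms of
  \<open>Om_bracket\<close> vanish. The curvature is thus determined by vectors at
  \<open>u0\<close>, and can be used in \<open>lifted_bracket\<close> for fields on which \<omega>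
  is not constant.\<close>

lemma curvature_dOm:
  assumes "X \<in> galg" "Y \<in> galg"
  shows "curvature B \<omega> u0 X Y = gbr X Y + dOm (omega_inv \<omega> X u0) (omega_inv \<omega> Y u0)"
proof -
  have const: "frechet_derivative (\<lambda>y. Om y (rep Z y)) (at y0) v = 0" if "Z \<in> galg" for Z v
    using frechet_derivative_cong_open(1)[of "\<lambda>y. Z" y0 N "\<lambda>y. Om y (rep Z y)"] open_N y0_in Om_rep[OF that]
    by (simp add: frechet_derivative_const)
  show ?thesis
    unfolding curvature_def lie_bracket_rep
    using Om_bracket[OF rep_differentiable rep_differentiable, OF assms] const assms
    by (simp add: rep_y0)
qed

lemma lifted_bracket:
  assumes "\<xi> differentiable (at y0)" "\<eta> differentiable (at y0)"
    and "\<omega> u0 (\<xi> y0) = X" "\<omega> u0 (\<eta> y0) = Y"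
  shows "\<omega> u0 (frechet_derivative \<eta> (at y0) (\<xi> y0) - frechet_derivative \<xi> (at y0) (\<eta> y0)) =
    frechet_derivative (\<lambda>y. Om y (\<eta> y)) (at y0) (\<xi> y0) - frechet_derivative (\<lambda>y. Om y (\<xi> y)) (at y0) (\<eta> y0)
    + gbr X Y - curvature B \<omega> u0 X Y"
proof -
  have "X \<in> galg" "Y \<in> galg" "omega_inv \<omega> X u0 = \<xi> y0" "omega_inv \<omega> Y u0 = \<eta> y0"
    using assms omega_in[OF u0] omega_inv_omega[OF u0] by blast+
  then show ?thesis
    using Om_bracket[OF assms(1,2)] curvature_dOm[of X Y] by simp
qed

text \<open>\<open>curvature_comp\<close> sums over all pairs of degrees; for arguments in
  \<open>ggr (-1)\<close> the other three summands contain a zero argument.\<close>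

lemma curvature_zero:
  assumes "X \<in> galg"
  shows "curvature B \<omega> u0 0 X = 0" "curvature B \<omega> u0 X 0 = 0"
proof -
  have 0: "omega_inv \<omega> 0 u0 = 0"
    using omega_inv_omega[OF u0, of 0] linear_0[OF omega_linear[OF u0]] by simp
  have D0: "frechet_derivative (\<lambda>y. Om y 0) (at y0) v = 0" for v
    using linear_0[OF linear_family_frechet_linear[OF open_N y0_in Om_linear Om_differentiable]] .
  have "frechet_derivative (\<lambda>y. Om y w) (at y0) 0 = 0" for w
    using linear_frechet_derivative[OF Om_differentiable] linear_0 by blast
  then have "dOm 0 w = 0" "dOm w 0 = 0" for w
    by (simp_all add: dOm_def D0)
  moreover have "gbr 0 X = 0" "gbr X 0 = 0"
    by (simp_all add: gbr_def prod_eq_iff cmat3_eq_iff cmat3_mult)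
  ultimately show "curvature B \<omega> u0 0 X = 0" "curvature B \<omega> u0 X 0 = 0"
    using curvature_dOm[of 0 X] curvature_dOm[of X 0] assms subspace_0[OF subspace_galg] by (simp_all add: 0)
qed

lemma curvature_in_galg: "X \<in> galg \<Longrightarrow> Y \<in> galg \<Longrightarrow> curvature B \<omega> u0 X Y \<in> galg"
  unfolding curvature_def using omega_in[OF u0] gbr_in_galg subspace_diff[OF subspace_galg] by blast

lemma curvature_comp_ggr_minus1:
  assumes "X \<in> ggr (-1)" "Y \<in> ggr (-1)"
  shows "curvature_comp k B \<omega> u0 X Y = gproj (k - 2) (curvature B \<omega> u0 X Y)"
proof -
  have "X \<in> galg" "Y \<in> galg" "(0::gvec) \<in> galg"
    using assms ggr_subset_galg subspace_0[OF subspace_galg] by blast+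
  then show ?thesis
    using assms curvature_zero linear_0[OF gproj_linear]
    by (simp add: curvature_comp_def gproj_ggr add.commute)
qed

end

section \<open>Frames induced by points of the bundle\<close>

text \<open>The common ground of the two claims. The assumption \<open>frames\<close> is a clause of
  \<open>regular_gP_structure\<close> in the abstract setting and part of the definition of
  \<open>emb_frames\<close> in the embedded one.\<close>

locale framed_geometry = P_geometry A B p r \<omega>
  for A :: "('m, 'e::euclidean_space) chart set" and B :: "('g, 'f::euclidean_space) chart set"
    and p :: "'g \<Rightarrow> 'm" and r :: "'g \<Rightarrow> gelt \<Rightarrow> 'g" and \<omega> :: "'g \<Rightarrow> 'f \<Rightarrow> gvec" +
  fixes E :: "'m \<Rightarrow> 'e set" and Fr :: "'m \<Rightarrow> 'e gframe set"
  assumes regular: "regular_connection B \<omega>" and induces: "induces_structure A E Fr B p \<omega>"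
    and frames: "\<And>x. x \<in> mcarrier A \<Longrightarrow> Fr x \<subseteq> gr_isos (E x)"
begin

definition frame :: "'g \<Rightarrow> 'e gframe" where
  "frame u = (restrict (\<lambda>X. (+) (push u X) ` E (p u)) (ggr (-2)), restrict (push u) (ggr (-1)))"

lemma Fr_eq: "x \<in> mcarrier A \<Longrightarrow> Fr x = {frame u |u. u \<in> mcarrier B \<and> p u = x}"
  using induces unfolding induces_structure_def frame_def by auto

lemma push_bij: "u \<in> mcarrier B \<Longrightarrow> bij_betw (push u) (ggr (-1)) (E (p u))"
proof -
  assume u: "u \<in> mcarrier B"
  have "frame u \<in> gr_isos (E (p u))"
    using Fr_eq[OF proj_in[OF u]] frames[OF proj_in[OF u]] u by blast
  then have "bij_betw (restrict (push u) (ggr (-1))) (ggr (-1)) (E (p u))"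
    unfolding frame_def gr_isos_def by simp
  then show ?thesis by (simp cong: bij_betw_cong)
qed

lemma push_inj: "u \<in> mcarrier B \<Longrightarrow> X \<in> ggr (-1) \<Longrightarrow> Y \<in> ggr (-1) \<Longrightarrow> push u X = push u Y \<Longrightarrow> X = Y"
  using push_bij by (meson bij_betw_imp_inj_on inj_onD)

lemma push_in: "u \<in> mcarrier B \<Longrightarrow> X \<in> ggr (-1) \<Longrightarrow> push u X \<in> E (p u)"
  using push_bij bij_betwE by blast

lemma push_surj:
  assumes "u \<in> mcarrier B" "v \<in> E (p u)"
  obtains X where "X \<in> ggr (-1)" "push u X = v"
proof -
  have "v \<in> push u ` ggr (-1)"
    using bij_betw_imp_surj_on[OF push_bij[OF assms(1)]] assms(2) by simp
  then show ?thesis using that by (metis imageE)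
qed

lemma push_gproj:
  assumes u: "u \<in> mcarrier B" and Z: "Z \<in> galg" "gproj (-2) Z = 0"
  shows "push u Z = push u (gproj (-1) Z)"
proof -
  obtain V where V: "V \<in> palg" "Z = gproj (-1) Z + V" by (rule gfilt_minus1_decomp[OF Z])
  have "V \<in> galg" using V(1) by (simp add: gfilt_iff)
  moreover have "gproj (-1) Z \<in> galg" using gproj_in_ggr[OF Z(1)] ggr_subset_galg by blast
  ultimately have "push u (gproj (-1) Z + V) = push u (gproj (-1) Z) + push u V"
    by (intro push_add[OF u])
  then show ?thesis using V push_vertical[OF u V(1)] by simp
qed

end

locale framed_geometry_at = framed_geometry A B p r \<omega> E Fr + P_geometry_at A B p r \<omega> u0
  for A :: "('m, 'e::euclidean_space) chart set" and B :: "('g, 'f::euclidean_space) chart set"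
    and p :: "'g \<Rightarrow> 'm" and r :: "'g \<Rightarrow> gelt \<Rightarrow> 'g" and \<omega> :: "'g \<Rightarrow> 'f \<Rightarrow> gvec"
    and E :: "'m \<Rightarrow> 'e set" and Fr :: "'m \<Rightarrow> 'e gframe set" and u0 :: 'g
begin

lemma gproj_curvature:
  assumes "X \<in> ggr (-1)" "Y \<in> ggr (-1)"
  shows "gproj (-2) (curvature B \<omega> u0 X Y) = 0"
proof -
  have "X \<in> gminus" "Y \<in> gminus" using assms ggr_subset_gminus by blast+
  then have "curvature_comp 0 B \<omega> u0 X Y = 0"
    using regular u0 unfolding regular_connection_def by blast
  then show ?thesis using curvature_comp_ggr_minus1[OF assms, of 0] by simp
qed

lemma curvature_aa_eq:
  assumes X: "X \<in> ggr (-1)" and Y: "Y \<in> ggr (-1)"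
    and K: "\<And>X Y. K X Y = gproj (-1) (curvature B \<omega> u0 X Y)"
  shows "curvature_aa B \<omega> u0 X Y =
    (1/4) *\<^sub>R (K X Y - K (cxm X) (cxm Y) + cxm (K (cxm X) Y) + cxm (K X (cxm Y)))"
  using curvature_comp_ggr_minus1[OF _ _, of _ _ 1] X Y cxm_in_ggr
  by (simp add: curvature_aa_def Let_def K)

lemma gproj_curvature_in:
  assumes "X \<in> ggr (-1)" "Y \<in> ggr (-1)"
  shows "gproj (-1) (curvature B \<omega> u0 X Y) \<in> ggr (-1)"
  using curvature_in_galg gproj_in_ggr assms ggr_subset_galg by blast

text \<open>By \<open>cxm_cxm\<close> the terms \<open>s\<close> and \<open>t\<close> drop out of
  the difference of the two sides, which is minus \<open>cxm\<close> of \<kappa>, and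
  \<open>cxm\<close> is injective on \<open>ggr (-1)\<close>. The parameters allow both uses:
  derivative terms for lifts of sections, zero for fields with constant \<omega>.\<close>

lemma curvature_aa_zero_iff:
  assumes X: "X \<in> ggr (-1)" and Y: "Y \<in> ggr (-1)" and s: "s \<in> ggr (-1)" and t: "t \<in> ggr (-1)"
    and K: "\<And>X Y. K X Y = gproj (-1) (curvature B \<omega> u0 X Y)"
  shows "cxm (s - cxm t - K X Y + K (cxm X) (cxm Y)) = cxm s + t - K X (cxm Y) - K (cxm X) Y \<longleftrightarrow>
    curvature_aa B \<omega> u0 X Y = 0"
proof -
  note in1 = cxm_in_ggr[OF X] cxm_in_ggr[OF Y] X Y
  note Kin = gproj_curvature_in[of X Y] gproj_curvature_in[of "cxm X" Y]
    gproj_curvature_in[of X "cxm Y"] gproj_curvature_in[of "cxm X" "cxm Y"]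
  define \<kappa> where "\<kappa> = K X Y - K (cxm X) (cxm Y) + cxm (K (cxm X) Y) + cxm (K X (cxm Y))"
  have kin: "\<kappa> \<in> ggr (-1)"
    unfolding \<kappa>_def K using Kin in1 cxm_in_ggr
    by (intro subspace_add[OF subspace_ggr] subspace_diff[OF subspace_ggr]) auto
  have k: "cxm \<kappa> = cxm (K X Y) - cxm (K (cxm X) (cxm Y)) - K (cxm X) Y - K X (cxm Y)"
    unfolding \<kappa>_def using Kin in1 by (simp add: linear_add[OF cxm_linear] linear_diff[OF cxm_linear] cxm_cxm K)
  have "cxm (s - cxm t - K X Y + K (cxm X) (cxm Y)) - (cxm s + t - K X (cxm Y) - K (cxm X) Y) = - cxm \<kappa>"
    unfolding k using t by (simp add: linear_add[OF cxm_linear] linear_diff[OF cxm_linear] cxm_cxm)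
  then have "cxm (s - cxm t - K X Y + K (cxm X) (cxm Y)) = cxm s + t - K X (cxm Y) - K (cxm X) Y \<longleftrightarrow> cxm \<kappa> = 0"
    by (metis eq_iff_diff_eq_0 neg_equal_0_iff_equal)
  also have "cxm \<kappa> = 0 \<longleftrightarrow> \<kappa> = 0"
    using cxm_cxm[OF kin] linear_0[OF cxm_linear] by (metis neg_equal_0_iff_equal)
  finally show ?thesis
    unfolding curvature_aa_eq[OF X Y K] \<kappa>_def[symmetric] by simp
qed

end

lemma differentiable_Pair:
  assumes "f differentiable (at x)" "g differentiable (at x)"
  shows "(\<lambda>x. (f x, g x)) differentiable (at x)"
proof -
  obtain f' g' where "(f has_derivative f') (at x)" "(g has_derivative g') (at x)"
    using assms unfolding differentiable_def by blast
  from has_derivative_Pair[OF this] show ?thesis unfolding differentiable_def by blast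
qed

section \<open>Lifts of sections and their brackets\<close>

context framed_geometry_at
begin

text \<open>The values are prescribed on a neighbourhood because their derivatives are needed, but
  differentiability of the lift is asked for at \<open>y0\<close> only, which is all that a bracket
  at \<open>y0\<close> requires.\<close>

definition is_lift :: "('m \<Rightarrow> 'e) \<Rightarrow> 'f set \<Rightarrow> ('f \<Rightarrow> 'f) \<Rightarrow> bool" where
  "is_lift \<xi> V \<xi>' \<longleftrightarrow> open V \<and> y0 \<in> V \<and> V \<subseteq> N \<and> \<xi>' differentiable (at y0) \<and>
    (\<forall>y\<in>V. Om y (\<xi>' y) \<in> ggr (-1) \<and> push (cinv c y) (Om y (\<xi>' y)) = \<xi> (p (cinv c y)) \<and>
      DP y (\<xi>' y) = vf_rep A d \<xi> (P y))"

lemma vf_rep_differentiable: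
  assumes "smooth_vf A U \<xi>" "p u0 \<in> U"
  shows "vf_rep A d \<xi> differentiable (at (P y0))"
proof -
  have "P y0 \<in> snd d ` (fst d \<inter> U)"
    using assms(2) d_in by (simp add: P_def cinv_y0)
  moreover have "smooth_on (snd d ` (fst d \<inter> U)) (vf_rep A d \<xi>)"
    using assms(1) d_in unfolding smooth_vf_def by blast
  ultimately show ?thesis using smooth_on_differentiable by blast
qed

text \<open>
  The lift of \<open>\<xi>\<close> with values in \<open>\<omega>\<^sup>-\<^sup>1(ggr (-1))\<close> is the solution of a linear system
  with differentiable coefficients.
\<close>

lemma lift_exists:
  assumes U: "openin (mtopology A) U" "p u0 \<in> U" and \<xi>: "smooth_vf A U \<xi>" "\<And>x. x \<in> U \<Longrightarrow> \<xi> x \<in> E x"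
  obtains V \<xi>' where "is_lift \<xi> V \<xi>'" "\<And>y. y \<in> V \<Longrightarrow> p (cinv c y) \<in> U"
proof -
  define V where "V = snd c ` ({u \<in> mcarrier B. p u \<in> U} \<inter> fst c) \<inter> N"
  have "openin (mtopology B) {u \<in> topspace (mtopology B). p u \<in> U}"
    using smooth_proj U(1) unfolding smooth_map_def continuous_map_def by blast
  then have "open (snd c ` ({u \<in> mcarrier B. p u \<in> U} \<inter> fst c))"
    using total.openin_iff total.topspace_eq c_in by auto
  then have oV: "open V" unfolding V_def using open_N by blast
  have yV: "y0 \<in> V" unfolding V_def using y0_in U(2) c_in u0 by (auto simp: y0_def)
  have VU: "p (cinv c y) \<in> U" if "y \<in> V" for y
    using that c_in by (auto simp: V_def)
  define \<xi>' where "\<xi>' y = (let u = cinv c y in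
    tcoord B c u (omega_inv \<omega> (inv_into (ggr (-1)) (push u) (\<xi> (p u))) u))" for y
  have props: "Om y (\<xi>' y) \<in> ggr (-1)" "push (cinv c y) (Om y (\<xi>' y)) = \<xi> (p (cinv c y))"
    "DP y (\<xi>' y) = vf_rep A d \<xi> (P y)" if y: "y \<in> V" for y
  proof -
    have "y \<in> N" using y by (simp add: V_def)
    then obtain u where u: "u \<in> fst c" "u \<in> mcarrier B" "p u \<in> fst d" "y = snd c u" "cinv c y = u" "P y = snd d (p u)"
      by (rule N_cases)
    define Z where "Z = inv_into (ggr (-1)) (push u) (\<xi> (p u))"
    have "\<xi> (p u) \<in> push u ` ggr (-1)"
      using \<xi>(2)[of "p u"] VU[OF y] u bij_betw_imp_surj_on[OF push_bij[OF u(2)]] by simp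
    then have Z: "Z \<in> ggr (-1)" "push u Z = \<xi> (p u)"
      unfolding Z_def by (rule inv_into_into, rule f_inv_into_f)
    have \<xi>y: "\<xi>' y = tcoord B c u (omega_inv \<omega> Z u)" unfolding \<xi>'_def Let_def u(5) Z_def ..
    have "Z \<in> galg" using Z(1) ggr_subset_galg by blast
    then have OmZ: "Om y (\<xi>' y) = Z"
      unfolding \<xi>y unfolding u(4) using Om_tcoord[OF u(1)] omega_omega_inv[OF u(2)] by simp
    then show "Om y (\<xi>' y) \<in> ggr (-1)" "push (cinv c y) (Om y (\<xi>' y)) = \<xi> (p (cinv c y))"
      using Z u by simp_all
    have "DP y (\<xi>' y) = tcoord A d (p u) (push u Z)"
      unfolding \<xi>y unfolding u(4) by (simp add: DP_tcoord u proj_omega_inv_def)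
    also have "\<dots> = vf_rep A d \<xi> (P y)"
      using u d_in by (simp add: vf_rep_def Z)
    finally show "DP y (\<xi>' y) = vf_rep A d \<xi> (P y)" .
  qed
  \<comment> \<open>The first component fixes the projection, the second forces the value of
    \<omega> into \<open>ggr (-1)\<close>. The system is overdetermined but injective at
    \<open>y0\<close>, because \<open>push u0\<close> is injective on
    \<open>ggr (-1)\<close>.\<close>
  define G where "G y w = (DP y w, Om y w - gproj (-1) (Om y w))" for y w
  have VN: "V \<subseteq> N" by (auto simp: V_def)
  have "\<xi>' differentiable (at y0)"
  proof (rule linear_family_solution_differentiable[OF oV yV, of G])
    show "linear (G y)" if "y \<in> V" for y
    proof -
      have "linear (DP y)"
        using smooth_on_has_derivative[OF smooth_P] that VN by (blast intro: has_derivative_linear)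
      moreover have "linear (Om y)" using Om_linear that VN by blast
      ultimately show ?thesis
        unfolding G_def
        by (intro linearI) (simp_all add: linear_add linear_scale linear_add[OF gproj_linear]
            linear_scale[OF gproj_linear] scaleR_diff_right)
    qed
    show "(\<lambda>y. G y w) differentiable (at y0)" for w
    proof -
      have "(\<lambda>y. DP y w) differentiable (at y0)"
        using smooth_on_differentiable[OF smooth_on_frechet_derivative[OF smooth_P] y0_in] .
      moreover have "(\<lambda>y. Om y w - gproj (-1) (Om y w)) differentiable (at y0)"
        using Om_differentiable frechet_derivative_linear_comp(2)[OF Om_differentiable gproj_linear]
        by (intro differentiable_diff) auto
      ultimately show ?thesis
        unfolding G_def by (rule differentiable_Pair)
    qed
    show "(\<lambda>y. (vf_rep A d \<xi> (P y), 0)) differentiable (at y0)"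
    proof -
      have "(vf_rep A d \<xi> has_derivative frechet_derivative (vf_rep A d \<xi>) (at (P y0))) (at (P y0))"
        using vf_rep_differentiable[OF \<xi>(1) U(2)] frechet_derivative_works by blast
      from has_derivative_compose[OF smooth_on_has_derivative[OF smooth_P y0_in] this]
      show ?thesis
        by (intro differentiable_Pair differentiable_const) (auto simp: differentiable_def)
    qed
    show "G y (\<xi>' y) = (vf_rep A d \<xi> (P y), 0)" if "y \<in> V" for y
      using props[OF that] by (simp add: G_def gproj_ggr)
    show "inj (G y0)"
    proof (rule injI)
      fix v w assume eq: "G y0 v = G y0 w"
      define Z where "Z = \<omega> u0 (v - w)"
      have Z: "Z \<in> galg" unfolding Z_def by (rule omega_in[OF u0])
      have "linear (DP y0)"
        using smooth_on_has_derivative[OF smooth_P y0_in] has_derivative_linear by blast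
      then have "push u0 Z = 0"
        using eq unfolding Z_def DP_push[symmetric] by (simp add: G_def linear_diff)
      moreover have "Z = gproj (-1) Z"
        using eq by (simp add: G_def Z_def Om_y0 linear_diff[OF omega_linear[OF u0]] linear_diff[OF gproj_linear] algebra_simps)
      then have "Z \<in> ggr (-1)" using gproj_in_ggr[OF Z] by metis
      ultimately have "Z = 0"
        using push_inj[OF u0, of Z 0] push_scaleR[OF u0 Z, of 0] subspace_0[OF subspace_ggr] by simp
      then show "v = w"
        using omega_inj linear_0[OF omega_linear[OF u0]] unfolding Z_def by (metis eq_iff_diff_eq_0 injD)
    qed
  qed
  then have "is_lift \<xi> V \<xi>'" unfolding is_lift_def using oV yV VN props by blast
  then show ?thesis using that VU by blast
qed

text \<open>Fields related by \<open>P\<close> have related brackets: differentiating the relation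
  between lift and section, and using symmetry of the second derivative of \<open>P\<close>, moves
  the bracket to the total space, where \<open>lifted_bracket\<close> evaluates \<omega> on
  it.\<close>

lemma lift_bracket:
  assumes U: "p u0 \<in> U" and \<xi>: "smooth_vf A U \<xi>" "is_lift \<xi> V \<xi>'" and \<eta>: "smooth_vf A U \<eta>" "is_lift \<eta> W \<eta>'"
  shows "lie_bracket A \<xi> \<eta> (p u0) = push u0 (
    frechet_derivative (\<lambda>y. Om y (\<eta>' y)) (at y0) (\<xi>' y0) - frechet_derivative (\<lambda>y. Om y (\<xi>' y)) (at y0) (\<eta>' y0)
    + gbr (\<omega> u0 (\<xi>' y0)) (\<omega> u0 (\<eta>' y0)) - curvature B \<omega> u0 (\<omega> u0 (\<xi>' y0)) (\<omega> u0 (\<eta>' y0)))"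
proof -
  have d: "\<xi>' differentiable (at y0)" "\<eta>' differentiable (at y0)"
    using \<xi> \<eta> by (auto simp: is_lift_def)
  have Py0: "P y0 = snd d (p u0)" by (simp add: P_def cinv_y0)
  have val: "DP y0 (\<zeta>' y0) = \<zeta> (p u0)" if "is_lift \<zeta> V \<zeta>'" for \<zeta> V \<zeta>'
  proof -
    have "DP y0 (\<zeta>' y0) = vf_rep A d \<zeta> (P y0)" using that unfolding is_lift_def by blast
    also have "\<dots> = \<zeta> (p u0)"
      using base.tcoord_chart_at[OF proj_in[OF u0]] d_in by (simp add: vf_rep_def Py0) (simp add: d_def)
    finally show ?thesis .
  qed
  have D: "frechet_derivative (\<lambda>y. DP y (\<zeta>' y)) (at y0) v = frechet_derivative (vf_rep A d \<zeta>) (at (P y0)) (DP y0 v)"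
    if \<zeta>: "smooth_vf A U \<zeta>" "is_lift \<zeta> V \<zeta>'" for \<zeta> V \<zeta>' v
  proof -
    have "(vf_rep A d \<zeta> has_derivative frechet_derivative (vf_rep A d \<zeta>) (at (P y0))) (at (P y0))"
      using vf_rep_differentiable[OF \<zeta>(1) U] frechet_derivative_works by blast
    from has_derivative_compose[OF smooth_on_has_derivative[OF smooth_P y0_in] this]
    have "((\<lambda>y. DP y (\<zeta>' y)) has_derivative (\<lambda>v. frechet_derivative (vf_rep A d \<zeta>) (at (P y0)) (DP y0 v))) (at y0)"
      by (rule has_derivative_transform_within_open[of _ _ _ _ V]) (use \<zeta>(2) in \<open>auto simp: is_lift_def\<close>)
    from fun_cong[OF frechet_derivative_at[OF this], of v] show ?thesis by (rule sym)
  qed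
  have "lie_bracket A \<xi> \<eta> (p u0) = frechet_derivative (vf_rep A d \<eta>) (at (P y0)) (DP y0 (\<xi>' y0))
      - frechet_derivative (vf_rep A d \<xi>) (at (P y0)) (DP y0 (\<eta>' y0))"
    unfolding lie_bracket_def Let_def d_def[symmetric] val[OF \<xi>(2)] val[OF \<eta>(2)] Py0 ..
  also have "\<dots> = DP y0 (frechet_derivative \<eta>' (at y0) (\<xi>' y0) - frechet_derivative \<xi>' (at y0) (\<eta>' y0))"
    unfolding smooth_map_bracket[OF open_N y0_in smooth_P d] D[OF \<xi>] D[OF \<eta>] ..
  finally show ?thesis
    unfolding DP_push lifted_bracket[OF d refl refl] .
qed

lemma push_diff:
  assumes "X \<in> galg" "Y \<in> galg"
  shows "push u0 (X - Y) = push u0 X - push u0 Y"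
  using push_add[OF u0 assms(1), of "(-1) *\<^sub>R Y"] push_scaleR[OF u0 assms(2), of "-1"]
    subspace_neg[OF subspace_galg assms(2)] by simp

lemma Om_lift_differentiable:
  assumes "is_lift \<xi> V \<xi>'"
  shows "(\<lambda>y. Om y (\<xi>' y)) differentiable (at y0)"
  using linear_family_has_derivative[OF open_N y0_in Om_linear Om_differentiable] assms frechet_derivative_works
  unfolding is_lift_def differentiable_def by blast

lemma Om_lift_derivative_in:
  assumes "is_lift \<xi> V \<xi>'"
  shows "frechet_derivative (\<lambda>y. Om y (\<xi>' y)) (at y0) v \<in> ggr (-1)"
proof -
  note diff = Om_lift_differentiable[OF assms]
  have "frechet_derivative (\<lambda>y. gminus1_proj (Om y (\<xi>' y))) (at y0) = frechet_derivative (\<lambda>y. Om y (\<xi>' y)) (at y0)"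
    by (rule frechet_derivative_cong_open(1)[OF diff, of V])
      (use assms gminus1_proj_id in \<open>auto simp: is_lift_def\<close>)
  then show ?thesis
    using gminus1_proj_in[of "frechet_derivative (\<lambda>y. Om y (\<xi>' y)) (at y0) v"]
    unfolding frechet_derivative_linear_comp(1)[OF diff gminus1_proj_linear, symmetric] by simp
qed

text \<open>The assumption \<open>rel\<close> says that \<eta> is J applied to \<xi>, phrased
  through \<open>push\<close> without reference to \<open>canonical_J\<close>. Near
  \<open>y0\<close> the two sides have equal image under the injective \<open>push\<close>, so they
  agree together with their derivatives.\<close>

lemma Om_lift_cxm:
  assumes \<xi>: "is_lift \<xi> V \<xi>'" and \<eta>: "is_lift \<eta> W \<eta>'"
    and rel: "\<And>u X. u \<in> mcarrier B \<Longrightarrow> p u \<in> U \<Longrightarrow> X \<in> ggr (-1) \<Longrightarrow> \<xi> (p u) = push u X \<Longrightarrow> \<eta> (p u) = push u (cxm X)"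
    and VU: "\<And>y. y \<in> V \<Longrightarrow> p (cinv c y) \<in> U"
  shows "\<omega> u0 (\<eta>' y0) = cxm (\<omega> u0 (\<xi>' y0))"
    "frechet_derivative (\<lambda>y. Om y (\<eta>' y)) (at y0) v = cxm (frechet_derivative (\<lambda>y. Om y (\<xi>' y)) (at y0) v)"
proof -
  have eq: "Om y (\<eta>' y) = cxm (Om y (\<xi>' y))" if y: "y \<in> V \<inter> W" for y
  proof -
    have "y \<in> N" using y \<xi> by (auto simp: is_lift_def)
    then have u: "cinv c y \<in> mcarrier B" by (rule N_cases) simp
    have x: "Om y (\<xi>' y) \<in> ggr (-1)" "push (cinv c y) (Om y (\<xi>' y)) = \<xi> (p (cinv c y))"
      and e: "Om y (\<eta>' y) \<in> ggr (-1)" "push (cinv c y) (Om y (\<eta>' y)) = \<eta> (p (cinv c y))"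
      using \<xi> \<eta> y by (auto simp: is_lift_def)
    have "push (cinv c y) (Om y (\<eta>' y)) = push (cinv c y) (cxm (Om y (\<xi>' y)))"
      unfolding e(2) using rel[OF u _ x(1)] x(2) VU y by auto
    then show ?thesis using push_inj[OF u e(1) cxm_in_ggr[OF x(1)]] by blast
  qed
  have o: "open (V \<inter> W)" "y0 \<in> V \<inter> W" using \<xi> \<eta> by (auto simp: is_lift_def)
  show "\<omega> u0 (\<eta>' y0) = cxm (\<omega> u0 (\<xi>' y0))" using eq[OF o(2)] by (simp add: Om_y0)
  note diff = Om_lift_differentiable[OF \<xi>]
  have "frechet_derivative (\<lambda>y. Om y (\<eta>' y)) (at y0) = frechet_derivative (\<lambda>y. cxm (Om y (\<xi>' y))) (at y0)"
    by (rule frechet_derivative_cong_open(1)[OF frechet_derivative_linear_comp(2)[OF diff cxm_linear] o])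
      (use eq in auto)
  then show "frechet_derivative (\<lambda>y. Om y (\<eta>' y)) (at y0) v = cxm (frechet_derivative (\<lambda>y. Om y (\<xi>' y)) (at y0) v)"
    using frechet_derivative_linear_comp(1)[OF diff cxm_linear] by simp
qed

text \<open>Expands the complex bracket with four lifts. Here \<open>s\<close> collects the
  derivatives along the lifts of \<xi>1 and \<eta>1, and \<open>t\<close> those along the lifts of
  \<xi>2 and \<eta>2.\<close>

lemma complex_bracket_push:
  assumes U: "openin (mtopology A) U" "p u0 \<in> U"
    and sm: "smooth_vf A U \<xi>1" "smooth_vf A U \<xi>2" "smooth_vf A U \<eta>1" "smooth_vf A U \<eta>2"
    and sec: "\<And>x. x \<in> U \<Longrightarrow> \<xi>1 x \<in> E x" "\<And>x. x \<in> U \<Longrightarrow> \<xi>2 x \<in> E x"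
      "\<And>x. x \<in> U \<Longrightarrow> \<eta>1 x \<in> E x" "\<And>x. x \<in> U \<Longrightarrow> \<eta>2 x \<in> E x"
    and rel: "\<And>u X. u \<in> mcarrier B \<Longrightarrow> p u \<in> U \<Longrightarrow> X \<in> ggr (-1) \<Longrightarrow> \<xi>1 (p u) = push u X \<Longrightarrow> \<xi>2 (p u) = push u (cxm X)"
      "\<And>u X. u \<in> mcarrier B \<Longrightarrow> p u \<in> U \<Longrightarrow> X \<in> ggr (-1) \<Longrightarrow> \<eta>1 (p u) = push u X \<Longrightarrow> \<eta>2 (p u) = push u (cxm X)"
    and X: "X \<in> ggr (-1)" "\<xi>1 (p u0) = push u0 X" and Y: "Y \<in> ggr (-1)" "\<eta>1 (p u0) = push u0 Y"
    and K: "\<And>X Y. K X Y = gproj (-1) (curvature B \<omega> u0 X Y)"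
  obtains s t where "s \<in> ggr (-1)" "t \<in> ggr (-1)"
    "lie_bracket A \<xi>1 \<eta>1 (p u0) - lie_bracket A \<xi>2 \<eta>2 (p u0) = push u0 (s - cxm t - K X Y + K (cxm X) (cxm Y))"
    "lie_bracket A \<xi>1 \<eta>2 (p u0) + lie_bracket A \<xi>2 \<eta>1 (p u0) = push u0 (cxm s + t - K X (cxm Y) - K (cxm X) Y)"
proof -
  obtain V1 x1 where x1: "is_lift \<xi>1 V1 x1" "\<And>y. y \<in> V1 \<Longrightarrow> p (cinv c y) \<in> U"
    using lift_exists[OF U sm(1) sec(1)] by metis
  obtain V2 x2 where x2: "is_lift \<xi>2 V2 x2" "\<And>y. y \<in> V2 \<Longrightarrow> p (cinv c y) \<in> U"
    using lift_exists[OF U sm(2) sec(2)] by metis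
  obtain W1 e1 where e1: "is_lift \<eta>1 W1 e1" "\<And>y. y \<in> W1 \<Longrightarrow> p (cinv c y) \<in> U"
    using lift_exists[OF U sm(3) sec(3)] by metis
  obtain W2 e2 where e2: "is_lift \<eta>2 W2 e2" "\<And>y. y \<in> W2 \<Longrightarrow> p (cinv c y) \<in> U"
    using lift_exists[OF U sm(4) sec(4)] by metis
  have val: "\<omega> u0 (\<zeta>' y0) = Z" if "is_lift \<zeta> V \<zeta>'" "Z \<in> ggr (-1)" "\<zeta> (p u0) = push u0 Z" for \<zeta> V \<zeta>' Z
  proof -
    have "Om y0 (\<zeta>' y0) \<in> ggr (-1)" "push u0 (Om y0 (\<zeta>' y0)) = \<zeta> (p u0)"
      using that(1) unfolding is_lift_def by (auto simp: cinv_y0)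
    then show ?thesis using push_inj[OF u0 _ that(2)] that(3) by (simp add: Om_y0)
  qed
  note vx1 = val[OF x1(1) X] and ve1 = val[OF e1(1) Y]
  let ?Dx = "frechet_derivative (\<lambda>y. Om y (x1 y)) (at y0)" and ?De = "frechet_derivative (\<lambda>y. Om y (e1 y)) (at y0)"
  have vx2: "\<omega> u0 (x2 y0) = cxm X" "frechet_derivative (\<lambda>y. Om y (x2 y)) (at y0) v = cxm (?Dx v)" for v
    unfolding vx1[symmetric]
    by (rule Om_lift_cxm[OF x1(1) x2(1), of U]; use rel(1) x1(2) in blast)+
  have ve2: "\<omega> u0 (e2 y0) = cxm Y" "frechet_derivative (\<lambda>y. Om y (e2 y)) (at y0) v = cxm (?De v)" for v
    unfolding ve1[symmetric]
    by (rule Om_lift_cxm[OF e1(1) e2(1), of U]; use rel(2) e1(2) in blast)+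
  \<comment> \<open>Derivatives of the \<omega>-values of the lift of \<eta>1 along the two
    \<xi>-lifts, and of the lift of \<xi>1 along the two \<eta>-lifts; the index marks the
    direction. The remaining four derivatives are their images under \<open>cxm\<close>.\<close>
  define p1 p2 q1 q2 where "p1 = ?De (x1 y0)" and "p2 = ?De (x2 y0)" and "q1 = ?Dx (e1 y0)" and "q2 = ?Dx (e2 y0)"
  note defs = p1_def[symmetric] p2_def[symmetric] q1_def[symmetric] q2_def[symmetric]
  have pq: "p1 \<in> ggr (-1)" "p2 \<in> ggr (-1)" "q1 \<in> ggr (-1)" "q2 \<in> ggr (-1)"
    unfolding p1_def p2_def q1_def q2_def using Om_lift_derivative_in x1(1) e1(1) by blast+
  let ?k = "curvature B \<omega> u0"
  have b11: "lie_bracket A \<xi>1 \<eta>1 (p u0) = push u0 (p1 - q1 + gbr X Y - ?k X Y)"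
    using lift_bracket[OF U(2) sm(1) x1(1) sm(3) e1(1)] unfolding vx1 ve1 defs .
  have b22: "lie_bracket A \<xi>2 \<eta>2 (p u0) = push u0 (cxm p2 - cxm q2 + gbr (cxm X) (cxm Y) - ?k (cxm X) (cxm Y))"
    using lift_bracket[OF U(2) sm(2) x2(1) sm(4) e2(1)] unfolding vx2 ve2 defs .
  have b12: "lie_bracket A \<xi>1 \<eta>2 (p u0) = push u0 (cxm p1 - q2 + gbr X (cxm Y) - ?k X (cxm Y))"
    using lift_bracket[OF U(2) sm(1) x1(1) sm(4) e2(1)] unfolding vx1 ve2 defs .
  have b21: "lie_bracket A \<xi>2 \<eta>1 (p u0) = push u0 (p2 - cxm q1 + gbr (cxm X) Y - ?k (cxm X) Y)"
    using lift_bracket[OF U(2) sm(2) x2(1) sm(3) e1(1)] unfolding vx2 ve1 defs .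
  have in1: "cxm X \<in> ggr (-1)" "cxm Y \<in> ggr (-1)" "cxm p1 \<in> ggr (-1)" "cxm p2 \<in> ggr (-1)" "cxm q1 \<in> ggr (-1)" "cxm q2 \<in> ggr (-1)"
    using X Y pq cxm_in_ggr by blast+
  have gal: "a - b + gbr Z W - ?k Z W \<in> galg"
    if "a \<in> ggr (-1)" "b \<in> ggr (-1)" "Z \<in> ggr (-1)" "W \<in> ggr (-1)" for a b Z W
  proof -
    have "a \<in> galg" "b \<in> galg" "Z \<in> galg" "W \<in> galg" using that ggr_subset_galg by blast+
    then show ?thesis
      using gbr_in_galg curvature_in_galg
      by (intro subspace_diff[OF subspace_galg] subspace_add[OF subspace_galg]) auto
  qed
  note lin = linear_add[OF gproj_linear] linear_diff[OF gproj_linear]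
  note pr = gproj_ggr gproj_curvature gbr_ggr_minus1[THEN gproj_ggr]
  let ?Z11 = "p1 - q1 + gbr X Y - ?k X Y" and ?Z22 = "cxm p2 - cxm q2 + gbr (cxm X) (cxm Y) - ?k (cxm X) (cxm Y)"
  let ?Z12 = "cxm p1 - q2 + gbr X (cxm Y) - ?k X (cxm Y)" and ?Z21 = "p2 - cxm q1 + gbr (cxm X) Y - ?k (cxm X) Y"
  note g = gal[OF pq(1,3) X(1) Y(1)] gal[OF in1(4,6,1,2)] gal[OF in1(3) pq(4) X(1) in1(2)] gal[OF pq(2) in1(5,1) Y(1)]
  have "push u0 ?Z11 - push u0 ?Z22 = push u0 (?Z11 - ?Z22)"
    using push_diff[OF g(1,2)] by simp
  \<comment> \<open>A single bracket need not lie in \<open>E\<close>: its \<open>ggr (-2)\<close>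
    part is a \<open>gbr\<close>. Only in the difference do these parts cancel, by
    \<open>gbr_cxm_cxm\<close>, so the projection is applied after subtracting.\<close>
  also have "\<dots> = push u0 (gproj (-1) (?Z11 - ?Z22))"
  proof (rule push_gproj[OF u0 subspace_diff[OF subspace_galg g(1,2)]])
    show "gproj (-2) (?Z11 - ?Z22) = 0"
      using pq in1 X(1) Y(1) by (simp add: lin pr gbr_cxm_cxm)
  qed
  also have "gproj (-1) (?Z11 - ?Z22) = (p1 - q1) - cxm (p2 - q2) - K X Y + K (cxm X) (cxm Y)"
    using pq in1 X(1) Y(1) by (simp add: lin pr gbr_cxm_cxm K linear_diff[OF cxm_linear])
  finally have r1: "push u0 ?Z11 - push u0 ?Z22 = push u0 ((p1 - q1) - cxm (p2 - q2) - K X Y + K (cxm X) (cxm Y))" .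
  have "push u0 ?Z12 + push u0 ?Z21 = push u0 (?Z12 + ?Z21)"
    using push_add[OF u0 g(3,4)] by simp
  also have "\<dots> = push u0 (gproj (-1) (?Z12 + ?Z21))"
  proof (rule push_gproj[OF u0 subspace_add[OF subspace_galg g(3,4)]])
    show "gproj (-2) (?Z12 + ?Z21) = 0"
      using pq in1 X(1) Y(1) gbr_cxm_add[OF X(1) Y(1)] by (simp add: lin pr)
  qed
  also have "gproj (-1) (?Z12 + ?Z21) = cxm (p1 - q1) + (p2 - q2) - K X (cxm Y) - K (cxm X) Y"
    using pq in1 X(1) Y(1) by (simp add: lin pr K linear_diff[OF cxm_linear])
  finally have r2: "push u0 ?Z12 + push u0 ?Z21 = push u0 (cxm (p1 - q1) + (p2 - q2) - K X (cxm Y) - K (cxm X) Y)" .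
  show ?thesis
    by (rule that[of "p1 - q1" "p2 - q2"])
      (use pq r1 r2 in \<open>simp_all add: b11 b12 b21 b22 subspace_diff[OF subspace_ggr]\<close>)
qed

end

section \<open>Integrability\<close>

locale hyperbolic_geometry = framed_geometry A B p r \<omega> E Fr
  for A :: "('m, 'e::euclidean_space) chart set" and B :: "('g, 'f::euclidean_space) chart set"
    and p :: "'g \<Rightarrow> 'm" and r :: "'g \<Rightarrow> gelt \<Rightarrow> 'g" and \<omega> :: "'g \<Rightarrow> 'f \<Rightarrow> gvec"
    and E :: "'m \<Rightarrow> 'e set" and Fr :: "'m \<Rightarrow> 'e gframe set" +
  assumes gP_structure: "regular_gP_structure A E Fr"
begin

lemma local_frame:
  assumes "x \<in> mcarrier A"
  obtains U f where "openin (mtopology A) U" "x \<in> U" "\<And>y. y \<in> U \<Longrightarrow> f y \<in> gr_isos (E y)"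
    "\<And>y. y \<in> U \<Longrightarrow> Fr y = frame_act (f y) ` G0set"
    "\<And>X. X \<in> ggr (-1) \<Longrightarrow> smooth_vf A U (\<lambda>y. snd (f y) X)"
proof -
  have "\<forall>x\<in>mcarrier A. \<exists>U f. openin (mtopology A) U \<and> x \<in> U \<and>
        (\<forall>y\<in>U. f y \<in> gr_isos (E y) \<and> Fr y = frame_act (f y) ` G0set) \<and>
        (\<forall>X\<in>ggr (-1). smooth_vf A U (\<lambda>y. snd (f y) X)) \<and>
        (\<forall>X\<in>ggr (-2). \<exists>\<zeta>. smooth_vf A U \<zeta> \<and> (\<forall>y\<in>U. \<zeta> y \<in> fst (f y) X))"
    using gP_structure unfolding regular_gP_structure_def by (elim conjE)
  from bspec[OF this assms] obtain U f where "openin (mtopology A) U" "x \<in> U"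
    "\<forall>y\<in>U. f y \<in> gr_isos (E y) \<and> Fr y = frame_act (f y) ` G0set"
    "\<forall>X\<in>ggr (-1). smooth_vf A U (\<lambda>y. snd (f y) X)"
    by (elim exE conjE)
  then show ?thesis by (intro that[of U f]) simp_all
qed

lemma G0set_ggr: "a \<in> G0set \<Longrightarrow> X \<in> ggr (-1) \<Longrightarrow> Ad a X \<in> ggr (-1)"
  unfolding G0set_def by blast

lemma push_frame_act:
  assumes "u \<in> mcarrier B" "Fr (p u) = frame_act f ` G0set"
  obtains a where "a \<in> G0set" "\<And>X. X \<in> ggr (-1) \<Longrightarrow> push u X = snd f (Ad a X)"
proof -
  have "frame u \<in> frame_act f ` G0set"
    using Fr_eq[OF proj_in[OF assms(1)]] assms by blast
  then obtain a where a: "a \<in> G0set" "frame u = frame_act f a" by blast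
  have "push u X = snd f (Ad a X)" if "X \<in> ggr (-1)" for X
    using fun_cong[OF arg_cong[OF a(2), of snd], of X] that by (simp add: frame_def frame_act_def)
  then show ?thesis using that a(1) by blast
qed

text \<open>Points of one fibre induce frames in one orbit of \<open>G0set\<close>. Comparing both
  with the local frame at \<open>p u\<close> reduces the claim to the fact that \<open>Ad\<close> of
  \<open>G0set\<close> commutes with \<open>cxm\<close>.\<close>

lemma push_cxm_well_defined:
  assumes u: "u \<in> mcarrier B" and v: "v \<in> mcarrier B" and uv: "p u = p v"
    and X: "X \<in> ggr (-1)" and Y: "Y \<in> ggr (-1)" and eq: "push u X = push v Y"
  shows "push u (cxm X) = push v (cxm Y)"
proof -
  obtain U f where f: "p u \<in> U" "\<And>y. y \<in> U \<Longrightarrow> f y \<in> gr_isos (E y)"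
    "\<And>y. y \<in> U \<Longrightarrow> Fr y = frame_act (f y) ` G0set"
    by (rule local_frame[OF proj_in[OF u]]) blast
  obtain a where a: "a \<in> G0set" "\<And>X. X \<in> ggr (-1) \<Longrightarrow> push u X = snd (f (p u)) (Ad a X)"
    using push_frame_act[OF u f(3)[OF f(1)]] by blast
  obtain b where b: "b \<in> G0set" "\<And>X. X \<in> ggr (-1) \<Longrightarrow> push v X = snd (f (p u)) (Ad b X)"
    using push_frame_act[OF v] f(3)[OF f(1)] uv by metis
  have "inj_on (snd (f (p u))) (ggr (-1))"
    using f(2)[OF f(1)] unfolding gr_isos_def by (auto dest: bij_betw_imp_inj_on)
  then have "Ad a X = Ad b Y"
    using eq a(2)[OF X] b(2)[OF Y] G0set_ggr[OF a(1) X] G0set_ggr[OF b(1) Y] by (metis inj_onD)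
  then show ?thesis
    using a(2)[OF cxm_in_ggr[OF X]] b(2)[OF cxm_in_ggr[OF Y]] G0set_cxm[OF a(1) X] G0set_cxm[OF b(1) Y] by simp
qed

lemma canonical_J_push:
  assumes u: "u \<in> mcarrier B" and X: "X \<in> ggr (-1)"
  shows "canonical_J A B p \<omega> (p u) (push u X) = push u (cxm X)"
  unfolding canonical_J_def
proof (rule the_equality)
  show "\<exists>u'\<in>mcarrier B. \<exists>X'\<in>ggr (-1). p u' = p u \<and> push u X = push u' X' \<and> push u (cxm X) = push u' (cxm X')"
    using u X by blast
  fix w assume "\<exists>u'\<in>mcarrier B. \<exists>X'\<in>ggr (-1). p u' = p u \<and> push u X = push u' X' \<and> w = push u' (cxm X')"
  then show "w = push u (cxm X)" using push_cxm_well_defined[OF u _ _ X] by metis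
qed

abbreviation "D01 \<equiv> zero_one_space E (canonical_J A B p \<omega>)"

lemma zero_one_iff:
  assumes u: "u \<in> mcarrier B"
  shows "(v, w) \<in> D01 (p u) \<longleftrightarrow> (\<exists>X\<in>ggr (-1). v = push u X \<and> w = push u (cxm X))"
proof
  assume *: "(v, w) \<in> D01 (p u)"
  then obtain X where X: "X \<in> ggr (-1)" "push u X = v"
    using push_surj[OF u] unfolding zero_one_space_def by blast
  then have "w = push u (cxm X)"
    using * canonical_J_push[OF u X(1)] by (simp add: zero_one_space_def)
  then show "\<exists>X\<in>ggr (-1). v = push u X \<and> w = push u (cxm X)" using X by blast
next
  assume "\<exists>X\<in>ggr (-1). v = push u X \<and> w = push u (cxm X)"
  then obtain X where X: "X \<in> ggr (-1)" "v = push u X" "w = push u (cxm X)" by blast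
  have "X \<in> galg" using X(1) ggr_subset_galg by blast
  then have "push u (cxm (cxm X)) = - push u X"
    using push_scaleR[OF u, of X "-1"] cxm_cxm[OF X(1)] by simp
  then show "(v, w) \<in> D01 (p u)"
    using X push_in[OF u] cxm_in_ggr canonical_J_push[OF u] by (simp add: zero_one_space_def)
qed

text \<open>The criterion involves the sections only through their values at \<open>p u\<close>.
  Hence involutivity can be tested with any one pair of sections through given vectors.\<close>

lemma bracket_in_D01_iff:
  assumes U: "openin (mtopology A) U" and u: "u \<in> mcarrier B" "p u \<in> U"
    and Z: "smooth_complex_section A D01 U Z" and W: "smooth_complex_section A D01 U W"
    and X: "X \<in> ggr (-1)" "fst (Z (p u)) = push u X" and Y: "Y \<in> ggr (-1)" "fst (W (p u)) = push u Y"
  shows "complex_lie_bracket A Z W (p u) \<in> D01 (p u) \<longleftrightarrow> curvature_aa B \<omega> u X Y = 0"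
proof -
  interpret at: framed_geometry_at A B p r \<omega> E Fr u
    by unfold_locales (rule u(1))
  define K where "K X Y = gproj (-1) (curvature B \<omega> u X Y)" for X Y
  have rel: "(snd \<circ> Z') (p u) = push u (cxm X)"
    if Z': "smooth_complex_section A D01 U Z'" and u: "u \<in> mcarrier B" "p u \<in> U"
      and X: "X \<in> ggr (-1)" "(fst \<circ> Z') (p u) = push u X" for Z' u X
  proof -
    have "(fst (Z' (p u)), snd (Z' (p u))) \<in> D01 (p u)"
      using Z' u(2) by (simp add: smooth_complex_section_def)
    then obtain X' where "X' \<in> ggr (-1)" "fst (Z' (p u)) = push u X'" "snd (Z' (p u)) = push u (cxm X')"
      using zero_one_iff[OF u(1)] by blast
    then show ?thesis using push_inj[OF u(1) _ X(1)] X(2) by (metis comp_apply)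
  qed
  have sec: "fst (Z' x) \<in> E x" "snd (Z' x) \<in> E x" if "smooth_complex_section A D01 U Z'" "x \<in> U" for Z' x
    using that unfolding smooth_complex_section_def zero_one_space_def by fastforce+
  obtain s t where st: "s \<in> ggr (-1)" "t \<in> ggr (-1)"
    "lie_bracket A (fst \<circ> Z) (fst \<circ> W) (p u) - lie_bracket A (snd \<circ> Z) (snd \<circ> W) (p u) =
      push u (s - cxm t - K X Y + K (cxm X) (cxm Y))"
    "lie_bracket A (fst \<circ> Z) (snd \<circ> W) (p u) + lie_bracket A (snd \<circ> Z) (fst \<circ> W) (p u) =
      push u (cxm s + t - K X (cxm Y) - K (cxm X) Y)"
    by (rule at.complex_bracket_push[OF U u(2), of "fst \<circ> Z" "snd \<circ> Z" "fst \<circ> W" "snd \<circ> W" X Y K])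
      (use Z W X Y rel[OF Z] rel[OF W] sec[OF Z] sec[OF W] in \<open>auto simp: smooth_complex_section_def K_def\<close>)
  let ?a = "s - cxm t - K X Y + K (cxm X) (cxm Y)" and ?b = "cxm s + t - K X (cxm Y) - K (cxm X) Y"
  note in_intros = subspace_add[OF subspace_ggr] subspace_diff[OF subspace_ggr] at.gproj_curvature_in cxm_in_ggr
  have ab: "?a \<in> ggr (-1)" "?b \<in> ggr (-1)"
    unfolding K_def by (intro in_intros st(1,2) X(1) Y(1))+
  have "complex_lie_bracket A Z W (p u) = (push u ?a, push u ?b)"
    unfolding complex_lie_bracket_def st(3,4) ..
  then have "complex_lie_bracket A Z W (p u) \<in> D01 (p u) \<longleftrightarrow> cxm ?a = ?b"
    using zero_one_iff[OF u(1), of "push u ?a" "push u ?b"] push_inj[OF u(1)] ab cxm_in_ggr[OF ab(1)] by metis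
  then show ?thesis
    using at.curvature_aa_zero_iff[OF X(1) Y(1) st(1,2), of K] K_def by simp
qed

lemma frame_act_one: "f \<in> gr_isos V \<Longrightarrow> frame_act f \<one>\<^bsub>Ggrp\<^esub> = f"
  by (auto simp: frame_act_def Ggrp_one Ad_one gr_isos_def comp_def extensional_restrict)

text \<open>The sections are constant in a local smooth frame, with \<open>Ad a\<close> accounting
  for the passage from that frame to the one induced by \<open>u\<close>. The domain is chosen
  before \<open>X\<close>, so that two such sections can be bracketed on it.\<close>

lemma adapted_section_exists:
  assumes u: "u \<in> mcarrier B"
  obtains U where "openin (mtopology A) U" "p u \<in> U"
    "\<And>X. X \<in> ggr (-1) \<Longrightarrow> \<exists>Z. smooth_complex_section A D01 U Z \<and> fst (Z (p u)) = push u X"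
proof -
  obtain U f where f: "openin (mtopology A) U" "p u \<in> U" "\<And>y. y \<in> U \<Longrightarrow> f y \<in> gr_isos (E y)"
    "\<And>y. y \<in> U \<Longrightarrow> Fr y = frame_act (f y) ` G0set"
    "\<And>X. X \<in> ggr (-1) \<Longrightarrow> smooth_vf A U (\<lambda>y. snd (f y) X)"
    by (rule local_frame[OF proj_in[OF u]]) (rule that)
  obtain a where a: "a \<in> G0set" "\<And>X. X \<in> ggr (-1) \<Longrightarrow> push u X = snd (f (p u)) (Ad a X)"
    using push_frame_act[OF u f(4)[OF f(2)]] by blast
  have "\<exists>Z. smooth_complex_section A D01 U Z \<and> fst (Z (p u)) = push u X" if X: "X \<in> ggr (-1)" for X
  proof (intro exI conjI)
    define Q where "Q = Ad a X"
    have Q: "Q \<in> ggr (-1)" unfolding Q_def by (rule G0set_ggr[OF a(1) X])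
    let ?Z = "\<lambda>y. (snd (f y) Q, snd (f y) (cxm Q))"
    show "fst (?Z (p u)) = push u X" using a(2)[OF X] by (simp add: Q_def)
    have "?Z y \<in> D01 y" if y: "y \<in> U" for y
    proof -
      have yA: "y \<in> mcarrier A" using y f(1) base.openin_iff by blast
      have "f y \<in> Fr y"
        using f(4)[OF y] frame_act_one[OF f(3)[OF y]] one_in_G0set by (metis imageI)
      then obtain v where v: "v \<in> mcarrier B" "p v = y" "f y = frame v"
        using Fr_eq[OF yA] by blast
      then have "snd (f y) X' = push v X'" if "X' \<in> ggr (-1)" for X'
        using that by (simp add: frame_def)
      then show ?thesis
        using zero_one_iff[OF v(1)] Q cxm_in_ggr[OF Q] v(2) by blast
    qed
    then show "smooth_complex_section A D01 U ?Z"
      unfolding smooth_complex_section_def using f(5)[OF Q] f(5)[OF cxm_in_ggr[OF Q]] by (simp add: comp_def)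
  qed
  then show ?thesis using that f(1,2) by blast
qed

text \<open>Each frame of the structure is induced by a point of the bundle, and there is a frame
  over \<open>x\<close> because \<open>G0set\<close> contains the identity.\<close>

lemma base_point_lift:
  assumes "x \<in> mcarrier A"
  obtains u where "u \<in> mcarrier B" "p u = x"
proof -
  obtain U f where "x \<in> U" "\<And>y. y \<in> U \<Longrightarrow> Fr y = frame_act (f y) ` G0set"
    by (rule local_frame[OF assms]) blast
  then have "Fr x \<noteq> {}" using one_in_G0set by blast
  then show ?thesis using that Fr_eq[OF assms] by blast
qed

lemma integrable_J_iff:
  "integrable_J A E (canonical_J A B p \<omega>) \<longleftrightarrow>
    (\<forall>u\<in>mcarrier B. \<forall>X\<in>ggr (-1). \<forall>Y\<in>ggr (-1). curvature_aa B \<omega> u X Y = 0)"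
proof (intro iffI ballI)
  fix u X Y
  assume int: "integrable_J A E (canonical_J A B p \<omega>)" and u: "u \<in> mcarrier B"
    and X: "X \<in> ggr (-1)" and Y: "Y \<in> ggr (-1)"
  obtain U where U: "openin (mtopology A) U" "p u \<in> U"
    "\<And>X. X \<in> ggr (-1) \<Longrightarrow> \<exists>Z. smooth_complex_section A D01 U Z \<and> fst (Z (p u)) = push u X"
    using adapted_section_exists[OF u] by blast
  obtain Z where Z: "smooth_complex_section A D01 U Z" "fst (Z (p u)) = push u X" using U(3)[OF X] by blast
  obtain W where W: "smooth_complex_section A D01 U W" "fst (W (p u)) = push u Y" using U(3)[OF Y] by blast
  have "complex_lie_bracket A Z W (p u) \<in> D01 (p u)"
    using int U Z(1) W(1) unfolding integrable_J_def complex_involutive_def by blast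
  then show "curvature_aa B \<omega> u X Y = 0"
    using bracket_in_D01_iff[OF U(1) u U(2) Z(1) W(1) X Z(2) Y W(2)] by blast
next
  assume zero: "\<forall>u\<in>mcarrier B. \<forall>X\<in>ggr (-1). \<forall>Y\<in>ggr (-1). curvature_aa B \<omega> u X Y = 0"
  show "integrable_J A E (canonical_J A B p \<omega>)"
    unfolding integrable_J_def complex_involutive_def
  proof (intro allI impI ballI)
    fix U Z W x
    assume *: "openin (mtopology A) U \<and> smooth_complex_section A D01 U Z \<and> smooth_complex_section A D01 U W"
      and x: "x \<in> U"
    then have "x \<in> mcarrier A" using base.openin_iff by blast
    then obtain u where u: "u \<in> mcarrier B" "p u = x" by (rule base_point_lift)
    have "fst (Z x) \<in> E x" "fst (W x) \<in> E x"
      using * x unfolding smooth_complex_section_def zero_one_space_def by fastforce+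
    then obtain X Y where X: "X \<in> ggr (-1)" "push u X = fst (Z x)" and Y: "Y \<in> ggr (-1)" "push u Y = fst (W x)"
      using push_surj[OF u(1)] u(2) by metis
    then show "complex_lie_bracket A Z W x \<in> D01 x"
      using bracket_in_D01_iff[OF _ u(1), of U Z W X Y] * x u zero by auto
  qed
qed

end

section \<open>The embedded case\<close>

context framed_geometry_at
begin

text \<open>Let \<phi> Z be the derivative of the immersion, pulled back to the total space, along
  the field with constant \<omega> equal to Z. By \<open>hol\<close>, \<phi> turns
  \<open>cxm\<close> into \<open>I\<close> on a whole neighbourhood, so the same holds for its
  derivatives. Brackets of these fields are then expressed by derivatives of \<phi>, while \<omega>
  expresses them by the curvature.\<close>

lemma curvature_aa_zero_if_CR_immersion:
  fixes F :: "'e \<Rightarrow> 'v::euclidean_space"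
  assumes F: "smooth_on (snd d ` fst d) F" and I: "linear I" "\<And>v. I (I v) = - v"
    and hol: "\<And>u X. u \<in> mcarrier B \<Longrightarrow> p u \<in> fst d \<Longrightarrow> X \<in> ggr (-1) \<Longrightarrow>
      frechet_derivative F (at (snd d (p u))) (tcoord A d (p u) (push u (cxm X))) =
      I (frechet_derivative F (at (snd d (p u))) (tcoord A d (p u) (push u X)))"
    and inj: "inj (frechet_derivative F (at (snd d (p u0))))"
    and X: "X \<in> ggr (-1)" and Y: "Y \<in> ggr (-1)"
  shows "curvature_aa B \<omega> u0 X Y = 0"
proof -
  define \<Phi> where "\<Phi> y = F (P y)" for y
  have PN: "P ` N \<subseteq> snd d ` fst d" by (auto elim!: N_cases)
  have s\<Phi>: "smooth_on N \<Phi>" unfolding \<Phi>_def by (rule smooth_on_compose[OF open_N PN smooth_P F])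
  have D\<Phi>: "frechet_derivative \<Phi> (at y) w = frechet_derivative F (at (P y)) (DP y w)" if "y \<in> N" for y w
  proof -
    have "(F has_derivative frechet_derivative F (at (P y))) (at (P y))"
      using smooth_on_has_derivative[OF F] PN that by blast
    from has_derivative_compose[OF smooth_on_has_derivative[OF smooth_P that] this]
    have "(\<Phi> has_derivative (\<lambda>w. frechet_derivative F (at (P y)) (DP y w))) (at y)"
      unfolding \<Phi>_def .
    from fun_cong[OF frechet_derivative_at[OF this], of w] show ?thesis by (rule sym)
  qed
  define E0 where "E0 = frechet_derivative F (at (snd d (p u0)))"
  have Py0: "P y0 = snd d (p u0)" by (simp add: P_def cinv_y0)
  have "(F has_derivative E0) (at (snd d (p u0)))"
    unfolding E0_def using smooth_on_has_derivative[OF F] d_in by blast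
  then have E0: "linear E0" by (rule has_derivative_linear)
  define \<phi> where "\<phi> Z y = frechet_derivative \<Phi> (at y) (rep Z y)" for Z y
  have \<phi>d: "\<phi> Z differentiable (at y0)" if "Z \<in> galg" for Z
  proof -
    have "linear (frechet_derivative \<Phi> (at y))" if "y \<in> N" for y
      using has_derivative_linear[OF smooth_on_has_derivative[OF s\<Phi> that]] .
    moreover have "(\<lambda>y. frechet_derivative \<Phi> (at y) w) differentiable (at y0)" for w
      using smooth_on_differentiable[OF smooth_on_frechet_derivative[OF s\<Phi>] y0_in] .
    ultimately show ?thesis
      using linear_family_has_derivative[OF open_N y0_in, of "\<lambda>y. frechet_derivative \<Phi> (at y)" "rep Z"]
        rep_differentiable[OF that] frechet_derivative_works
      unfolding \<phi>_def differentiable_def by blast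
  qed
  have \<phi>_cxm: "\<phi> (cxm Z) y = I (\<phi> Z y)" if Z: "Z \<in> ggr (-1)" and y: "y \<in> N" for Z y
  proof -
    obtain u where u: "u \<in> fst c" "u \<in> mcarrier B" "p u \<in> fst d" "y = snd c u" "cinv c y = u" "P y = snd d (p u)"
      by (rule N_cases[OF y])
    have "DP y (rep V y) = tcoord A d (p u) (push u V)" for V
      unfolding rep_def vf_rep_def u(5) unfolding u(4) DP_tcoord[OF u(1,3)] by (simp add: proj_omega_inv_def)
    then show ?thesis unfolding \<phi>_def D\<Phi>[OF y] u(6) using hol[OF u(2,3) Z] by simp
  qed
  define \<phi>' where "\<phi>' Z v = frechet_derivative (\<phi> Z) (at y0) v" for Z v
  have \<phi>'_cxm: "\<phi>' (cxm Z) v = I (\<phi>' Z v)" if Z: "Z \<in> ggr (-1)" for Z v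
  proof -
    have Zg: "Z \<in> galg" using Z ggr_subset_galg by blast
    note lc = frechet_derivative_linear_comp[OF \<phi>d[OF Zg] I(1)]
    have "frechet_derivative (\<phi> (cxm Z)) (at y0) = frechet_derivative (\<lambda>y. I (\<phi> Z y)) (at y0)"
      by (rule frechet_derivative_cong_open(1)[OF lc(2) open_N y0_in]) (simp add: \<phi>_cxm[OF Z])
    then show ?thesis unfolding \<phi>'_def lc(1)[symmetric] by simp
  qed
  let ?k = "curvature B \<omega> u0"
  have br: "E0 (push u0 (gbr V W - ?k V W)) = \<phi>' W (rep V y0) - \<phi>' V (rep W y0)"
    if "V \<in> galg" "W \<in> galg" for V W
  proof -
    have "gbr V W - ?k V W = \<omega> u0 (lie_bracket B (omega_inv \<omega> V) (omega_inv \<omega> W) u0)"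
      by (simp add: curvature_def)
    then have "E0 (push u0 (gbr V W - ?k V W)) = frechet_derivative \<Phi> (at y0) (lie_bracket B (omega_inv \<omega> V) (omega_inv \<omega> W) u0)"
      by (simp add: D\<Phi>[OF y0_in] DP_push Py0 E0_def)
    also have "\<dots> = \<phi>' W (rep V y0) - \<phi>' V (rep W y0)"
      unfolding lie_bracket_rep smooth_map_bracket[OF open_N y0_in s\<Phi> rep_differentiable[OF that(1)] rep_differentiable[OF that(2)]]
      by (simp add: \<phi>'_def \<phi>_def[abs_def])
    finally show ?thesis .
  qed
  define K where "K V W = gproj (-1) (?k V W)" for V W
  have in1: "cxm X \<in> ggr (-1)" "cxm Y \<in> ggr (-1)" using X Y cxm_in_ggr by blast+
  have gal: "gbr V W - ?k V W \<in> galg" if "V \<in> ggr (-1)" "W \<in> ggr (-1)" for V W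
  proof -
    have "V \<in> galg" "W \<in> galg" using that ggr_subset_galg by blast+
    then show ?thesis by (intro subspace_diff[OF subspace_galg] gbr_in_galg curvature_in_galg)
  qed
  note lin = linear_add[OF gproj_linear] linear_diff[OF gproj_linear]
  note pr = gproj_ggr gproj_curvature gbr_ggr_minus1[THEN gproj_ggr]
  let ?t = "\<lambda>V W. gbr V W - ?k V W"
  note g = gal[OF X Y] gal[OF in1] gal[OF X in1(2)] gal[OF in1(1) Y]
  \<comment> \<open>The zeros stand for \<open>s\<close> and \<open>t\<close>, so that
    \<open>curvature_aa_zero_iff\<close> applies literally.\<close>
  let ?a = "0 - cxm 0 - K X Y + K (cxm X) (cxm Y)" and ?b = "cxm 0 + 0 - K X (cxm Y) - K (cxm X) Y"
  have c0: "cxm 0 = 0" using linear_0[OF cxm_linear] .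
  have a: "push u0 (?t X Y) - push u0 (?t (cxm X) (cxm Y)) = push u0 ?a"
  proof -
    have "push u0 (?t X Y) - push u0 (?t (cxm X) (cxm Y)) = push u0 (?t X Y - ?t (cxm X) (cxm Y))"
      using push_diff[OF g(1,2)] by simp
    also have "\<dots> = push u0 (gproj (-1) (?t X Y - ?t (cxm X) (cxm Y)))"
      by (rule push_gproj[OF u0 subspace_diff[OF subspace_galg g(1,2)]])
        (use in1 X Y in \<open>simp add: lin pr gbr_cxm_cxm\<close>)
    also have "gproj (-1) (?t X Y - ?t (cxm X) (cxm Y)) = ?a"
      using in1 X Y by (simp add: lin pr gbr_cxm_cxm K_def c0)
    finally show ?thesis .
  qed
  have b: "push u0 (?t X (cxm Y)) + push u0 (?t (cxm X) Y) = push u0 ?b"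
  proof -
    have "push u0 (?t X (cxm Y)) + push u0 (?t (cxm X) Y) = push u0 (?t X (cxm Y) + ?t (cxm X) Y)"
      using push_add[OF u0 g(3,4)] by simp
    also have "\<dots> = push u0 (gproj (-1) (?t X (cxm Y) + ?t (cxm X) Y))"
      by (rule push_gproj[OF u0 subspace_add[OF subspace_galg g(3,4)]])
        (use in1 X Y gbr_cxm_add[OF X Y] in \<open>simp add: lin pr\<close>)
    also have "gproj (-1) (?t X (cxm Y) + ?t (cxm X) Y) = ?b"
      using in1 X Y by (simp add: lin pr K_def c0)
    finally show ?thesis .
  qed
  have Xg: "X \<in> galg" "Y \<in> galg" "cxm X \<in> galg" "cxm Y \<in> galg" using X Y in1 ggr_subset_galg by blast+
  \<comment> \<open>Written with \<open>br\<close>, both sides are combinations of the same four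
    derivatives of \<open>\<phi> X\<close> and \<open>\<phi> Y\<close>; they match because
    \<open>I\<close> squares to minus the identity.\<close>
  have "E0 (push u0 ?b) = I (E0 (push u0 ?a))"
    unfolding a[symmetric] b[symmetric] linear_diff[OF E0] linear_add[OF E0] br[OF Xg(1,2)] br[OF Xg(3,4)]
      br[OF Xg(1,4)] br[OF Xg(3,2)] \<phi>'_cxm[OF X] \<phi>'_cxm[OF Y] linear_diff[OF I(1)] I(2)
    by simp
  have zero: "0 \<in> ggr (-1)" by (rule subspace_0[OF subspace_ggr])
  have ab: "?a \<in> ggr (-1)" "?b \<in> ggr (-1)"
    unfolding K_def
    by (intro subspace_add[OF subspace_ggr] subspace_diff[OF subspace_ggr] gproj_curvature_in cxm_in_ggr X Y zero)+
  have tc: "tcoord A d (p u0) v = v" for v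
    using base.tcoord_chart_at[OF proj_in[OF u0]] by (simp add: d_def)
  have "I (E0 (push u0 ?a)) = E0 (push u0 (cxm ?a))"
    using hol[OF u0 d_in(2) ab(1)] by (simp add: E0_def tc)
  with \<open>E0 (push u0 ?b) = _\<close> have "push u0 ?b = push u0 (cxm ?a)"
    using inj unfolding E0_def by (metis injD)
  then have "cxm ?a = ?b" using push_inj[OF u0 ab(2) cxm_in_ggr[OF ab(1)]] by simp
  then show ?thesis
    using curvature_aa_zero_iff[OF X Y zero zero, of K] K_def by blast
qed

end

text \<open>The chart extends to a smooth map \<Phi> on an open set of the ambient space, which is a
  left inverse of \<open>cinv c\<close>; by the chain rule the derivative of \<open>cinv c\<close>
  has a left inverse too.\<close>

lemma submanifold_chart_cinv:
  assumes "c \<in> submanifold_charts S"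
  shows "smooth_on (snd c ` fst c) (cinv c)"
    "x \<in> fst c \<Longrightarrow> inj (frechet_derivative (cinv c) (at (snd c x)))"
proof -
  obtain W \<Phi> where W: "open W" "fst c = S \<inter> W" "smooth_on W \<Phi>" "\<And>x. x \<in> fst c \<Longrightarrow> snd c x = \<Phi> x"
    "inj_on (snd c) (fst c)" "open (snd c ` fst c)" and s: "smooth_on (snd c ` fst c) (inv_into (fst c) (snd c))"
    using assms unfolding submanifold_charts_def by (cases c) auto
  show sm: "smooth_on (snd c ` fst c) (cinv c)"
    using s unfolding cinv_def by simp
  assume x: "x \<in> fst c"
  have cx: "cinv c (snd c z) = z" if "z \<in> fst c" for z using W(5) that by (simp add: cinv_def)
  have 1: "(cinv c has_derivative frechet_derivative (cinv c) (at (snd c x))) (at (snd c x))"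
    using smooth_on_has_derivative[OF sm] x by blast
  have 2: "(\<Phi> has_derivative frechet_derivative \<Phi> (at x)) (at (cinv c (snd c x)))"
    using smooth_on_has_derivative[OF W(3)] x W(2) cx by auto
  have "((\<lambda>y. y) has_derivative (\<lambda>v. frechet_derivative \<Phi> (at x) (frechet_derivative (cinv c) (at (snd c x)) v))) (at (snd c x))"
    by (rule has_derivative_transform_within_open[OF has_derivative_compose[OF 1 2] W(6)])
      (use x cx W(4) in auto)
  from has_derivative_unique[OF this has_derivative_ident]
  have "frechet_derivative \<Phi> (at x) (frechet_derivative (cinv c) (at (snd c x)) v) = v" for v
    by metis
  then show "inj (frechet_derivative (cinv c) (at (snd c x)))" by (metis injI)
qed

lemma emb_diff_tcoord:
  assumes M: "smooth_atlas (emb_atlas M)" and d: "d \<in> emb_atlas M" "x \<in> fst d"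
  shows "emb_diff M x v = frechet_derivative (cinv d) (at (snd d x)) (tcoord (emb_atlas M) d x v)"
proof -
  interpret atlas "emb_atlas M" by (rule atlas.intro[OF M])
  define e where "e = chart_at (emb_atlas M) x"
  have e: "e \<in> emb_atlas M" "x \<in> fst e"
    unfolding e_def using chart_at_in in_mcarrier[OF d] by auto
  have "(cinv d has_derivative frechet_derivative (cinv d) (at (snd d x))) (at ((snd d \<circ> cinv e) (snd e x)))"
    using smooth_on_has_derivative[OF submanifold_chart_cinv(1)[OF d(1)]] d e by simp
  from has_derivative_compose[OF transition_has_derivative[OF e(1) d(1) e(2) d(2)] this]
  have "(cinv e has_derivative (\<lambda>v. frechet_derivative (cinv d) (at (snd d x))
      (frechet_derivative (snd d \<circ> cinv e) (at (snd e x)) v))) (at (snd e x))"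
  proof (rule has_derivative_transform_within_open)
    show "open (snd e ` (fst e \<inter> fst d))" by (rule open_chart_overlap[OF e(1) d(1)])
  qed (use d e in auto)
  from fun_cong[OF frechet_derivative_at[OF this], of v]
  show ?thesis by (simp add: emb_diff_def tcoord_def e_def Let_def)
qed

text \<open>The immersion is \<open>cinv d\<close>, that is, the inclusion of \<open>M\<close> read
  in the chart \<open>d\<close>, with multiplication by \<open>\<i>\<close> as \<open>I\<close>. The
  condition \<open>hol\<close> is the complex linearity built into
  \<open>emb_frames\<close>.\<close>

lemma embedded_curvature_aa:
  assumes geom: "canonical_cartan_geometry (emb_atlas M) (emb_CR_space M) (emb_frames M) B p r \<omega>"
    and u: "u \<in> mcarrier B" and X: "X \<in> ggr (-1)" and Y: "Y \<in> ggr (-1)"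
  shows "curvature_aa B \<omega> u X Y = 0"
proof -
  interpret framed_geometry_at "emb_atlas M" B p r \<omega> "emb_CR_space M" "emb_frames M" u
    by unfold_locales (use geom u in \<open>auto simp: canonical_cartan_geometry_def emb_frames_def\<close>)
  have smul: "linear (\<lambda>v :: complex^4. \<i> *s v)"
    by (rule linearI) (auto simp: vec_eq_iff algebra_simps)
  show ?thesis
  proof (rule curvature_aa_zero_if_CR_immersion[where F = "cinv d" and I = "\<lambda>v. \<i> *s v", OF _ smul _ _ _ X Y])
    show "smooth_on (snd d ` fst d) (cinv d)"
      by (rule submanifold_chart_cinv(1)[OF d_in(1)])
    show "\<i> *s (\<i> *s v) = - v" for v :: "complex^4"
      by (simp add: vec_eq_iff)
    show "inj (frechet_derivative (cinv d) (at (snd d (p u))))"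
      by (rule submanifold_chart_cinv(2)[OF d_in])
    fix u' Z assume u': "u' \<in> mcarrier B" "p u' \<in> fst d" and Z: "Z \<in> ggr (-1)"
    have "frame u' \<in> emb_frames M (p u')"
      using Fr_eq[OF proj_in[OF u'(1)]] u'(1) by blast
    then have "emb_diff M (p u') (snd (frame u') (cxm Z)) = \<i> *s emb_diff M (p u') (snd (frame u') Z)"
      using Z unfolding emb_frames_def by blast
    then have "emb_diff M (p u') (push u' (cxm Z)) = \<i> *s emb_diff M (p u') (push u' Z)"
      using Z cxm_in_ggr[OF Z] by (simp add: frame_def)
    then show "frechet_derivative (cinv d) (at (snd d (p u'))) (tcoord (emb_atlas M) d (p u') (push u' (cxm Z))) =
      \<i> *s frechet_derivative (cinv d) (at (snd d (p u'))) (tcoord (emb_atlas M) d (p u') (push u' Z))"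
      unfolding emb_diff_tcoord[OF smooth_atlas_base d_in(1) u'(2)] .
  qed
qed

theorem theorem3p6:
  fixes A :: "('m, real^6) chart set" and E :: "'m \<Rightarrow> (real^6) set"
    and Fr :: "'m \<Rightarrow> (real^6) gframe set"
    and B :: "('g, real^16) chart set" and p :: "'g \<Rightarrow> 'm" and r :: "'g \<Rightarrow> gelt \<Rightarrow> 'g"
    and \<omega> :: "'g \<Rightarrow> real^16 \<Rightarrow> gvec"
    and M :: "(complex^4) set"
    and B' :: "('h, real^16) chart set" and p' :: "'h \<Rightarrow> complex^4" and r' :: "'h \<Rightarrow> gelt \<Rightarrow> 'h"
    and \<omega>' :: "'h \<Rightarrow> real^16 \<Rightarrow> gvec"
  shows "(abstract_hyperbolic_CR A E Fr \<and> canonical_cartan_geometry A E Fr B p r \<omega> \<longrightarrow>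
           (integrable_J A E (canonical_J A B p \<omega>) \<longleftrightarrow>
             (\<forall>u\<in>mcarrier B. \<forall>X\<in>ggr (-1). \<forall>Y\<in>ggr (-1). curvature_aa B \<omega> u X Y = 0)))
       \<and>
         (embedded_hyperbolic_CR M \<and>
          canonical_cartan_geometry (emb_atlas M) (emb_CR_space M) (emb_frames M) B' p' r' \<omega>' \<longrightarrow>
            (\<forall>u\<in>mcarrier B'. \<forall>X\<in>ggr (-1). \<forall>Y\<in>ggr (-1). curvature_aa B' \<omega>' u X Y = 0))"
proof (intro conjI impI)
  assume *: "abstract_hyperbolic_CR A E Fr \<and> canonical_cartan_geometry A E Fr B p r \<omega>"
  interpret hyperbolic_geometry A B p r \<omega> E Fr
    by unfold_locales
      (use * in \<open>auto simp: abstract_hyperbolic_CR_def canonical_cartan_geometry_def regular_gP_structure_def\<close>)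
  show "integrable_J A E (canonical_J A B p \<omega>) \<longleftrightarrow>
      (\<forall>u\<in>mcarrier B. \<forall>X\<in>ggr (-1). \<forall>Y\<in>ggr (-1). curvature_aa B \<omega> u X Y = 0)"
    by (rule integrable_J_iff)
next
  assume "embedded_hyperbolic_CR M \<and>
    canonical_cartan_geometry (emb_atlas M) (emb_CR_space M) (emb_frames M) B' p' r' \<omega>'"
  then show "\<forall>u\<in>mcarrier B'. \<forall>X\<in>ggr (-1). \<forall>Y\<in>ggr (-1). curvature_aa B' \<omega>' u X Y = 0"
    by (intro ballI) (rule embedded_curvature_aa, elim conjE)
qed

end
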